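(* Let $\mathcal{P}=\mathcal{T}(V)/(R)$ be a binary quadratic operad (with finite-dimensional space of generators $V$). Then there is an isomorphism of operads $$\mathrm{TSu}(\mathcal{P})\;\cong\;\mathit{PostLie}\bullet\mathcal{P},$$ where $\mathrm{TSu}(\mathcal P)$ is the trisuccessor of $\mathcal P$ and $\bullet$ is the Manin black product.
   Context: Fix a field $\mathbf{k}$. Operads are symmetric operads in $\mathbf{k}$-vector spaces (right actions of the symmetric groups $\mathbb{S}_n$). **Free operad.** For an $\mathbb{S}_2$-module $V$ (seen as an $\mathbb S$-module concentrated in arity 2), $\mathcal{T}(V)$ is the free operad on $V$. $\mathcal{T}(V)(n)$ is spanned by planar binary rooted trees with $n$ leaves labeled bijectively by $\{1,\dots,n\}$ and each vertex labeled by an element of $V$; such trees are multilinear in the vertex labels, and exchanging the left and right subtrees of a vertex labeled $\omega$ gives the same element after replacing $\omega$ by $\omega^{(12)}$. A binary operad is an operad $\mathcal{P}=\mathcal{T}(V)/(R)$ with $R$ spanned, as an $\mathbb S$-module, by homogeneous elements (each lying in some $\mathcal{T}(V)(n)$). It is quadratic if $R\subseteq\mathcal{T}(V)(3)$ ($R$ an $\mathbb S_3$-submodule). **Trisuccessor.** Let $\widehat V=V\otimes(\mathbf{k}\prec\oplus\,\mathbf{k}\succ\oplus\,\mathbf{k}\,\cdot\,)$, write $\omega_\prec=\omega\otimes\prec$, $\omega_\succ=\omega\otimes\succ$, $\omega_{\cdot}=\omega\otimes\cdot$, $\omega_\star=\omega_\prec+\omega_\succ+\omega_\cdot$, with $\mathbb{S}_2$-action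 $(\omega_\prec)^{(12)}=(\omega^{(12)})_\succ$, $(\omega_\succ)^{(12)}=(\omega^{(12)})_\prec$, $(\omega_\cdot)^{(12)}=(\omega^{(12)})_\cdot$. For a labeled tree $\tau$ and a nonempty set $J$ of leaves of $\tau$, $\mathrm{TSu}_J(\tau)$ is obtained by relabeling vertices: a vertex labeled $\omega$ lying on at least one of the paths from the root to the leaves in $J$ gets the label $\omega_\prec$ if all such paths through it turn left there, $\omega_\succ$ if all turn right there, and $\omega_\cdot$ if some turn left and some turn right; every other vertex labeled $\omega$ gets the label $\omega_\star$. This extends linearly to $\mathrm{TSu}_J:\mathcal{T}(V)(n)\to\mathcal{T}(\widehat V)(n)$. The trisuccessor of $\mathcal{P}$ is $\mathrm{TSu}(\mathcal{P})=\mathcal{T}(\widehat V)/(\mathrm{TSu}(R))$, where $\mathrm{TSu}(R)$ consists of all $\mathrm{TSu}_J(r)$, $r\in R$ homogeneous of arity $n$, $\emptyset\neq J\subseteq\{1,\dots,n\}$. **PostLie.** $\mathit{PostLie}$ is the operad of PostLie algebras: a bilinear operation $\circ$ and a skew-symmetric bilinear operation $[\,,]$ with $[[x,y],z]+[[z,x],y]+[[y,z],x]=0$; $(x\circ y)\circ z-x\circ(y\circ z)-(x\circ z)\circ y+x\circ(z\circ y)-x\circ[y,z]=0$; $[x,y]\circ z-[x\circ z,y]-[x,y\circ z]=0$. **Manin black product.** For $\omega,\nu\in V$ let $\omega\circ_{\rm I}\nu$, $\omega\circ_{\rm II}\nu$, $\omega\circ_{\rm III}\nu$ be the elements of $\mathcal{T}(V)(3)$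 given by $\omega(\nu(x,y),z)$, $\omega(\nu(y,z),x)$, $\omega(\nu(z,x),y)$ respectively (inputs $x,y,z$ = leaves $1,2,3$). Then $\mathcal{T}(V)(3)=\bigoplus_{u\in\{\rm I,II,III\}}V\circ_uV$, each summand being a copy of $V\otimes V$. For binary quadratic operads $\mathcal{P}=\mathcal{T}(V)/(R)$, $\mathcal{Q}=\mathcal{T}(W)/(S)$ with finite-dimensional generating spaces, put $$\mathcal{P}\bullet\mathcal{Q}=\mathcal{T}(V\otimes W\otimes \mathrm{sgn}_{\mathbb{S}_2})/(\Psi(R\otimes S)),$$ where $\Psi:\mathcal T(V)(3)\otimes\mathcal T(W)(3)\to\mathcal T(V\otimes W\otimes\mathrm{sgn}_{\mathbb S_2})(3)$ sends $(\omega\circ_u\nu)\otimes(\omega'\circ_v\nu')$ to $(\omega\otimes\omega'\otimes1)\circ_u(\nu\otimes\nu'\otimes1)$ if $u=v$ and to $0$ if $u\ne v$. *)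

theory Defs
  imports
    "HOL-Library.Poly_Mapping"
    "HOL-Combinatorics.Permutations"
    "HOL-Algebra.AbelCoset"
    "Jordan_Normal_Form.VS_Connect"
begin

section \<open>Vector spaces over a field\<close>

text \<open>
  The field is a type \<open>'k :: field\<close>, turned into a ring record by \<^term>\<open>class_ring\<close>.
  A vector space is a record of type \<open>('k, 'a) module\<close>; the components \<open>mult\<close> and \<open>one\<close>, which
  that record inherits from rings, play no role and are left unspecified below.
\<close>

abbreviation linear_maps ::
    "('k::field, 'a, 'm) module_scheme \<Rightarrow> ('k, 'b, 'n) module_scheme \<Rightarrow> ('a \<Rightarrow> 'b) set"
  where "linear_maps M N \<equiv> LinearCombinations.module_hom class_ring M N"

abbreviation subspace_of :: "'a set \<Rightarrow> ('k::field, 'a, 'm) module_scheme \<Rightarrow> bool"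
  where "subspace_of U M \<equiv> LinearCombinations.submodule class_ring U M"

abbreviation span_in :: "('k::field, 'a, 'm) module_scheme \<Rightarrow> 'a set \<Rightarrow> 'a set"
  where "span_in M S \<equiv> LinearCombinations.module.span class_ring M S"

definition free_vs :: "'x set \<Rightarrow> ('k::field, 'x \<Rightarrow>\<^sub>0 'k) module" where
  "free_vs X =
     \<lparr>carrier = {p. Poly_Mapping.keys p \<subseteq> X}, mult = undefined, one = undefined,
      zero = 0, add = (+), smult = (\<lambda>c. Poly_Mapping.map ((*) c))\<rparr>"

text \<open>The linear and bilinear extensions of maps between bases.\<close>

definition push :: "('x \<Rightarrow> 'y) \<Rightarrow> ('x \<Rightarrow>\<^sub>0 'k::field) \<Rightarrow> ('y \<Rightarrow>\<^sub>0 'k)" where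
  "push g p = (\<Sum>x\<in>Poly_Mapping.keys p. Poly_Mapping.single (g x) (Poly_Mapping.lookup p x))"

definition push2 ::
    "('x \<Rightarrow> 'y \<Rightarrow> 'z) \<Rightarrow> ('x \<Rightarrow>\<^sub>0 'k::field) \<Rightarrow> ('y \<Rightarrow>\<^sub>0 'k) \<Rightarrow> ('z \<Rightarrow>\<^sub>0 'k)" where
  "push2 g p q = (\<Sum>x\<in>Poly_Mapping.keys p. \<Sum>y\<in>Poly_Mapping.keys q.
     Poly_Mapping.single (g x y) (Poly_Mapping.lookup p x * Poly_Mapping.lookup q y))"

text \<open>
  The elements of \<open>M / U\<close> are cosets. As for factor rings in the library, an operation on cosets is
  the union of the cosets obtained from all representatives; whenever the operation is well defined,
  all these cosets coincide.
\<close>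

definition quot_vs ::
    "('k::field, 'a, 'm) module_scheme \<Rightarrow> 'a set \<Rightarrow> ('k, 'a set) module" where
  "quot_vs M U =
     \<lparr>carrier = a_rcosets\<^bsub>M\<^esub> U, mult = undefined, one = undefined,
      zero = U, add = set_add M, smult = (\<lambda>c A. \<Union>a\<in>A. U +>\<^bsub>M\<^esub> (c \<odot>\<^bsub>M\<^esub> a))\<rparr>"


section \<open>Tensor products\<close>

definition bilinearity_relations ::
    "('k::field, 'v, 'm) module_scheme \<Rightarrow> ('k, 'w, 'n) module_scheme \<Rightarrow> ('v \<times> 'w \<Rightarrow>\<^sub>0 'k) set" where
  "bilinearity_relations V W =
     {Poly_Mapping.single (a \<oplus>\<^bsub>V\<^esub> b, w) 1 - Poly_Mapping.single (a, w) 1 - Poly_Mapping.single (b, w) 1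
       | a b w. a \<in> carrier V \<and> b \<in> carrier V \<and> w \<in> carrier W}
   \<union> {Poly_Mapping.single (v, a \<oplus>\<^bsub>W\<^esub> b) 1 - Poly_Mapping.single (v, a) 1 - Poly_Mapping.single (v, b) 1
       | v a b. v \<in> carrier V \<and> a \<in> carrier W \<and> b \<in> carrier W}
   \<union> {Poly_Mapping.single (c \<odot>\<^bsub>V\<^esub> v, w) 1 - Poly_Mapping.single (v, w) c
       | c v w. v \<in> carrier V \<and> w \<in> carrier W}
   \<union> {Poly_Mapping.single (v, c \<odot>\<^bsub>W\<^esub> w) 1 - Poly_Mapping.single (v, w) c
       | c v w. v \<in> carrier V \<and> w \<in> carrier W}"

definition tensor_class ::
    "('k::field, 'v, 'm) module_scheme \<Rightarrow> ('k, 'w, 'n) module_scheme \<Rightarrow>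
     ('v \<times> 'w \<Rightarrow>\<^sub>0 'k) \<Rightarrow> ('v \<times> 'w \<Rightarrow>\<^sub>0 'k) set" where
  "tensor_class V W p =
     (let F = free_vs (carrier V \<times> carrier W)
      in span_in F (bilinearity_relations V W) +>\<^bsub>F\<^esub> p)"

definition tensor_vs ::
    "('k::field, 'v, 'm) module_scheme \<Rightarrow> ('k, 'w, 'n) module_scheme \<Rightarrow>
     ('k, ('v \<times> 'w \<Rightarrow>\<^sub>0 'k) set) module" where
  "tensor_vs V W =
     (let F = free_vs (carrier V \<times> carrier W)
      in quot_vs F (span_in F (bilinearity_relations V W)))"

definition pure_tensor ::
    "('k::field, 'v, 'm) module_scheme \<Rightarrow> ('k, 'w, 'n) module_scheme \<Rightarrow>
     'v \<Rightarrow> 'w \<Rightarrow> ('v \<times> 'w \<Rightarrow>\<^sub>0 'k) set" where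
  "pure_tensor V W v w = tensor_class V W (Poly_Mapping.single (v, w) 1)"


section \<open>Modules over the symmetric group on two letters\<close>

text \<open>\<open>swap V\<close> is the action of the transposition \<open>(12)\<close>.\<close>

record ('k, 'v) s2_module = "('k, 'v) module" +
  swap :: "'v \<Rightarrow> 'v"

locale s2_module = vectorspace class_ring V
  for V :: "('k::field, 'v) s2_module" +
  assumes swap_linear: "swap V \<in> linear_maps V V"
    and swap_swap: "x \<in> carrier V \<Longrightarrow> swap V (swap V x) = x"

definition with_swap :: "('k, 'v) module \<Rightarrow> ('v \<Rightarrow> 'v) \<Rightarrow> ('k, 'v) s2_module" where
  "with_swap M s =
     \<lparr>carrier = carrier M, mult = mult M, one = one M, zero = zero M, add = add M,
      smult = module.smult M, swap = s\<rparr>"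

definition tensor_s2 ::
    "('k::field, 'v) s2_module \<Rightarrow> ('k, 'w) s2_module \<Rightarrow>
     ('k, ('v \<times> 'w \<Rightarrow>\<^sub>0 'k) set) s2_module" where
  "tensor_s2 V W =
     with_swap (tensor_vs V W)
       (\<lambda>A. \<Union>p\<in>A. tensor_class V W (push (map_prod (swap V) (swap W)) p))"

definition sgn_s2 :: "('k::field, 'k) s2_module" where
  "sgn_s2 =
     \<lparr>carrier = UNIV, mult = undefined, one = undefined, zero = 0, add = (+),
      smult = (*), swap = uminus\<rparr>"


section \<open>Symmetric operads\<close>

text \<open>
  Operads are presented by partial compositions: \<open>pcomp P m n i x y\<close> is \<open>x \<circ>\<^sub>i y\<close> for \<open>x\<close> of arity
  \<open>m\<close> and \<open>y\<close> of arity \<open>n\<close>, an element of arity \<open>m + n - 1\<close>. The symmetric group on \<open>n\<close> letters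
  consists of the functions \<open>\<sigma>\<close> with \<open>\<sigma> permutes {1..n}\<close>, and \<open>sym_act P n \<sigma> x\<close> is \<open>x\<^sup>\<sigma>\<close> (right action).
\<close>

record ('k, 'a) operad =
  arity_space :: "nat \<Rightarrow> ('k, 'a) module"
  sym_act :: "nat \<Rightarrow> (nat \<Rightarrow> nat) \<Rightarrow> 'a \<Rightarrow> 'a"
  op_unit :: 'a
  pcomp :: "nat \<Rightarrow> nat \<Rightarrow> nat \<Rightarrow> 'a \<Rightarrow> 'a \<Rightarrow> 'a"

abbreviation ops :: "('k, 'a) operad \<Rightarrow> nat \<Rightarrow> 'a set" where
  "ops P n \<equiv> carrier (arity_space P n)"

text \<open>
  Inserting an operation of arity \<open>n\<close> at input \<open>i\<close> renumbers each other input \<open>j\<close> as \<open>shift_input i n j\<close>.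
  The permutations \<open>perm_inner\<close> and \<open>perm_outer\<close> are \<open>1 \<circ>\<^sub>i \<sigma>\<close> and \<open>\<sigma> \<circ>\<^sub>i 1\<close>, where \<open>1\<close> has arity \<open>n\<close> in the second.
\<close>

definition shift_input :: "nat \<Rightarrow> nat \<Rightarrow> nat \<Rightarrow> nat" where
  "shift_input i n j = (if j < i then j else j + n - 1)"

definition perm_inner :: "nat \<Rightarrow> nat \<Rightarrow> (nat \<Rightarrow> nat) \<Rightarrow> nat \<Rightarrow> nat" where
  "perm_inner i n \<sigma> j = (if i \<le> j \<and> j < i + n then \<sigma> (j + 1 - i) + i - 1 else j)"

definition perm_outer :: "nat \<Rightarrow> nat \<Rightarrow> (nat \<Rightarrow> nat) \<Rightarrow> nat \<Rightarrow> nat" where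
  "perm_outer i n \<sigma> j =
     (if j < i then shift_input (\<sigma> i) n (\<sigma> j)
      else if j < i + n then \<sigma> i + (j - i)
      else shift_input (\<sigma> i) n (\<sigma> (j + 1 - n)))"

locale operad =
  fixes P :: "('k::field, 'a) operad"
  assumes arity_vectorspace: "vectorspace class_ring (arity_space P n)"
    and act_linear:
      "\<sigma> permutes {1..n} \<Longrightarrow> sym_act P n \<sigma> \<in> linear_maps (arity_space P n) (arity_space P n)"
    and act_id: "x \<in> ops P n \<Longrightarrow> sym_act P n id x = x"
    and act_comp:
      "\<lbrakk>\<sigma> permutes {1..n}; \<tau> permutes {1..n}; x \<in> ops P n\<rbrakk> \<Longrightarrow>
         sym_act P n (\<sigma> \<circ> \<tau>) x = sym_act P n \<tau> (sym_act P n \<sigma> x)"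
    and unit_closed: "op_unit P \<in> ops P 1"
    and pcomp_linear_left:
      "\<lbrakk>i \<in> {1..m}; y \<in> ops P n\<rbrakk> \<Longrightarrow>
         (\<lambda>x. pcomp P m n i x y) \<in> linear_maps (arity_space P m) (arity_space P (m + n - 1))"
    and pcomp_linear_right:
      "\<lbrakk>i \<in> {1..m}; x \<in> ops P m\<rbrakk> \<Longrightarrow>
         (\<lambda>y. pcomp P m n i x y) \<in> linear_maps (arity_space P n) (arity_space P (m + n - 1))"
    and unit_left: "y \<in> ops P n \<Longrightarrow> pcomp P 1 n 1 (op_unit P) y = y"
    and unit_right: "\<lbrakk>i \<in> {1..m}; x \<in> ops P m\<rbrakk> \<Longrightarrow> pcomp P m 1 i x (op_unit P) = x"
    and sequential_assoc:
      "\<lbrakk>i \<in> {1..l}; j \<in> {1..m}; x \<in> ops P l; y \<in> ops P m; z \<in> ops P n\<rbrakk> \<Longrightarrow>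
         pcomp P (l + m - 1) n (i + j - 1) (pcomp P l m i x y) z =
         pcomp P l (m + n - 1) i x (pcomp P m n j y z)"
    and parallel_assoc:
      "\<lbrakk>1 \<le> i; i < k; k \<le> l; x \<in> ops P l; y \<in> ops P m; z \<in> ops P n\<rbrakk> \<Longrightarrow>
         pcomp P (l + m - 1) n (k + m - 1) (pcomp P l m i x y) z =
         pcomp P (l + n - 1) m i (pcomp P l n k x z) y"
    and equivariant_inner:
      "\<lbrakk>i \<in> {1..m}; \<sigma> permutes {1..n}; x \<in> ops P m; y \<in> ops P n\<rbrakk> \<Longrightarrow>
         pcomp P m n i x (sym_act P n \<sigma> y) =
         sym_act P (m + n - 1) (perm_inner i n \<sigma>) (pcomp P m n i x y)"
    and equivariant_outer:
      "\<lbrakk>i \<in> {1..m}; \<sigma> permutes {1..m}; x \<in> ops P m; y \<in> ops P n\<rbrakk> \<Longrightarrow>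
         pcomp P m n i (sym_act P m \<sigma> x) y =
         sym_act P (m + n - 1) (perm_outer i n \<sigma>) (pcomp P m n (\<sigma> i) x y)"

definition operad_hom ::
    "('k::field, 'a) operad \<Rightarrow> ('k, 'b) operad \<Rightarrow> (nat \<Rightarrow> 'a \<Rightarrow> 'b) set" where
  "operad_hom P Q = {\<phi>.
     (\<forall>n. \<phi> n \<in> linear_maps (arity_space P n) (arity_space Q n)) \<and>
     (\<forall>n \<sigma> x. \<sigma> permutes {1..n} \<and> x \<in> ops P n \<longrightarrow>
        \<phi> n (sym_act P n \<sigma> x) = sym_act Q n \<sigma> (\<phi> n x)) \<and>
     \<phi> 1 (op_unit P) = op_unit Q \<and>
     (\<forall>m n i x y. i \<in> {1..m} \<and> x \<in> ops P m \<and> y \<in> ops P n \<longrightarrow>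
        \<phi> (m + n - 1) (pcomp P m n i x y) = pcomp Q m n i (\<phi> m x) (\<phi> n y))}"

definition operad_isomorphic :: "('k::field, 'a) operad \<Rightarrow> ('k, 'b) operad \<Rightarrow> bool" where
  "operad_isomorphic P Q \<longleftrightarrow>
     operad P \<and> operad Q \<and>
     (\<exists>\<phi>\<in>operad_hom P Q. \<forall>n. bij_betw (\<phi> n) (ops P n) (ops Q n))"

definition sym_submodule :: "('k::field, 'a) operad \<Rightarrow> nat \<Rightarrow> 'a set \<Rightarrow> bool" where
  "sym_submodule P n U \<longleftrightarrow>
     subspace_of U (arity_space P n) \<and>
     (\<forall>\<sigma> x. \<sigma> permutes {1..n} \<and> x \<in> U \<longrightarrow> sym_act P n \<sigma> x \<in> U)"

definition operad_ideal :: "('k::field, 'a) operad \<Rightarrow> (nat \<Rightarrow> 'a set) \<Rightarrow> bool" where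
  "operad_ideal P I \<longleftrightarrow>
     (\<forall>n. sym_submodule P n (I n)) \<and>
     (\<forall>m n i x y. i \<in> {1..m} \<and> x \<in> I m \<and> y \<in> ops P n \<longrightarrow> pcomp P m n i x y \<in> I (m + n - 1)) \<and>
     (\<forall>m n i x y. i \<in> {1..m} \<and> x \<in> ops P m \<and> y \<in> I n \<longrightarrow> pcomp P m n i x y \<in> I (m + n - 1))"

definition generated_ideal ::
    "('k::field, 'a) operad \<Rightarrow> (nat \<Rightarrow> 'a set) \<Rightarrow> nat \<Rightarrow> 'a set" where
  "generated_ideal P R n = \<Inter>{I n | I. operad_ideal P I \<and> (\<forall>m. R m \<subseteq> I m)}"

definition quot_operad ::
    "('k::field, 'a) operad \<Rightarrow> (nat \<Rightarrow> 'a set) \<Rightarrow> ('k, 'a set) operad" where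
  "quot_operad P I =
     \<lparr>arity_space = (\<lambda>n. quot_vs (arity_space P n) (I n)),
      sym_act = (\<lambda>n \<sigma> A. \<Union>x\<in>A. I n +>\<^bsub>arity_space P n\<^esub> sym_act P n \<sigma> x),
      op_unit = I 1 +>\<^bsub>arity_space P 1\<^esub> op_unit P,
      pcomp = (\<lambda>m n i A B. \<Union>x\<in>A. \<Union>y\<in>B.
        I (m + n - 1) +>\<^bsub>arity_space P (m + n - 1)\<^esub> pcomp P m n i x y)\<rparr>"


section \<open>Free operads on binary generators\<close>

datatype (labels: 'v) ptree = Leaf nat | Node 'v "'v ptree" "'v ptree"

primrec leaves :: "'v ptree \<Rightarrow> nat list" where
  "leaves (Leaf j) = [j]"
| "leaves (Node v l r) = leaves l @ leaves r"

primrec relabel :: "(nat \<Rightarrow> nat) \<Rightarrow> 'v ptree \<Rightarrow> 'v ptree" where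
  "relabel f (Leaf j) = Leaf (f j)"
| "relabel f (Node v l r) = Node v (relabel f l) (relabel f r)"

text \<open>\<open>graft i n t s\<close> inserts the tree \<open>s\<close> with \<open>n\<close> leaves at the leaf \<open>i\<close> of \<open>t\<close>.\<close>

primrec graft :: "nat \<Rightarrow> nat \<Rightarrow> 'v ptree \<Rightarrow> 'v ptree \<Rightarrow> 'v ptree" where
  "graft i n (Leaf j) s = (if j = i then relabel (\<lambda>k. k + i - 1) s else Leaf (shift_input i n j))"
| "graft i n (Node v l r) s = Node v (graft i n l s) (graft i n r s)"

definition trees :: "('k, 'v) s2_module \<Rightarrow> nat \<Rightarrow> 'v ptree set" where
  "trees V n = {t. labels t \<subseteq> carrier V \<and> distinct (leaves t) \<and> set (leaves t) = {1..n}}"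

text \<open>Trees with one hole, as functions of the tree to be put into the hole.\<close>

inductive tree_context :: "('v ptree \<Rightarrow> 'v ptree) \<Rightarrow> bool" where
  hole: "tree_context (\<lambda>t. t)"
| left: "tree_context C \<Longrightarrow> tree_context (\<lambda>t. Node v (C t) r)"
| right: "tree_context C \<Longrightarrow> tree_context (\<lambda>t. Node v l (C t))"

text \<open>Linearity in each vertex label, and exchange of the two subtrees of a vertex.\<close>

definition tree_relations :: "('k::field, 'v) s2_module \<Rightarrow> nat \<Rightarrow> ('v ptree \<Rightarrow>\<^sub>0 'k) set" where
  "tree_relations V n =
     {Poly_Mapping.single (C (Node (a \<oplus>\<^bsub>V\<^esub> b) l r)) 1
        - Poly_Mapping.single (C (Node a l r)) 1 - Poly_Mapping.single (C (Node b l r)) 1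
       | C a b l r. tree_context C \<and> C (Node a l r) \<in> trees V n \<and> C (Node b l r) \<in> trees V n}
   \<union> {Poly_Mapping.single (C (Node (c \<odot>\<^bsub>V\<^esub> a) l r)) 1 - Poly_Mapping.single (C (Node a l r)) c
       | C a c l r. tree_context C \<and> C (Node a l r) \<in> trees V n}
   \<union> {Poly_Mapping.single (C (Node a l r)) 1 - Poly_Mapping.single (C (Node (swap V a) r l)) 1
       | C a l r. tree_context C \<and> C (Node a l r) \<in> trees V n}"

definition tree_class ::
    "('k::field, 'v) s2_module \<Rightarrow> nat \<Rightarrow> ('v ptree \<Rightarrow>\<^sub>0 'k) \<Rightarrow> ('v ptree \<Rightarrow>\<^sub>0 'k) set" where
  "tree_class V n p =
     (let F = free_vs (trees V n) in span_in F (tree_relations V n) +>\<^bsub>F\<^esub> p)"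

text \<open>
  In \<open>\<mu>\<^sup>\<sigma>(x\<^sub>1, \<dots>, x\<^sub>n) = \<mu>(x\<^bsub>\<sigma>\<inverse>(1)\<^esub>, \<dots>, x\<^bsub>\<sigma>\<inverse>(n)\<^esub>)\<close> the input \<open>j\<close> of \<open>\<mu>\<close> receives the label
  \<open>\<sigma>\<inverse>(j)\<close>; this is a right action.
\<close>

definition free_operad ::
    "('k::field, 'v) s2_module \<Rightarrow> ('k, ('v ptree \<Rightarrow>\<^sub>0 'k) set) operad" where
  "free_operad V =
     \<lparr>arity_space = (\<lambda>n. let F = free_vs (trees V n) in quot_vs F (span_in F (tree_relations V n))),
      sym_act = (\<lambda>n \<sigma> A. \<Union>p\<in>A. tree_class V n (push (relabel (inv_into UNIV \<sigma>)) p)),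
      op_unit = tree_class V 1 (Poly_Mapping.single (Leaf 1) 1),
      pcomp = (\<lambda>m n i A B. \<Union>p\<in>A. \<Union>q\<in>B. tree_class V (m + n - 1) (push2 (graft i n) p q))\<rparr>"

text \<open>
  The binary operad with generators \<open>V\<close> and relations \<open>R\<close>; \<open>R n\<close> is the set of relations of arity \<open>n\<close>.
\<close>

definition binary_operad ::
    "('k::field, 'v) s2_module \<Rightarrow> (nat \<Rightarrow> ('v ptree \<Rightarrow>\<^sub>0 'k) set set) \<Rightarrow>
     ('k, ('v ptree \<Rightarrow>\<^sub>0 'k) set set) operad" where
  "binary_operad V R = quot_operad (free_operad V) (generated_ideal (free_operad V) R)"

definition in_arity_3 :: "'a set \<Rightarrow> nat \<Rightarrow> 'a set" where
  "in_arity_3 R n = (if n = 3 then R else {})"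


section \<open>The trisuccessor\<close>

datatype tri = Prec | Succ | Dot

primrec tri_flip :: "tri \<Rightarrow> tri" where
  "tri_flip Prec = Succ"
| "tri_flip Succ = Prec"
| "tri_flip Dot = Dot"

definition tri_s2 :: "('k::field, tri \<Rightarrow>\<^sub>0 'k) s2_module" where
  "tri_s2 = with_swap (free_vs UNIV) (push tri_flip)"

definition hat :: "('k::field, 'v) s2_module \<Rightarrow> ('k, ('v \<times> (tri \<Rightarrow>\<^sub>0 'k) \<Rightarrow>\<^sub>0 'k) set) s2_module" where
  "hat V = tensor_s2 V tri_s2"

definition tri_label ::
    "('k::field, 'v) s2_module \<Rightarrow> tri \<Rightarrow> 'v \<Rightarrow> ('v \<times> (tri \<Rightarrow>\<^sub>0 'k) \<Rightarrow>\<^sub>0 'k) set" where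
  "tri_label V s v = pure_tensor V tri_s2 v (Poly_Mapping.single s 1)"

definition star_label ::
    "('k::field, 'v) s2_module \<Rightarrow> 'v \<Rightarrow> ('v \<times> (tri \<Rightarrow>\<^sub>0 'k) \<Rightarrow>\<^sub>0 'k) set" where
  "star_label V v = tri_label V Prec v \<oplus>\<^bsub>hat V\<^esub> tri_label V Succ v \<oplus>\<^bsub>hat V\<^esub> tri_label V Dot v"

text \<open>A path from the root to a leaf in \<open>J\<close> turns left at a vertex iff that leaf is in the left subtree.\<close>

primrec tsu_tree ::
    "('k::field, 'v) s2_module \<Rightarrow> nat set \<Rightarrow> 'v ptree \<Rightarrow> ('v \<times> (tri \<Rightarrow>\<^sub>0 'k) \<Rightarrow>\<^sub>0 'k) set ptree" where
  "tsu_tree V J (Leaf j) = Leaf j"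
| "tsu_tree V J (Node v l r) =
     Node (if set (leaves l) \<inter> J \<noteq> {} \<and> set (leaves r) \<inter> J \<noteq> {} then tri_label V Dot v
           else if set (leaves l) \<inter> J \<noteq> {} then tri_label V Prec v
           else if set (leaves r) \<inter> J \<noteq> {} then tri_label V Succ v
           else star_label V v)
       (tsu_tree V J l) (tsu_tree V J r)"

definition tsu_map ::
    "('k::field, 'v) s2_module \<Rightarrow> nat \<Rightarrow> nat set \<Rightarrow>
     ('v ptree \<Rightarrow>\<^sub>0 'k) set \<Rightarrow> (('v \<times> (tri \<Rightarrow>\<^sub>0 'k) \<Rightarrow>\<^sub>0 'k) set ptree \<Rightarrow>\<^sub>0 'k) set" where
  "tsu_map V n J A = (\<Union>p\<in>A. tree_class (hat V) n (push (tsu_tree V J) p))"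

definition trisuccessor ::
    "('k::field, 'v) s2_module \<Rightarrow> (nat \<Rightarrow> ('v ptree \<Rightarrow>\<^sub>0 'k) set set) \<Rightarrow>
     ('k, (('v \<times> (tri \<Rightarrow>\<^sub>0 'k) \<Rightarrow>\<^sub>0 'k) set ptree \<Rightarrow>\<^sub>0 'k) set set) operad" where
  "trisuccessor V R =
     binary_operad (hat V)
       (\<lambda>n. {tsu_map V n J r | J r. r \<in> R n \<and> J \<noteq> {} \<and> J \<subseteq> {1..n}})"


section \<open>The Manin black product\<close>

datatype tree_type = Type_I | Type_II | Type_III

primrec comp3_tree :: "tree_type \<Rightarrow> 'v \<Rightarrow> 'v \<Rightarrow> 'v ptree" where
  "comp3_tree Type_I v w = Node v (Node w (Leaf 1) (Leaf 2)) (Leaf 3)"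
| "comp3_tree Type_II v w = Node v (Node w (Leaf 2) (Leaf 3)) (Leaf 1)"
| "comp3_tree Type_III v w = Node v (Node w (Leaf 3) (Leaf 1)) (Leaf 2)"

definition comp3 ::
    "('k::field, 'v) s2_module \<Rightarrow> tree_type \<Rightarrow> 'v \<Rightarrow> 'v \<Rightarrow> ('v ptree \<Rightarrow>\<^sub>0 'k) set" where
  "comp3 V u v w = tree_class V 3 (Poly_Mapping.single (comp3_tree u v w) 1)"

abbreviation free3 :: "('k::field, 'v) s2_module \<Rightarrow> ('k, ('v ptree \<Rightarrow>\<^sub>0 'k) set) module" where
  "free3 V \<equiv> arity_space (free_operad V) 3"

type_synonym ('k, 'v, 'w) black_label = "(('v \<times> 'w \<Rightarrow>\<^sub>0 'k) set \<times> 'k \<Rightarrow>\<^sub>0 'k) set"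

definition black_s2 ::
    "('k::field, 'v) s2_module \<Rightarrow> ('k, 'w) s2_module \<Rightarrow> ('k, ('k, 'v, 'w) black_label) s2_module" where
  "black_s2 V W = tensor_s2 (tensor_s2 V W) sgn_s2"

definition black_tensor ::
    "('k::field, 'v) s2_module \<Rightarrow> ('k, 'w) s2_module \<Rightarrow> 'v \<Rightarrow> 'w \<Rightarrow> ('k, 'v, 'w) black_label" where
  "black_tensor V W v w = pure_tensor (tensor_s2 V W) sgn_s2 (pure_tensor V W v w) 1"

text \<open>
  The conditions below determine \<open>\<Psi>\<close> on the whole tensor product of the two free operads in arity 3,
  because each of them is the direct sum over \<open>u\<close> of the spans of the \<open>comp3 u v w\<close>; the choice only
  concerns arguments outside the tensor product.
\<close>

definition is_black_map ::
    "('k::field, 'v) s2_module \<Rightarrow> ('k, 'w) s2_module \<Rightarrow>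
     ((('v ptree \<Rightarrow>\<^sub>0 'k) set \<times> ('w ptree \<Rightarrow>\<^sub>0 'k) set \<Rightarrow>\<^sub>0 'k) set \<Rightarrow>
      (('k, 'v, 'w) black_label ptree \<Rightarrow>\<^sub>0 'k) set) \<Rightarrow> bool" where
  "is_black_map V W \<Psi> \<longleftrightarrow>
     \<Psi> \<in> linear_maps (tensor_vs (free3 V) (free3 W)) (free3 (black_s2 V W)) \<and>
     (\<forall>u u' v w v' w'. v \<in> carrier V \<and> w \<in> carrier V \<and> v' \<in> carrier W \<and> w' \<in> carrier W \<longrightarrow>
        \<Psi> (pure_tensor (free3 V) (free3 W) (comp3 V u v w) (comp3 W u' v' w')) =
        (if u = u' then comp3 (black_s2 V W) u (black_tensor V W v v') (black_tensor V W w w')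
         else \<zero>\<^bsub>free3 (black_s2 V W)\<^esub>))"

definition black_map ::
    "('k::field, 'v) s2_module \<Rightarrow> ('k, 'w) s2_module \<Rightarrow>
     (('v ptree \<Rightarrow>\<^sub>0 'k) set \<times> ('w ptree \<Rightarrow>\<^sub>0 'k) set \<Rightarrow>\<^sub>0 'k) set \<Rightarrow>
     (('k, 'v, 'w) black_label ptree \<Rightarrow>\<^sub>0 'k) set" where
  "black_map V W = (SOME \<Psi>. is_black_map V W \<Psi>)"

definition black_product ::
    "('k::field, 'v) s2_module \<Rightarrow> ('v ptree \<Rightarrow>\<^sub>0 'k) set set \<Rightarrow>
     ('k, 'w) s2_module \<Rightarrow> ('w ptree \<Rightarrow>\<^sub>0 'k) set set \<Rightarrow>
     ('k, (('k, 'v, 'w) black_label ptree \<Rightarrow>\<^sub>0 'k) set set) operad" where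
  "black_product V R W S =
     binary_operad (black_s2 V W)
       (in_arity_3 (black_map V W `
          span_in (tensor_vs (free3 V) (free3 W))
            {pure_tensor (free3 V) (free3 W) r s | r s. r \<in> R \<and> s \<in> S}))"


section \<open>The operad PostLie\<close>

text \<open>
  The generators have the basis \<open>x \<circ> y\<close>, \<open>y \<circ> x\<close>, \<open>[x, y]\<close>.
\<close>

datatype postlie_op = Circ | Circ_Op | Bracket

definition postlie_s2 :: "('k::field, postlie_op \<Rightarrow>\<^sub>0 'k) s2_module" where
  "postlie_s2 = with_swap (free_vs UNIV)
     (\<lambda>p. Poly_Mapping.single Circ (Poly_Mapping.lookup p Circ_Op)
        + Poly_Mapping.single Circ_Op (Poly_Mapping.lookup p Circ)
        - Poly_Mapping.single Bracket (Poly_Mapping.lookup p Bracket))"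

definition postlie_relators :: "((postlie_op \<Rightarrow>\<^sub>0 'k::field) ptree \<Rightarrow>\<^sub>0 'k) set" where
  "postlie_relators =
     (let x = Leaf 1; y = Leaf 2; z = Leaf 3;
          m = (\<lambda>t. Poly_Mapping.single t 1);
          C = Node (Poly_Mapping.single Circ 1);
          B = Node (Poly_Mapping.single Bracket 1)
      in {m (B (B x y) z) + m (B (B z x) y) + m (B (B y z) x),
          m (C (C x y) z) - m (C x (C y z)) - m (C (C x z) y) + m (C x (C z y)) - m (C x (B y z)),
          m (C (B x y) z) - m (B (C x z) y) - m (B x (C y z))})"

definition postlie_relations :: "((postlie_op \<Rightarrow>\<^sub>0 'k::field) ptree \<Rightarrow>\<^sub>0 'k) set set" where
  "postlie_relations = span_in (free3 postlie_s2)
     {sym_act (free_operad postlie_s2) 3 \<sigma> (tree_class postlie_s2 3 p)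
       | \<sigma> p. \<sigma> permutes {1..3} \<and> p \<in> postlie_relators}"

end

theory Submission
  imports Defs
begin

text \<open>
  The generators \<open>v\<^sub>\<prec>\<close>, \<open>v\<^sub>\<succ>\<close>, \<open>v\<^sub>\<cdot>\<close> of the trisuccessor correspond to the tensors of \<open>v\<close> with \<open>x \<circ> y\<close>, \<open>-(y \<circ> x)\<close>
  and \<open>[x, y]\<close>; the minus sign makes this equivariant, because of the factor \<open>sgn\<close> in the black product.
  For a nonempty set \<open>J\<close> of inputs, label the three trees \<open>(x y) z\<close>, \<open>(y z) x\<close>, \<open>(z x) y\<close> along the paths to
  \<open>J\<close> by these PostLie operations and add them up. The result \<open>s\<^sub>J\<close> is a relation of PostLie: the sets
  \<open>{1, 2, 3}\<close>, \<open>{1}\<close>, \<open>{1, 2}\<close> yield the three defining ones, and a permutation moves \<open>s\<^sub>J\<close> to plus or minus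
  another such element, so the \<open>s\<^sub>J\<close> span all relations. Since \<open>\<Psi>\<close> multiplies labels tree by tree,
  \<open>\<Psi> (s\<^sub>J \<otimes> r)\<close> is the image of \<open>TSu\<^sub>J r\<close>. So the isomorphism of free operads induced by the
  one on generators matches the two ideals of relations.
\<close>

text \<open>The labels are dictated by vertices off all paths. Such a vertex carries the sum of the
  three labels, whose PostLie part is \<open>{y, z} = y \<circ> z - z \<circ> y + [y, z]\<close>,
  and the second PostLie relation says precisely that \<open>x \<circ> {y, z} = (x \<circ> y)
  \<circ> z - (x \<circ> z) \<circ> y\<close>. With the chosen sign each label, this sum included,
  turns into its negative when the two sides of the vertex are exchanged; so a permutation of the
  inputs costs one common sign. Three trees are enough because \<Psi> is diagonal in the tree type:
  against an operation of one type a single summand of \<open>s\<^sub>J\<close> survives.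

  The obstacle is that nearly every object is a quotient and that \<Psi> is a Hilbert choice. Free
  operads are therefore presented as quotients of an operad of formal sums of trees, so that one
  theory of quotient operads serves twice, and maps are compared on spanning elements. The existence
  of \<Psi> needs the sum over the three tree types to be direct, which comes from a normal form for
  trees of arity three.\<close>

abbreviation "single \<equiv> Poly_Mapping.single"
abbreviation "keys \<equiv> Poly_Mapping.keys"
abbreviation "lookup \<equiv> Poly_Mapping.lookup"

section \<open>Linear algebra over records\<close>

text \<open>The library states these laws with the ring operations of \<open>class_ring\<close>.
  Unfolding them once gives the form with the operations of the field, in which later goals
  arise.\<close>

lemma vectorspace_smult:
  fixes M :: "('k::field, 'a, 'm) module_scheme"
  assumes "vectorspace class_ring M"
  shows "x \<in> carrier M \<Longrightarrow> c \<odot>\<^bsub>M\<^esub> x \<in> carrier M"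
    "x \<in> carrier M \<Longrightarrow> (c + d) \<odot>\<^bsub>M\<^esub> x = c \<odot>\<^bsub>M\<^esub> x \<oplus>\<^bsub>M\<^esub> d \<odot>\<^bsub>M\<^esub> x"
    "x \<in> carrier M \<Longrightarrow> y \<in> carrier M \<Longrightarrow> c \<odot>\<^bsub>M\<^esub> (x \<oplus>\<^bsub>M\<^esub> y) = c \<odot>\<^bsub>M\<^esub> x \<oplus>\<^bsub>M\<^esub> c \<odot>\<^bsub>M\<^esub> y"
    "x \<in> carrier M \<Longrightarrow> (c * d) \<odot>\<^bsub>M\<^esub> x = c \<odot>\<^bsub>M\<^esub> (d \<odot>\<^bsub>M\<^esub> x)"
    "x \<in> carrier M \<Longrightarrow> 1 \<odot>\<^bsub>M\<^esub> x = x"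
    "x \<in> carrier M \<Longrightarrow> 0 \<odot>\<^bsub>M\<^esub> x = \<zero>\<^bsub>M\<^esub>"
    "c \<odot>\<^bsub>M\<^esub> \<zero>\<^bsub>M\<^esub> = \<zero>\<^bsub>M\<^esub>"
    "x \<in> carrier M \<Longrightarrow> (- 1) \<odot>\<^bsub>M\<^esub> x = \<ominus>\<^bsub>M\<^esub> x"
proof -
  interpret vectorspace class_ring M by fact
  show "x \<in> carrier M \<Longrightarrow> c \<odot>\<^bsub>M\<^esub> x \<in> carrier M"
    "x \<in> carrier M \<Longrightarrow> (c + d) \<odot>\<^bsub>M\<^esub> x = c \<odot>\<^bsub>M\<^esub> x \<oplus>\<^bsub>M\<^esub> d \<odot>\<^bsub>M\<^esub> x"
    "x \<in> carrier M \<Longrightarrow> y \<in> carrier M \<Longrightarrow> c \<odot>\<^bsub>M\<^esub> (x \<oplus>\<^bsub>M\<^esub> y) = c \<odot>\<^bsub>M\<^esub> x \<oplus>\<^bsub>M\<^esub> c \<odot>\<^bsub>M\<^esub> y"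
    "x \<in> carrier M \<Longrightarrow> (c * d) \<odot>\<^bsub>M\<^esub> x = c \<odot>\<^bsub>M\<^esub> (d \<odot>\<^bsub>M\<^esub> x)"
    "x \<in> carrier M \<Longrightarrow> 1 \<odot>\<^bsub>M\<^esub> x = x"
    "x \<in> carrier M \<Longrightarrow> 0 \<odot>\<^bsub>M\<^esub> x = \<zero>\<^bsub>M\<^esub>"
    "c \<odot>\<^bsub>M\<^esub> \<zero>\<^bsub>M\<^esub> = \<zero>\<^bsub>M\<^esub>"
    "x \<in> carrier M \<Longrightarrow> (- 1) \<odot>\<^bsub>M\<^esub> x = \<ominus>\<^bsub>M\<^esub> x"
    using smult_l_distr[of c d x] smult_r_distr[of c x y] smult_assoc1[of c d x] smult_minus_1[of x]
      smult_one[of x] lmult_0[of x] smult_r_null[of c] smult_closed[of c x]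
    unfolding class_ring_simps by simp_all
qed

lemma vectorspaceI:
  fixes M :: "('k::field, 'a, 'm) module_scheme"
  assumes "\<And>x y. x \<in> carrier M \<Longrightarrow> y \<in> carrier M \<Longrightarrow> x \<oplus>\<^bsub>M\<^esub> y \<in> carrier M"
    and "\<zero>\<^bsub>M\<^esub> \<in> carrier M"
    and "\<And>x y z. x \<in> carrier M \<Longrightarrow> y \<in> carrier M \<Longrightarrow> z \<in> carrier M \<Longrightarrow>
      (x \<oplus>\<^bsub>M\<^esub> y) \<oplus>\<^bsub>M\<^esub> z = x \<oplus>\<^bsub>M\<^esub> (y \<oplus>\<^bsub>M\<^esub> z)"
    and "\<And>x y. x \<in> carrier M \<Longrightarrow> y \<in> carrier M \<Longrightarrow> x \<oplus>\<^bsub>M\<^esub> y = y \<oplus>\<^bsub>M\<^esub> x"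
    and "\<And>x. x \<in> carrier M \<Longrightarrow> \<zero>\<^bsub>M\<^esub> \<oplus>\<^bsub>M\<^esub> x = x"
    and "\<And>x. x \<in> carrier M \<Longrightarrow> \<exists>y\<in>carrier M. y \<oplus>\<^bsub>M\<^esub> x = \<zero>\<^bsub>M\<^esub>"
    and smult: "\<And>c x. x \<in> carrier M \<Longrightarrow> c \<odot>\<^bsub>M\<^esub> x \<in> carrier M"
      "\<And>c d x. x \<in> carrier M \<Longrightarrow> (c + d) \<odot>\<^bsub>M\<^esub> x = c \<odot>\<^bsub>M\<^esub> x \<oplus>\<^bsub>M\<^esub> d \<odot>\<^bsub>M\<^esub> x"
      "\<And>c x y. x \<in> carrier M \<Longrightarrow> y \<in> carrier M \<Longrightarrow>
        c \<odot>\<^bsub>M\<^esub> (x \<oplus>\<^bsub>M\<^esub> y) = c \<odot>\<^bsub>M\<^esub> x \<oplus>\<^bsub>M\<^esub> c \<odot>\<^bsub>M\<^esub> y"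
      "\<And>c d x. x \<in> carrier M \<Longrightarrow> (c * d) \<odot>\<^bsub>M\<^esub> x = c \<odot>\<^bsub>M\<^esub> (d \<odot>\<^bsub>M\<^esub> x)"
      "\<And>x. x \<in> carrier M \<Longrightarrow> 1 \<odot>\<^bsub>M\<^esub> x = x"
  shows "vectorspace class_ring M"
proof -
  interpret abelian_group M by (rule abelian_groupI) fact+
  have "module class_ring M"
    by (intro Module.module.intro Module.module_axioms.intro abelian_group_axioms domain.axioms(1)
        field.axioms(1) class_field) (simp_all add: smult)
  then show ?thesis by (intro vectorspace.intro class_field)
qed

lemma subspace_ofI:
  assumes "vectorspace class_ring M" "U \<subseteq> carrier M" "\<zero>\<^bsub>M\<^esub> \<in> U"
    "\<And>x y. x \<in> U \<Longrightarrow> y \<in> U \<Longrightarrow> x \<oplus>\<^bsub>M\<^esub> y \<in> U" "\<And>c x. x \<in> U \<Longrightarrow> c \<odot>\<^bsub>M\<^esub> x \<in> U"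
  shows "subspace_of U M"
  using assms by (auto simp: submodule_def vectorspace_def)

lemma subspace_ofD:
  assumes "subspace_of U M"
  shows "U \<subseteq> carrier M" "\<zero>\<^bsub>M\<^esub> \<in> U"
    "\<And>x y. x \<in> U \<Longrightarrow> y \<in> U \<Longrightarrow> x \<oplus>\<^bsub>M\<^esub> y \<in> U" "\<And>c x. x \<in> U \<Longrightarrow> c \<odot>\<^bsub>M\<^esub> x \<in> U"
  using assms by (auto simp: submodule_def)

lemma subspace_of_minus:
  assumes "vectorspace class_ring M" "subspace_of U M" "x \<in> U" "y \<in> U"
  shows "x \<ominus>\<^bsub>M\<^esub> y \<in> U"
proof -
  interpret vectorspace class_ring M by fact
  have "y \<in> carrier M" using subspace_ofD[OF assms(2)] assms(4) by auto
  then have "x \<ominus>\<^bsub>M\<^esub> y = x \<oplus>\<^bsub>M\<^esub> ((-1) \<odot>\<^bsub>M\<^esub> y)"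
    by (simp add: a_minus_def vectorspace_smult[OF assms(1)])
  then show ?thesis using subspace_ofD[OF assms(2)] assms by simp
qed

lemma vectorspace_cancel:
  assumes "vectorspace class_ring M" "x \<in> carrier M"
  shows "x \<ominus>\<^bsub>M\<^esub> x = \<zero>\<^bsub>M\<^esub>" "y \<in> carrier M \<Longrightarrow> (x \<oplus>\<^bsub>M\<^esub> y) \<ominus>\<^bsub>M\<^esub> x \<ominus>\<^bsub>M\<^esub> y = \<zero>\<^bsub>M\<^esub>"
proof -
  interpret vectorspace class_ring M by fact
  show "x \<ominus>\<^bsub>M\<^esub> x = \<zero>\<^bsub>M\<^esub>" using assms(2) by (simp add: a_minus_def r_neg)
  assume y: "y \<in> carrier M"
  have "(x \<oplus>\<^bsub>M\<^esub> y) \<ominus>\<^bsub>M\<^esub> x \<ominus>\<^bsub>M\<^esub> y = (x \<oplus>\<^bsub>M\<^esub> y) \<oplus>\<^bsub>M\<^esub> \<ominus>\<^bsub>M\<^esub> (x \<oplus>\<^bsub>M\<^esub> y)"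
    using y assms(2) by (simp add: a_minus_def minus_add a_assoc)
  then show "(x \<oplus>\<^bsub>M\<^esub> y) \<ominus>\<^bsub>M\<^esub> x \<ominus>\<^bsub>M\<^esub> y = \<zero>\<^bsub>M\<^esub>" using y assms(2) by (simp add: r_neg)
qed

lemma subspace_of_zero:
  assumes "vectorspace class_ring M"
  shows "subspace_of {\<zero>\<^bsub>M\<^esub>} M"
proof -
  interpret vectorspace class_ring M by fact
  show ?thesis by (intro subspace_ofI assms) (auto simp: vectorspace_smult[OF assms])
qed

section \<open>Linear maps\<close>

lemma linear_mapsI:
  assumes "\<And>x. x \<in> carrier M \<Longrightarrow> h x \<in> carrier N"
    "\<And>x y. x \<in> carrier M \<Longrightarrow> y \<in> carrier M \<Longrightarrow> h (x \<oplus>\<^bsub>M\<^esub> y) = h x \<oplus>\<^bsub>N\<^esub> h y"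
    "\<And>c x. x \<in> carrier M \<Longrightarrow> h (c \<odot>\<^bsub>M\<^esub> x) = c \<odot>\<^bsub>N\<^esub> h x"
  shows "h \<in> linear_maps M N"
  using assms by (auto simp: LinearCombinations.module_hom_def)

lemma linear_mapsD:
  assumes "h \<in> linear_maps M N"
  shows "\<And>x. x \<in> carrier M \<Longrightarrow> h x \<in> carrier N"
    "\<And>x y. x \<in> carrier M \<Longrightarrow> y \<in> carrier M \<Longrightarrow> h (x \<oplus>\<^bsub>M\<^esub> y) = h x \<oplus>\<^bsub>N\<^esub> h y"
    "\<And>c x. x \<in> carrier M \<Longrightarrow> h (c \<odot>\<^bsub>M\<^esub> x) = c \<odot>\<^bsub>N\<^esub> h x"
  using assms by (auto simp: LinearCombinations.module_hom_def)

lemma linear_maps_zero_minus: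
  assumes "vectorspace class_ring M" "vectorspace class_ring N" "h \<in> linear_maps M N"
  shows "h \<zero>\<^bsub>M\<^esub> = \<zero>\<^bsub>N\<^esub>"
    "\<And>x. x \<in> carrier M \<Longrightarrow> h (\<ominus>\<^bsub>M\<^esub> x) = \<ominus>\<^bsub>N\<^esub> h x"
    "\<And>x y. x \<in> carrier M \<Longrightarrow> y \<in> carrier M \<Longrightarrow> h (x \<ominus>\<^bsub>M\<^esub> y) = h x \<ominus>\<^bsub>N\<^esub> h y"
proof -
  interpret M: vectorspace class_ring M by fact
  interpret N: vectorspace class_ring N by fact
  interpret mod_hom class_ring M N h
    by unfold_locales fact
  show "h \<zero>\<^bsub>M\<^esub> = \<zero>\<^bsub>N\<^esub>" by (rule f0_is_0)
  show "\<And>x. x \<in> carrier M \<Longrightarrow> h (\<ominus>\<^bsub>M\<^esub> x) = \<ominus>\<^bsub>N\<^esub> h x" by (rule f_neg)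
  show "\<And>x y. x \<in> carrier M \<Longrightarrow> y \<in> carrier M \<Longrightarrow> h (x \<ominus>\<^bsub>M\<^esub> y) = h x \<ominus>\<^bsub>N\<^esub> h y"
    by (rule f_minus)
qed

lemma linear_maps_cong:
  assumes "h \<in> linear_maps M N" "\<And>x. x \<in> carrier M \<Longrightarrow> h' x = h x" "vectorspace class_ring M"
  shows "h' \<in> linear_maps M N"
proof -
  interpret vectorspace class_ring M by fact
  show ?thesis using assms(1,2) linear_mapsD[OF assms(1)]
    by (intro linear_mapsI) auto
qed

lemma linear_maps_compose:
  assumes "g \<in> linear_maps M N" "h \<in> linear_maps N K"
  shows "(\<lambda>x. h (g x)) \<in> linear_maps M K"
  using linear_mapsD[OF assms(1)] linear_mapsD[OF assms(2)] by (intro linear_mapsI) auto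

lemma linear_maps_id: "(\<lambda>x. x) \<in> linear_maps M M"
  by (intro linear_mapsI) auto

lemma linear_maps_zero:
  assumes "vectorspace class_ring N"
  shows "(\<lambda>x. \<zero>\<^bsub>N\<^esub>) \<in> linear_maps M N"
proof -
  interpret N: vectorspace class_ring N by fact
  show ?thesis by (intro linear_mapsI) (auto simp: N.smult_r_null)
qed

lemma linear_maps_add:
  assumes "vectorspace class_ring N" "g \<in> linear_maps M N" "h \<in> linear_maps M N"
  shows "(\<lambda>x. g x \<oplus>\<^bsub>N\<^esub> h x) \<in> linear_maps M N"
proof -
  interpret N: vectorspace class_ring N by fact
  show ?thesis
    using linear_mapsD[OF assms(2)] linear_mapsD[OF assms(3)]
    by (intro linear_mapsI) (auto simp: N.smult_r_distr N.a_ac)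
qed

lemma linear_maps_smult:
  assumes "vectorspace class_ring N" "g \<in> linear_maps M N"
  shows "(\<lambda>x. c \<odot>\<^bsub>N\<^esub> g x) \<in> linear_maps M N"
proof -
  interpret N: vectorspace class_ring N by fact
  show ?thesis
    using linear_mapsD[OF assms(2)]
    by (intro linear_mapsI) (auto simp: vectorspace_smult[OF assms(1)] simp flip: vectorspace_smult(4)[OF assms(1)] simp: mult.commute)
qed

lemma subspace_of_vimage:
  assumes "vectorspace class_ring M" "vectorspace class_ring N" "h \<in> linear_maps M N" "subspace_of W N"
  shows "subspace_of {x \<in> carrier M. h x \<in> W} M"
proof -
  interpret M: vectorspace class_ring M by fact
  interpret N: vectorspace class_ring N by fact
  show ?thesis
    using linear_mapsD[OF assms(3)] linear_maps_zero_minus[OF assms(1-3)] subspace_ofD[OF assms(4)]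
    by (intro subspace_ofI assms) auto
qed

section \<open>Spans\<close>

lemma
  assumes "vectorspace class_ring M" "S \<subseteq> carrier M"
  shows span_in_subspace: "subspace_of (span_in M S) M"
    and span_in_superset: "x \<in> S \<Longrightarrow> x \<in> span_in M S"
    and span_in_carrier: "span_in M S \<subseteq> carrier M"
proof -
  interpret vectorspace class_ring M by fact
  show "subspace_of (span_in M S) M" "span_in M S \<subseteq> carrier M"
    using span_is_submodule[OF assms(2)] span_is_subset2[OF assms(2)] by auto
  show "x \<in> S \<Longrightarrow> x \<in> span_in M S" using in_own_span[OF assms(2)] by auto
qed

lemma span_in_least:
  assumes "vectorspace class_ring M" "subspace_of W M" "S \<subseteq> W"
  shows "span_in M S \<subseteq> W"
proof -
  interpret vectorspace class_ring M by fact
  show ?thesis by (rule span_is_subset) fact+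
qed

text \<open>The preimage of \<open>W\<close> is a subspace, so it contains the span once it contains
  \<open>S\<close>. This reduces well-definedness of maps on quotients to a check on the spanning
  relations.\<close>

lemma linear_span_in:
  assumes "vectorspace class_ring M" "vectorspace class_ring N" "h \<in> linear_maps M N" "S \<subseteq> carrier M"
    "subspace_of W N" "\<And>x. x \<in> S \<Longrightarrow> h x \<in> W" "x \<in> span_in M S"
  shows "h x \<in> W"
  using span_in_least[OF assms(1) subspace_of_vimage[OF assms(1-3,5)], of S] assms(4,6,7) by auto

subsection \<open>Quotients\<close>

context
  fixes M :: "('k::field, 'a, 'm) module_scheme" and U :: "'a set"
  assumes M: "vectorspace class_ring M" and U: "subspace_of U M"
begin

interpretation M: vectorspace class_ring M by (rule M)

lemma abelian_subgroup_subspace: "abelian_subgroup U M"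
proof (rule abelian_subgroupI3)
  show "abelian_group M" by unfold_locales
  show "additive_subgroup U M"
  proof (rule additive_subgroup.intro, unfold_locales)
    show "U \<subseteq> carrier (add_monoid M)" using subspace_ofD[OF U] by simp
    fix x y assume "x \<in> U" "y \<in> U"
    then show "x \<otimes>\<^bsub>add_monoid M\<^esub> y \<in> U" using subspace_ofD[OF U] by simp
  next
    show "\<one>\<^bsub>add_monoid M\<^esub> \<in> U" using subspace_ofD[OF U] by simp
  next
    fix x assume x: "x \<in> U"
    then have "\<zero>\<^bsub>M\<^esub> \<ominus>\<^bsub>M\<^esub> x \<in> U" using subspace_ofD[OF U]
      by (intro subspace_of_minus[OF M U]) auto
    then show "inv\<^bsub>add_monoid M\<^esub> x \<in> U" 
      using x subspace_ofD(1)[OF U] by (simp add: a_minus_def a_inv_def[symmetric] subset_iff)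
  qed
qed

interpretation S: abelian_subgroup U M by (rule abelian_subgroup_subspace)

lemma coset_eq_iff:
  assumes "a \<in> carrier M" "b \<in> carrier M"
  shows "U +>\<^bsub>M\<^esub> a = U +>\<^bsub>M\<^esub> b \<longleftrightarrow> a \<ominus>\<^bsub>M\<^esub> b \<in> U"
proof
  assume "U +>\<^bsub>M\<^esub> a = U +>\<^bsub>M\<^esub> b"
  then have "a \<in> U +>\<^bsub>M\<^esub> b" using S.a_rcos_self[OF assms(1)] by simp
  then show "a \<ominus>\<^bsub>M\<^esub> b \<in> U" using S.a_rcos_module[OF assms(2,1)] by (simp add: a_minus_def)
next
  assume "a \<ominus>\<^bsub>M\<^esub> b \<in> U"
  then have "a \<in> U +>\<^bsub>M\<^esub> b" using S.a_rcos_module[OF assms(2,1)] by (simp add: a_minus_def)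
  then show "U +>\<^bsub>M\<^esub> a = U +>\<^bsub>M\<^esub> b" using S.a_repr_independence'[of a b] assms by simp
qed

lemma coset_memD:
  assumes "x \<in> U +>\<^bsub>M\<^esub> a" "a \<in> carrier M"
  shows "x \<in> carrier M" "x \<ominus>\<^bsub>M\<^esub> a \<in> U"
proof -
  show x: "x \<in> carrier M" using assms M.a_r_coset_subset_G[of U a] subspace_ofD[OF U] by auto
  show "x \<ominus>\<^bsub>M\<^esub> a \<in> U" using assms S.a_rcos_module[OF assms(2) x] by (simp add: a_minus_def)
qed

lemma coset_self: "a \<in> carrier M \<Longrightarrow> a \<in> U +>\<^bsub>M\<^esub> a"
  by (rule S.a_rcos_self)

text \<open>Operations on cosets are defined as unions over representatives; when all the sets in
  the union coincide, it equals any one of them. This is the bridge from that encoding to computing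
  with a representative.\<close>

lemma UN_coset:
  assumes "a \<in> carrier M" "\<And>x. x \<in> carrier M \<Longrightarrow> x \<ominus>\<^bsub>M\<^esub> a \<in> U \<Longrightarrow> F x = F a"
  shows "(\<Union>x\<in>U +>\<^bsub>M\<^esub> a. F x) = F a"
proof (intro antisym UN_least)
  show "F x \<subseteq> F a" if "x \<in> U +>\<^bsub>M\<^esub> a" for x
    using assms(2)[OF coset_memD[OF that assms(1)]] by simp
  show "F a \<subseteq> (\<Union>x\<in>U +>\<^bsub>M\<^esub> a. F x)" using coset_self[OF assms(1)] by blast
qed

lemma quot_vs_carrier: "carrier (quot_vs M U) = {U +>\<^bsub>M\<^esub> a | a. a \<in> carrier M}"
  by (auto simp: quot_vs_def A_RCOSETS_def')

lemma quot_vs_zero: "\<zero>\<^bsub>quot_vs M U\<^esub> = U"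
  by (simp add: quot_vs_def)

lemma quot_vs_add:
  assumes "a \<in> carrier M" "b \<in> carrier M"
  shows "(U +>\<^bsub>M\<^esub> a) \<oplus>\<^bsub>quot_vs M U\<^esub> (U +>\<^bsub>M\<^esub> b) = U +>\<^bsub>M\<^esub> (a \<oplus>\<^bsub>M\<^esub> b)"
  using S.a_rcos_sum[OF assms] by (simp add: quot_vs_def)

lemma smult_diff:
  assumes "x \<in> carrier M" "a \<in> carrier M"
  shows "c \<odot>\<^bsub>M\<^esub> (x \<ominus>\<^bsub>M\<^esub> a) = c \<odot>\<^bsub>M\<^esub> x \<ominus>\<^bsub>M\<^esub> c \<odot>\<^bsub>M\<^esub> a"
  using linear_maps_zero_minus(3)[OF M M linear_maps_smult[OF M linear_maps_id] assms] .

lemma quot_vs_smult: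
  assumes "a \<in> carrier M"
  shows "c \<odot>\<^bsub>quot_vs M U\<^esub> (U +>\<^bsub>M\<^esub> a) = U +>\<^bsub>M\<^esub> (c \<odot>\<^bsub>M\<^esub> a)"
  unfolding quot_vs_def module.simps
proof (subst UN_coset[OF assms])
  fix x assume x: "x \<in> carrier M" "x \<ominus>\<^bsub>M\<^esub> a \<in> U"
  then have "c \<odot>\<^bsub>M\<^esub> (x \<ominus>\<^bsub>M\<^esub> a) \<in> U" using subspace_ofD[OF U] by simp
  then show "U +>\<^bsub>M\<^esub> c \<odot>\<^bsub>M\<^esub> x = U +>\<^bsub>M\<^esub> c \<odot>\<^bsub>M\<^esub> a"
    using x assms by (simp add: coset_eq_iff smult_diff)
qed simp

lemma quot_vs_vectorspace: "vectorspace class_ring (quot_vs M U)"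
proof -
  let ?Q = "quot_vs M U"
  note simps = quot_vs_carrier quot_vs_add quot_vs_smult
  have zero: "\<zero>\<^bsub>?Q\<^esub> = U +>\<^bsub>M\<^esub> \<zero>\<^bsub>M\<^esub>"
    using M.a_coset_add_zero[of U] subspace_ofD[OF U] by (simp add: quot_vs_zero)
  show ?thesis
  proof (rule vectorspaceI)
    show "\<zero>\<^bsub>?Q\<^esub> \<in> carrier ?Q" unfolding zero using M.zero_closed unfolding simps by blast
    fix x assume x: "x \<in> carrier ?Q"
    then obtain a where a: "x = U +>\<^bsub>M\<^esub> a" "a \<in> carrier M" unfolding simps by blast
    show "\<zero>\<^bsub>?Q\<^esub> \<oplus>\<^bsub>?Q\<^esub> x = x" unfolding zero using a by (simp add: simps)
    have "(U +>\<^bsub>M\<^esub> (\<ominus>\<^bsub>M\<^esub> a)) \<oplus>\<^bsub>?Q\<^esub> x = \<zero>\<^bsub>?Q\<^esub>" using a by (simp add: simps zero M.l_neg)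
    moreover have "U +>\<^bsub>M\<^esub> (\<ominus>\<^bsub>M\<^esub> a) \<in> carrier ?Q" using M.a_inv_closed[OF a(2)] unfolding simps by blast
    ultimately show "\<exists>y\<in>carrier ?Q. y \<oplus>\<^bsub>?Q\<^esub> x = \<zero>\<^bsub>?Q\<^esub>" by blast
    show "1 \<odot>\<^bsub>?Q\<^esub> x = x" using a by (simp add: simps vectorspace_smult[OF M])
    fix c d
    show "(c + d) \<odot>\<^bsub>?Q\<^esub> x = c \<odot>\<^bsub>?Q\<^esub> x \<oplus>\<^bsub>?Q\<^esub> d \<odot>\<^bsub>?Q\<^esub> x" "(c * d) \<odot>\<^bsub>?Q\<^esub> x = c \<odot>\<^bsub>?Q\<^esub> (d \<odot>\<^bsub>?Q\<^esub> x)"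
      using a by (simp_all add: simps vectorspace_smult[OF M])
    show "c \<odot>\<^bsub>?Q\<^esub> x \<in> carrier ?Q"
      unfolding a quot_vs_smult[OF a(2)] quot_vs_carrier using vectorspace_smult(1)[OF M a(2), of c] by blast
    fix y assume y: "y \<in> carrier ?Q"
    then obtain b where b: "y = U +>\<^bsub>M\<^esub> b" "b \<in> carrier M" unfolding simps by blast
    show "x \<oplus>\<^bsub>?Q\<^esub> y \<in> carrier ?Q"
      unfolding a(1) b(1) quot_vs_add[OF a(2) b(2)] quot_vs_carrier using M.a_closed[OF a(2) b(2)] by blast
    show "x \<oplus>\<^bsub>?Q\<^esub> y = y \<oplus>\<^bsub>?Q\<^esub> x" using a b M.a_comm[of a b] by (simp add: simps)
    show "c \<odot>\<^bsub>?Q\<^esub> (x \<oplus>\<^bsub>?Q\<^esub> y) = c \<odot>\<^bsub>?Q\<^esub> x \<oplus>\<^bsub>?Q\<^esub> c \<odot>\<^bsub>?Q\<^esub> y"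
      using a b by (simp add: simps vectorspace_smult[OF M])
    fix z assume "z \<in> carrier ?Q"
    then obtain e where "z = U +>\<^bsub>M\<^esub> e" "e \<in> carrier M" unfolding simps by blast
    then show "x \<oplus>\<^bsub>?Q\<^esub> y \<oplus>\<^bsub>?Q\<^esub> z = x \<oplus>\<^bsub>?Q\<^esub> (y \<oplus>\<^bsub>?Q\<^esub> z)" using a b by (simp add: simps M.a_assoc)
  qed
qed

lemma coset_linear: "(\<lambda>a. U +>\<^bsub>M\<^esub> a) \<in> linear_maps M (quot_vs M U)"
proof (intro linear_mapsI)
  show "U +>\<^bsub>M\<^esub> a \<in> carrier (quot_vs M U)" if "a \<in> carrier M" for a
    using that unfolding quot_vs_carrier by blast
qed (simp_all add: quot_vs_add quot_vs_smult)

text \<open>The target is an arbitrary vector space, so a union over representatives makes no sense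
  here. A representative is chosen instead, and two choices differ by an element of
  \<open>U\<close>, which \<open>h\<close> kills.\<close>

lemma linear_quot_ex:
  assumes N: "vectorspace class_ring N" and h: "h \<in> linear_maps M N" and 0: "\<And>u. u \<in> U \<Longrightarrow> h u = \<zero>\<^bsub>N\<^esub>"
  shows "\<exists>h'\<in>linear_maps (quot_vs M U) N. \<forall>a\<in>carrier M. h' (U +>\<^bsub>M\<^esub> a) = h a"
proof -
  interpret N: vectorspace class_ring N by (rule N)
  define h' where "h' A = h (SOME a. a \<in> carrier M \<and> A = U +>\<^bsub>M\<^esub> a)" for A
  have eq: "h' (U +>\<^bsub>M\<^esub> a) = h a" if a: "a \<in> carrier M" for a
  proof -
    define b where "b = (SOME b. b \<in> carrier M \<and> U +>\<^bsub>M\<^esub> a = U +>\<^bsub>M\<^esub> b)"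
    have b: "b \<in> carrier M" "U +>\<^bsub>M\<^esub> a = U +>\<^bsub>M\<^esub> b"
      using someI_ex[of "\<lambda>b. b \<in> carrier M \<and> U +>\<^bsub>M\<^esub> a = U +>\<^bsub>M\<^esub> b"] a unfolding b_def by blast+
    then have "h (a \<ominus>\<^bsub>M\<^esub> b) = \<zero>\<^bsub>N\<^esub>" using a coset_eq_iff by (intro 0) auto
    then have "h a \<ominus>\<^bsub>N\<^esub> h b = \<zero>\<^bsub>N\<^esub>" using linear_maps_zero_minus[OF M N h] a b by simp
    then have "h a = h b" using linear_mapsD[OF h] a b by simp
    then show ?thesis by (simp add: h'_def b_def)
  qed
  have "h' \<in> linear_maps (quot_vs M U) N"
  proof (intro linear_mapsI)
    fix A assume "A \<in> carrier (quot_vs M U)"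
    then obtain a where a: "A = U +>\<^bsub>M\<^esub> a" "a \<in> carrier M" unfolding quot_vs_carrier by blast
    show "h' A \<in> carrier N" "h' (c \<odot>\<^bsub>quot_vs M U\<^esub> A) = c \<odot>\<^bsub>N\<^esub> h' A" for c
      using a linear_mapsD[OF h] by (simp_all add: eq quot_vs_smult)
    fix B assume "B \<in> carrier (quot_vs M U)"
    then obtain b where "B = U +>\<^bsub>M\<^esub> b" "b \<in> carrier M" unfolding quot_vs_carrier by blast
    then show "h' (A \<oplus>\<^bsub>quot_vs M U\<^esub> B) = h' A \<oplus>\<^bsub>N\<^esub> h' B"
      using a linear_mapsD[OF h] by (simp add: eq quot_vs_add)
  qed
  then show ?thesis using eq by blast
qed

end

text \<open>The union has the literal shape of the actions, of \<open>swap\<close> on tensor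
  products and of \<open>tsu_map\<close>, so that all of them descend by one argument:
  representatives differ by elements of \<open>U\<close>, whose images lie in
  \<open>W\<close>.\<close>

lemma
  assumes M: "vectorspace class_ring M" "subspace_of U M" and N: "vectorspace class_ring N" "subspace_of W N"
    and h: "h \<in> linear_maps M N" and UW: "\<And>u. u \<in> U \<Longrightarrow> h u \<in> W"
  shows coset_map_eq: "\<And>a. a \<in> carrier M \<Longrightarrow> (\<Union>x\<in>U +>\<^bsub>M\<^esub> a. W +>\<^bsub>N\<^esub> h x) = W +>\<^bsub>N\<^esub> h a"
    and coset_map_linear_maps: "(\<lambda>A. \<Union>x\<in>A. W +>\<^bsub>N\<^esub> h x) \<in> linear_maps (quot_vs M U) (quot_vs N W)"
proof -
  show eq: "(\<Union>x\<in>U +>\<^bsub>M\<^esub> a. W +>\<^bsub>N\<^esub> h x) = W +>\<^bsub>N\<^esub> h a" if "a \<in> carrier M" for a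
  proof (rule UN_coset[OF M that])
    fix x assume "x \<in> carrier M" "x \<ominus>\<^bsub>M\<^esub> a \<in> U"
    then show "W +>\<^bsub>N\<^esub> h x = W +>\<^bsub>N\<^esub> h a"
      using that linear_maps_zero_minus(3)[OF M(1) N(1) h, of x a] linear_mapsD[OF h] UW[of "x \<ominus>\<^bsub>M\<^esub> a"]
      by (simp add: coset_eq_iff[OF N])
  qed
  interpret M: vectorspace class_ring M by fact
  show "(\<lambda>A. \<Union>x\<in>A. W +>\<^bsub>N\<^esub> h x) \<in> linear_maps (quot_vs M U) (quot_vs N W)"
  proof (rule linear_mapsI)
    fix A assume "A \<in> carrier (quot_vs M U)"
    then obtain a where a: "A = U +>\<^bsub>M\<^esub> a" "a \<in> carrier M" by (auto simp: quot_vs_carrier[OF M])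
    show "(\<Union>x\<in>A. W +>\<^bsub>N\<^esub> h x) \<in> carrier (quot_vs N W)"
      unfolding a(1) eq[OF a(2)] using a linear_mapsD[OF h] by (auto simp: quot_vs_carrier[OF N])
    show "(\<Union>x\<in>c \<odot>\<^bsub>quot_vs M U\<^esub> A. W +>\<^bsub>N\<^esub> h x) = c \<odot>\<^bsub>quot_vs N W\<^esub> (\<Union>x\<in>A. W +>\<^bsub>N\<^esub> h x)" for c
      unfolding a(1) eq[OF a(2)] quot_vs_smult[OF M a(2)]
      using a linear_mapsD[OF h] by (simp add: eq quot_vs_smult[OF N] del: UN_simps)
    fix B assume "B \<in> carrier (quot_vs M U)"
    then obtain b where b: "B = U +>\<^bsub>M\<^esub> b" "b \<in> carrier M" by (auto simp: quot_vs_carrier[OF M])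
    show "(\<Union>x\<in>A \<oplus>\<^bsub>quot_vs M U\<^esub> B. W +>\<^bsub>N\<^esub> h x) =
        (\<Union>x\<in>A. W +>\<^bsub>N\<^esub> h x) \<oplus>\<^bsub>quot_vs N W\<^esub> (\<Union>x\<in>B. W +>\<^bsub>N\<^esub> h x)"
      unfolding a(1) b(1) eq[OF a(2)] eq[OF b(2)] quot_vs_add[OF M a(2) b(2)]
      using a b linear_mapsD[OF h] by (simp add: eq quot_vs_add[OF N] del: UN_simps)
  qed
qed

text \<open>For a fixed representative of the first argument the inner union is the one-variable
  case; its result depends on \<open>x\<close> through a linear map again, so the outer union is the
  one-variable case too.\<close>

lemma coset_map2_eq:
  assumes M: "vectorspace class_ring M" "subspace_of U M" and M': "vectorspace class_ring M'" "subspace_of U' M'"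
    and N: "vectorspace class_ring N" "subspace_of W N"
    and l: "\<And>y. y \<in> carrier M' \<Longrightarrow> (\<lambda>x. g x y) \<in> linear_maps M N"
    and r: "\<And>x. x \<in> carrier M \<Longrightarrow> (\<lambda>y. g x y) \<in> linear_maps M' N"
    and lU: "\<And>u y. u \<in> U \<Longrightarrow> y \<in> carrier M' \<Longrightarrow> g u y \<in> W"
    and rU: "\<And>x u. x \<in> carrier M \<Longrightarrow> u \<in> U' \<Longrightarrow> g x u \<in> W"
    and a: "a \<in> carrier M" and b: "b \<in> carrier M'"
  shows "(\<Union>x\<in>U +>\<^bsub>M\<^esub> a. \<Union>y\<in>U' +>\<^bsub>M'\<^esub> b. W +>\<^bsub>N\<^esub> g x y) = W +>\<^bsub>N\<^esub> g a b"
proof -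
  have "(\<Union>y\<in>U' +>\<^bsub>M'\<^esub> b. W +>\<^bsub>N\<^esub> g x y) = W +>\<^bsub>N\<^esub> g x b" if "x \<in> carrier M" for x
    using coset_map_eq[OF M' N r[OF that]] rU that b by blast
  then have "(\<Union>x\<in>U +>\<^bsub>M\<^esub> a. \<Union>y\<in>U' +>\<^bsub>M'\<^esub> b. W +>\<^bsub>N\<^esub> g x y) = (\<Union>x\<in>U +>\<^bsub>M\<^esub> a. W +>\<^bsub>N\<^esub> g x b)"
    using coset_memD(1)[OF M _ a] by simp
  also have "\<dots> = W +>\<^bsub>N\<^esub> g a b" using coset_map_eq[OF M N l[OF b]] lU a b by blast
  finally show ?thesis .
qed

text \<open>Moves the structure to a record of another type with the same components, as happens
  when \<open>swap\<close> is added to a module.\<close>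

lemma vectorspace_transfer:
  fixes M :: "('k::field, 'a, 'm) module_scheme" and N :: "('k, 'a, 'n) module_scheme"
  assumes M: "vectorspace class_ring M"
    and eq: "carrier N = carrier M" "add N = add M" "zero N = zero M" "module.smult N = module.smult M"
  shows "vectorspace class_ring N"
proof -
  interpret vectorspace class_ring M by fact
  note [simp] = eq
  show ?thesis
  proof (rule vectorspaceI, goal_cases)
    case (6 x)
    then show ?case by (intro bexI[of _ "\<ominus>\<^bsub>M\<^esub> x"]) (simp_all add: l_neg)
  qed (simp_all add: a_ac vectorspace_smult[OF M])
qed

subsection \<open>Free vector spaces\<close>

lemma lookup_map_times [simp]:
  "lookup (Poly_Mapping.map ((*) c) p) x = c * lookup (p :: _ \<Rightarrow>\<^sub>0 'k::field) x"
  by (cases "lookup p x = 0") (simp_all add: Poly_Mapping.map.rep_eq when_def)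

lemma map_times_zero [simp]: "Poly_Mapping.map ((*) (c::'k::field)) 0 = 0"
  by (rule poly_mapping_eqI) simp

lemma keys_add_subset:
  "keys p \<subseteq> X \<Longrightarrow> keys q \<subseteq> X \<Longrightarrow> keys (p + q :: _ \<Rightarrow>\<^sub>0 'k::field) \<subseteq> X"
  using Poly_Mapping.keys_add[of p q] by auto

lemma keys_diff_subset:
  "keys p \<subseteq> X \<Longrightarrow> keys q \<subseteq> X \<Longrightarrow> keys (p - q :: _ \<Rightarrow>\<^sub>0 'k::field) \<subseteq> X"
  using Poly_Mapping.keys_diff[of p q] by auto

lemma keys_single_subset: "x \<in> X \<Longrightarrow> keys (single x c) \<subseteq> X"
  by simp

lemma map_times_add: "Poly_Mapping.map ((*) c) (p + q) =
    Poly_Mapping.map ((*) c) p + Poly_Mapping.map ((*) (c::'k::field)) q"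
  by (rule poly_mapping_eqI) (simp add: lookup_add algebra_simps)

lemma map_times_single [simp]:
  "Poly_Mapping.map ((*) c) (single x d) = single x (c * (d::'k::field))"
  by (rule poly_mapping_eqI) (simp add: lookup_single when_def)

lemma keys_map_times: "keys (Poly_Mapping.map ((*) (c::'k::field)) p) \<subseteq> keys p"
  by (auto simp: in_keys_iff)

lemma free_vs_simps [simp]:
  "carrier (free_vs X) = {p. keys p \<subseteq> X}"
  "\<zero>\<^bsub>free_vs X\<^esub> = 0" "add (free_vs X) = (+)"
  "module.smult (free_vs X) = (\<lambda>c. Poly_Mapping.map ((*) c))"
  by (simp_all add: free_vs_def)

lemma free_vs_vectorspace: "vectorspace class_ring (free_vs X :: ('k::field, _) module)"
proof (rule vectorspaceI, goal_cases)
  case (1 x y)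
  then show ?case using Poly_Mapping.keys_add[of x y] by auto
next
  case (6 x)
  then show ?case by (intro bexI[of _ "- x"]) auto
next
  case (7 c x)
  then show ?case using keys_map_times by fastforce
qed (auto simp: algebra_simps lookup_add intro!: poly_mapping_eqI)

lemma free_vs_minus [simp]:
  assumes "keys p \<subseteq> X" "keys (q :: _ \<Rightarrow>\<^sub>0 'k::field) \<subseteq> X"
  shows "p \<ominus>\<^bsub>free_vs X\<^esub> q = p - q"
proof -
  have "\<ominus>\<^bsub>free_vs X\<^esub> q = Poly_Mapping.map ((*) (- 1)) q"
    using vectorspace_smult(8)[OF free_vs_vectorspace, of q X] assms by simp
  also have "\<dots> = - q" by (rule poly_mapping_eqI) simp
  finally show ?thesis by (simp add: a_minus_def)
qed

text \<open>Building up from singletons inside \<open>X\<close> keeps every intermediate element in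
  the carrier of \<open>free_vs X\<close>, so facts that hold only for basis elements in
  \<open>X\<close> can be extended linearly.\<close>

lemma poly_mapping_keys_induct [consumes 1, case_names zero single add]:
  assumes "keys p \<subseteq> X" and "P 0"
    and single: "\<And>x c. x \<in> X \<Longrightarrow> P (single x c)"
    and add: "\<And>p q. keys p \<subseteq> X \<Longrightarrow> keys q \<subseteq> X \<Longrightarrow> P p \<Longrightarrow> P q \<Longrightarrow> P (p + q)"
  shows "P (p :: _ \<Rightarrow>\<^sub>0 'k::comm_monoid_add)"
proof -
  \<comment> \<open>\<open>T A\<close> is the part of \<open>p\<close> supported on
    \<open>A\<close>; induction on \<open>A\<close> reaches \<open>p\<close> itself at
    \<open>A = keys p\<close>.\<close>
  define T where "T = (\<lambda>A. \<Sum>x\<in>A. single x (lookup p x))"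
  have "finite A \<Longrightarrow> A \<subseteq> X \<Longrightarrow> keys (T A) \<subseteq> X \<and> P (T A)" for A
  proof (induction A rule: finite_induct)
    case (insert x A)
    have T: "T (insert x A) = single x (lookup p x) + T A"
      using insert by (simp add: T_def)
    have k: "keys (single x (lookup p x)) \<subseteq> X"
      using insert by simp
    have "keys (T (insert x A)) \<subseteq> X"
      using insert k unfolding T by (intro order_trans[OF Poly_Mapping.keys_add]) auto
    then show ?case using insert k add[OF k] single unfolding T by auto
  qed (use assms in \<open>simp add: T_def\<close>)
  moreover have "p = T (keys p)"
    by (rule poly_mapping_eqI)
      (auto simp: T_def lookup_sum lookup_single when_def in_keys_iff)
  ultimately show ?thesis using assms(1) finite_keys by metis
qed

lemma free_vs_linear_eq:
  assumes N: "vectorspace class_ring N" and h: "h \<in> linear_maps (free_vs X) N" and h': "h' \<in> linear_maps (free_vs X) N"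
    and eq: "\<And>x. x \<in> X \<Longrightarrow> h (single x 1) = h' (single x 1)"
    and p: "keys p \<subseteq> X"
  shows "h p = h' p"
  using p
proof (induction rule: poly_mapping_keys_induct)
  case zero
  then show ?case
    using linear_maps_zero_minus(1)[OF free_vs_vectorspace N h] linear_maps_zero_minus(1)[OF free_vs_vectorspace N h']
    by simp
next
  case (single x c)
  then show ?case
    using linear_mapsD(3)[OF h, of "single x 1" c]
      linear_mapsD(3)[OF h', of "single x 1" c] eq[OF single] by simp
next
  case (add p q)
  then show ?case using linear_mapsD(2)[OF h, of p q] linear_mapsD(2)[OF h', of p q] by simp
qed

lemma free_vs_ex:
  fixes N :: "('k::field, 'b, 'n) module_scheme"
  assumes N: "vectorspace class_ring N" and g: "\<And>x. x \<in> X \<Longrightarrow> g x \<in> carrier N"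
  shows "\<exists>h\<in>linear_maps (free_vs X) N. \<forall>x\<in>X. h (single x 1) = g x"
proof -
  interpret N: vectorspace class_ring N by fact
  define h where "h p = (\<Oplus>\<^bsub>N\<^esub>x\<in>keys p. lookup p x \<odot>\<^bsub>N\<^esub> g x)" for p
  note vs = vectorspace_smult[OF N]
  \<comment> \<open>The sum may run over any finite set between the support and \<open>X\<close>.
    With this freedom \<open>p\<close>, \<open>q\<close> and \<open>p + q\<close> are all summed
    over the same set.\<close>
  have h: "h p = (\<Oplus>\<^bsub>N\<^esub>x\<in>A. lookup p x \<odot>\<^bsub>N\<^esub> g x)"
    if "finite A" "keys p \<subseteq> A" "A \<subseteq> X" for p A
    unfolding h_def using that g
    by (intro N.add.finprod_mono_neutral_cong_left) (auto simp: in_keys_iff vs)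
  have "h \<in> linear_maps (free_vs X) N"
  proof (rule linear_mapsI; clarsimp)
    fix p :: "'a \<Rightarrow>\<^sub>0 'k" assume p: "keys p \<subseteq> X"
    show "h p \<in> carrier N" unfolding h_def using g p by (intro N.finsum_closed) (auto simp: vs)
    show "h (Poly_Mapping.map ((*) c) p) = c \<odot>\<^bsub>N\<^esub> h p" for c
    proof -
      have "h (Poly_Mapping.map ((*) c) p) = (\<Oplus>\<^bsub>N\<^esub>x\<in>keys p. c \<odot>\<^bsub>N\<^esub> (lookup p x \<odot>\<^bsub>N\<^esub> g x))"
        using p g by (subst h[OF finite_keys keys_map_times p])
          (intro N.finsum_cong', auto simp: vs)
      also have "\<dots> = c \<odot>\<^bsub>N\<^esub> h p" unfolding h_def
        by (rule N.finsum_smult[symmetric]) (use p g in \<open>auto simp: vs\<close>)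
      finally show ?thesis .
    qed
    fix q :: "'a \<Rightarrow>\<^sub>0 'k" assume q: "keys q \<subseteq> X"
    let ?A = "keys p \<union> keys q"
    have A: "finite ?A" "?A \<subseteq> X" using p q by auto
    have "h (p + q) = (\<Oplus>\<^bsub>N\<^esub>x\<in>?A. lookup p x \<odot>\<^bsub>N\<^esub> g x \<oplus>\<^bsub>N\<^esub> lookup q x \<odot>\<^bsub>N\<^esub> g x)"
      using A g by (subst h[OF A(1) Poly_Mapping.keys_add A(2)])
        (intro N.finsum_cong', auto simp: vs lookup_add)
    also have "\<dots> = h p \<oplus>\<^bsub>N\<^esub> h q"
      using A g by (subst (1 2) h[of ?A]) (auto intro!: N.finsum_addf simp: vs)
    finally show "h (p + q) = h p \<oplus>\<^bsub>N\<^esub> h q" .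
  qed
  moreover have "h (single x 1) = g x" if "x \<in> X" for x
    using g[OF that] by (simp add: h_def vs)
  ultimately show ?thesis by blast
qed

subsection \<open>Linear and bilinear extensions\<close>

lemma push_superset:
  assumes "finite A" "keys p \<subseteq> A"
  shows "push g p = (\<Sum>x\<in>A. single (g x) (lookup p x))"
  unfolding push_def by (rule sum.mono_neutral_left) (use assms in \<open>auto simp: in_keys_iff\<close>)

lemma push2_superset:
  assumes "finite A" "keys p \<subseteq> A" "finite B" "keys q \<subseteq> B"
  shows "push2 g p q = (\<Sum>x\<in>A. \<Sum>y\<in>B.
     single (g x y) (lookup p x * lookup q y))"
  unfolding push2_def
  by (rule sum.mono_neutral_cong_left)
    (use assms in \<open>auto simp: in_keys_iff intro!: sum.mono_neutral_left\<close>)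

lemma push_zero [simp]: "push g 0 = 0"
  by (simp add: push_def)

lemma push2_zero [simp]: "push2 g 0 q = 0" "push2 g p 0 = 0"
  by (simp_all add: push2_def)

lemma push_single [simp]: "push g (single x c) = single (g x) c"
  by (simp add: push_def)

lemma push2_single [simp]:
  "push2 g (single x c) (single y d) = single (g x y) (c * d)"
  by (simp add: push2_def)

lemma push_add: "push g (p + q) = push g p + push g q"
proof -
  let ?A = "keys p \<union> keys q"
  have "finite ?A" by simp
  then show ?thesis
    by (subst (1 2 3) push_superset[of ?A])
      (auto simp: lookup_add single_add sum.distrib distrib_right distrib_left dest!: subsetD[OF Poly_Mapping.keys_add])
qed

lemma push2_add_left: "push2 g (p + p') q = push2 g p q + push2 g p' q"
proof -
  let ?A = "keys p \<union> keys p'"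
  have "finite ?A" by simp
  then show ?thesis
    by (subst (1 2 3) push2_superset[of ?A _ "keys q"])
      (auto simp: lookup_add single_add sum.distrib distrib_right dest!: subsetD[OF Poly_Mapping.keys_add])
qed

lemma push2_add_right: "push2 g p (q + q') = push2 g p q + push2 g p q'"
proof -
  let ?A = "keys q \<union> keys q'"
  have "finite ?A" by simp
  then show ?thesis
    by (subst (1 2 3) push2_superset[of "keys p" _ ?A])
      (auto simp: lookup_add single_add sum.distrib distrib_left dest!: subsetD[OF Poly_Mapping.keys_add])
qed

lemma push_map_times: "push g (Poly_Mapping.map ((*) c) p) = Poly_Mapping.map ((*) c) (push g p)"
  using subset_UNIV[of "keys p"] by (induction p rule: poly_mapping_keys_induct)
    (simp_all add: push_add map_times_add)

lemma push_diff: "push g (p - q) = push g p - push g q"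
  using push_add[of g "p - q" q] by simp

lemma push2_single_left: "push2 g (single x 1) q = push (g x) q"
  by (simp add: push2_def push_def)

lemma push2_single_right: "push2 g p (single y 1) = push (\<lambda>x. g x y) p"
  by (simp add: push2_def push_def)

lemma keys_push: "keys (push g p) \<subseteq> g ` keys p"
  unfolding push_def by (rule order_trans[OF Poly_Mapping.keys_sum]) (auto split: if_splits)

lemma keys_push2: "keys (push2 g p q) \<subseteq> {g x y | x y. x \<in> keys p \<and> y \<in> keys q}"
  unfolding push2_def
  by (intro order_trans[OF Poly_Mapping.keys_sum] UN_least) (auto split: if_splits)

lemma push_linear:
  assumes "\<And>x. x \<in> X \<Longrightarrow> g x \<in> Y"
  shows "push g \<in> linear_maps (free_vs X) (free_vs Y)"
proof (intro linear_mapsI)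
  show "push g p \<in> carrier (free_vs Y)" if "p \<in> carrier (free_vs X)" for p
    using order_trans[OF keys_push image_mono[of "keys p" X]] that assms by fastforce
qed (simp_all add: push_add push_map_times)

lemma push2_map_times:
  "push2 g (Poly_Mapping.map ((*) c) p) q = Poly_Mapping.map ((*) c) (push2 g p q)"
  "push2 g p (Poly_Mapping.map ((*) c) q) = Poly_Mapping.map ((*) c) (push2 g p q)"
proof -
  have 1: "push2 g (single x (c * d)) q = Poly_Mapping.map ((*) c) (push2 g (single x d) q)"
    "push2 g (single x d) (Poly_Mapping.map ((*) c) q) = Poly_Mapping.map ((*) c) (push2 g (single x d) q)"
    for x d
    using subset_UNIV[of "keys q"] by (induction q rule: poly_mapping_keys_induct)
      (simp_all add: push2_add_right map_times_add mult.assoc mult.left_commute)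
  show "push2 g (Poly_Mapping.map ((*) c) p) q = Poly_Mapping.map ((*) c) (push2 g p q)"
    using subset_UNIV[of "keys p"] by (induction p rule: poly_mapping_keys_induct)
      (simp_all add: push2_add_left map_times_add 1)
  show "push2 g p (Poly_Mapping.map ((*) c) q) = Poly_Mapping.map ((*) c) (push2 g p q)"
    using subset_UNIV[of "keys p"] by (induction p rule: poly_mapping_keys_induct)
      (simp_all add: push2_add_left map_times_add 1)
qed

lemma
  assumes "\<And>x y. x \<in> X \<Longrightarrow> y \<in> Y \<Longrightarrow> g x y \<in> Z"
  shows push2_linear_left: "keys q \<subseteq> Y \<Longrightarrow> (\<lambda>p. push2 g p q) \<in> linear_maps (free_vs X) (free_vs Z)"
    and push2_linear_right: "keys p \<subseteq> X \<Longrightarrow> (\<lambda>q. push2 g p q) \<in> linear_maps (free_vs Y) (free_vs Z)"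
proof -
  have *: "keys (push2 g p q) \<subseteq> Z" if "keys p \<subseteq> X" "keys q \<subseteq> Y" for p q
    using that assms by (intro order_trans[OF keys_push2]) blast
  show "keys q \<subseteq> Y \<Longrightarrow> (\<lambda>p. push2 g p q) \<in> linear_maps (free_vs X) (free_vs Z)"
    by (intro linear_mapsI) (auto simp: push2_add_left push2_map_times dest: *)
  show "keys p \<subseteq> X \<Longrightarrow> (\<lambda>q. push2 g p q) \<in> linear_maps (free_vs Y) (free_vs Z)"
    by (intro linear_mapsI) (auto simp: push2_add_right push2_map_times dest: *)
qed

subsection \<open>The universal property of the tensor product\<close>

definition bilinear_on ::
    "('k::field, 'v, 'm) module_scheme \<Rightarrow> ('k, 'w, 'n) module_scheme \<Rightarrow> ('k, 'u, 'p) module_scheme \<Rightarrow>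
     ('v \<Rightarrow> 'w \<Rightarrow> 'u) \<Rightarrow> bool" where
  "bilinear_on V W K \<beta> \<longleftrightarrow> (\<forall>w\<in>carrier W. (\<lambda>v. \<beta> v w) \<in> linear_maps V K)
     \<and> (\<forall>v\<in>carrier V. \<beta> v \<in> linear_maps W K)"

context
  fixes V :: "('k::field, 'v, 'm) module_scheme" and W :: "('k, 'w, 'n) module_scheme"
  assumes V: "vectorspace class_ring V" and W: "vectorspace class_ring W"
begin

interpretation V: vectorspace class_ring V by (rule V)
interpretation W: vectorspace class_ring W by (rule W)

private abbreviation "F \<equiv> free_vs (carrier V \<times> carrier W) :: ('k, _) module"
private abbreviation "N \<equiv> span_in F (bilinearity_relations V W)"

lemma bilinearity_relations_carrier: "bilinearity_relations V W \<subseteq> carrier F"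
proof
  fix x assume "x \<in> bilinearity_relations V W"
  then show "x \<in> carrier F"
    unfolding bilinearity_relations_def
    by (elim UnE CollectE exE conjE; hypsubst; simp add: keys_diff_subset keys_single_subset
        vectorspace_smult[OF V] vectorspace_smult[OF W] del: keys_single)
qed

private lemmas F = free_vs_vectorspace[of "carrier V \<times> carrier W", where ?'k='k]
private lemmas N = span_in_subspace[OF F bilinearity_relations_carrier]

lemma tensor_vs_vectorspace: "vectorspace class_ring (tensor_vs V W)"
  unfolding tensor_vs_def Let_def by (rule quot_vs_vectorspace[OF F N])

lemma tensor_class_linear: "tensor_class V W \<in> linear_maps F (tensor_vs V W)"
  unfolding tensor_vs_def tensor_class_def Let_def by (rule coset_linear[OF F N])

lemma tensor_class_eqI:
  assumes "p \<in> carrier F" "q \<in> carrier F" "p - q \<in> N"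
  shows "tensor_class V W p = tensor_class V W q"
  unfolding tensor_class_def Let_def using coset_eq_iff[OF F N, of p q] assms by simp

lemma pure_tensor_bilinear: "bilinear_on V W (tensor_vs V W) (pure_tensor V W)"
proof -
  note rel = span_in_superset[OF F bilinearity_relations_carrier]
  note lin = linear_mapsD[OF tensor_class_linear]
  have cl: "tensor_class V W (single (v, w) c) \<in> carrier (tensor_vs V W)"
    if "v \<in> carrier V" "w \<in> carrier W" for v w c
    using that by (intro lin) auto
  have add: "tensor_class V W (single x 1) =
      tensor_class V W (single y 1) \<oplus>\<^bsub>tensor_vs V W\<^esub> tensor_class V W (single z 1)"
    if "single x 1 - single y 1 - single z 1 \<in> bilinearity_relations V W"
      "x \<in> carrier V \<times> carrier W" "y \<in> carrier V \<times> carrier W" "z \<in> carrier V \<times> carrier W" for x y z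
  proof -
    have "tensor_class V W (single x 1) = tensor_class V W (single y 1 + single z 1)"
      using rel[OF that(1)] that by (intro tensor_class_eqI) (simp_all add: diff_diff_eq keys_add_subset keys_single_subset del: keys_single)
    then show ?thesis
      using lin(2)[of "single y 1" "single z 1"] that by simp
  qed
  have smult: "tensor_class V W (single x 1) =
      c \<odot>\<^bsub>tensor_vs V W\<^esub> tensor_class V W (single y 1)"
    if "single x 1 - single y c \<in> bilinearity_relations V W"
      "x \<in> carrier V \<times> carrier W" "y \<in> carrier V \<times> carrier W" for x y c
  proof -
    have "tensor_class V W (single x 1) = tensor_class V W (single y c)"
      using rel[OF that(1)] that by (intro tensor_class_eqI) auto
    then show ?thesis using lin(3)[of "single y 1" c] that by simp
  qed
  have rels: "v \<in> carrier V \<Longrightarrow> v' \<in> carrier V \<Longrightarrow> w \<in> carrier W \<Longrightarrow>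
      single (v \<oplus>\<^bsub>V\<^esub> v', w) 1 - single (v, w) 1 - single (v', w) 1
        \<in> bilinearity_relations V W"
    "v \<in> carrier V \<Longrightarrow> w \<in> carrier W \<Longrightarrow> w' \<in> carrier W \<Longrightarrow>
      single (v, w \<oplus>\<^bsub>W\<^esub> w') 1 - single (v, w) 1 - single (v, w') 1
        \<in> bilinearity_relations V W"
    "v \<in> carrier V \<Longrightarrow> w \<in> carrier W \<Longrightarrow>
      single (c \<odot>\<^bsub>V\<^esub> v, w) 1 - single (v, w) c \<in> bilinearity_relations V W"
    "v \<in> carrier V \<Longrightarrow> w \<in> carrier W \<Longrightarrow>
      single (v, c \<odot>\<^bsub>W\<^esub> w) 1 - single (v, w) c \<in> bilinearity_relations V W"
    for v v' w w' c
    unfolding bilinearity_relations_def by blast+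
  show ?thesis
    unfolding bilinear_on_def pure_tensor_def
    by (intro conjI ballI linear_mapsI cl add smult rels)
      (simp_all add: vectorspace_smult[OF V] vectorspace_smult[OF W])
qed

lemma tensor_linear_eq:
  assumes K: "vectorspace class_ring K" and h: "h \<in> linear_maps (tensor_vs V W) K" and h': "h' \<in> linear_maps (tensor_vs V W) K"
    and eq: "\<And>v w. v \<in> carrier V \<Longrightarrow> w \<in> carrier W \<Longrightarrow> h (pure_tensor V W v w) = h' (pure_tensor V W v w)"
    and x: "x \<in> carrier (tensor_vs V W)"
  shows "h x = h' x"
proof -
  obtain p where p: "x = tensor_class V W p" "p \<in> carrier F"
    using x unfolding tensor_vs_def tensor_class_def Let_def quot_vs_carrier[OF F N] by blast
  have "h (tensor_class V W p) = h' (tensor_class V W p)"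
    by (rule free_vs_linear_eq[OF K linear_maps_compose[OF tensor_class_linear h] linear_maps_compose[OF tensor_class_linear h']])
      (use eq p in \<open>auto simp: pure_tensor_def\<close>)
  then show ?thesis using p by simp
qed

text \<open>Bilinearity of \<beta> is what makes its linear extension to the free space on pairs
  vanish on the four kinds of bilinearity relations; the extension then factors through the
  quotient.\<close>

lemma tensor_ex:
  assumes K: "vectorspace class_ring K" and \<beta>: "bilinear_on V W K \<beta>"
  shows "\<exists>h\<in>linear_maps (tensor_vs V W) K. \<forall>v\<in>carrier V. \<forall>w\<in>carrier W. h (pure_tensor V W v w) = \<beta> v w"
proof -
  interpret K: vectorspace class_ring K by fact
  have l: "\<And>w. w \<in> carrier W \<Longrightarrow> (\<lambda>v. \<beta> v w) \<in> linear_maps V K"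
    and r: "\<And>v. v \<in> carrier V \<Longrightarrow> \<beta> v \<in> linear_maps W K"
    using \<beta> by (auto simp: bilinear_on_def)
  note lr = linear_mapsD[OF l] linear_mapsD[OF r]
  have "\<exists>h\<in>linear_maps F K. \<forall>x\<in>carrier V \<times> carrier W. h (single x 1) = (case x of (v, w) \<Rightarrow> \<beta> v w)"
    using lr by (intro free_vs_ex[OF K]) auto
  then obtain h where h: "h \<in> linear_maps F K"
    and h1: "\<And>v w. v \<in> carrier V \<Longrightarrow> w \<in> carrier W \<Longrightarrow> h (single (v, w) 1) = \<beta> v w"
    by auto
  have hc: "h (single (v, w) c) = c \<odot>\<^bsub>K\<^esub> \<beta> v w" if "v \<in> carrier V" "w \<in> carrier W" for v w c
    using linear_mapsD(3)[OF h, of "single (v, w) 1" c] h1 that by simp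
  have minus: "h (p - q) = h p \<ominus>\<^bsub>K\<^esub> h q" if "p \<in> carrier F" "q \<in> carrier F" for p q
    using linear_maps_zero_minus(3)[OF F K h that] that by simp
  have minus_closed: "p - q \<in> carrier F" if "p \<in> carrier F" "q \<in> carrier F" for p q :: "_ \<Rightarrow>\<^sub>0 'k"
    using that by (simp add: keys_diff_subset)
  have single: "single (v, w) c \<in> carrier F" if "v \<in> carrier V" "w \<in> carrier W" for v w and c :: 'k
    using that by simp
  have "h r \<in> {\<zero>\<^bsub>K\<^esub>}" if "r \<in> N" for r
  proof (rule linear_span_in[OF F K h bilinearity_relations_carrier subspace_of_zero[OF K] _ that])
    fix x assume "x \<in> bilinearity_relations V W"
    then show "h x \<in> {\<zero>\<^bsub>K\<^esub>}"
      unfolding bilinearity_relations_def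
      by (elim UnE CollectE exE conjE; hypsubst; simp add: minus minus_closed single hc lr vectorspace_cancel[OF K]
          vectorspace_smult[OF V] vectorspace_smult[OF W] vectorspace_smult[OF K] del: free_vs_simps)
  qed
  then obtain h' where "h' \<in> linear_maps (tensor_vs V W) K" "\<And>p. p \<in> carrier F \<Longrightarrow> h' (tensor_class V W p) = h p"
    using linear_quot_ex[OF F N K h] unfolding tensor_vs_def tensor_class_def Let_def by blast
  then show ?thesis by (intro bexI[of _ h']) (auto simp: pure_tensor_def h1)
qed

end

section \<open>Quotient operads\<close>

lemma permutes_mem: "\<sigma> permutes S \<Longrightarrow> x \<in> S \<Longrightarrow> \<sigma> x \<in> S"
  by (simp add: permutes_in_image)

text \<open>The block \<open>{i..<i + n}\<close> is preserved, and on it \<open>perm_inner\<close>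
  is \<sigma> conjugated by a translation to \<open>{1..n}\<close>; inverting \<sigma> therefore
  inverts it.\<close>

lemma perm_inner_inverse:
  assumes "\<sigma> permutes {1..n}" "1 \<le> i"
  shows "perm_inner i n (inv_into UNIV \<sigma>) (perm_inner i n \<sigma> j) = j"
proof (cases "i \<le> j \<and> j < i + n")
  case True
  then have *: "1 \<le> j + 1 - i \<and> j + 1 - i \<le> n" using assms(2) by auto
  then have "1 \<le> \<sigma> (j + 1 - i) \<and> \<sigma> (j + 1 - i) \<le> n" using permutes_mem[OF assms(1), of "j + 1 - i"] by simp
  then show ?thesis using True * assms(2) permutes_inverses[OF assms(1)] by (auto simp: perm_inner_def)
qed (auto simp: perm_inner_def)

lemma perm_inner_inv:
  assumes "\<sigma> permutes {1..n}" "1 \<le> i"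
  shows "inv_into UNIV (perm_inner i n \<sigma>) = perm_inner i n (inv_into UNIV \<sigma>)"
  using perm_inner_inverse[OF assms] perm_inner_inverse[OF permutes_inv[OF assms(1)] assms(2)]
    permutes_inv_inv[OF assms(1)]
  by (intro inv_unique_comp ext) simp_all

lemma perm_inner_permutes:
  assumes "\<sigma> permutes {1..n}" "i \<in> {1..m}"
  shows "perm_inner i n \<sigma> permutes {1..m + n - 1}"
proof -
  have "bij (perm_inner i n \<sigma>)"
    using perm_inner_inverse[OF assms(1), of i] perm_inner_inverse[OF permutes_inv[OF assms(1)], of i]
      permutes_inv_inv[OF assms(1)] assms(2)
    by (intro o_bij[of "perm_inner i n (inv_into UNIV \<sigma>)"] ext) simp_all
  moreover have "perm_inner i n \<sigma> j = j" if "j \<notin> {1..m + n - 1}" for j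
    using that assms(2) by (auto simp: perm_inner_def)
  ultimately show ?thesis unfolding permutes_def bij_iff by blast
qed

text \<open>The block at \<open>i\<close> is carried to the block at \<open>\<sigma> i\<close>,
  hence the inverse has to start at \<open>\<sigma> i\<close>. By injectivity the image of any other
  input differs from \<open>\<sigma> i\<close>, so it lands before or after that block and is
  shifted back correctly. This includes \<open>n = 0\<close>, where the block is empty.\<close>

lemma perm_outer_inverse:
  assumes "\<sigma> permutes {1..m}" "i \<in> {1..m}"
  shows "perm_outer (\<sigma> i) n (inv_into UNIV \<sigma>) (perm_outer i n \<sigma> j) = j"
proof -
  note inv = permutes_inverses[OF assms(1)]
  have pos: "1 \<le> \<sigma> i" "1 \<le> i" using permutes_mem[OF assms] assms(2) by auto
  have inj: "\<sigma> a = \<sigma> b \<longleftrightarrow> a = b" for a b using permutes_inj[OF assms(1)] by (auto dest: injD)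
  consider "j < i" | "i \<le> j" "j < i + n" | "i + n \<le> j" by linarith
  then show ?thesis
  proof cases
    case 1
    then have "\<sigma> j \<noteq> \<sigma> i" using inj by auto
    then show ?thesis using 1 pos inv by (auto simp: perm_outer_def shift_input_def)
  next
    case 2
    then show ?thesis using pos inv by (auto simp: perm_outer_def shift_input_def)
  next
    case 3
    then have "\<sigma> (j + 1 - n) \<noteq> \<sigma> i" using inj by auto
    then show ?thesis using 3 pos inv by (auto simp: perm_outer_def shift_input_def)
  qed
qed

lemma perm_outer_inverse':
  assumes "\<sigma> permutes {1..m}" "i \<in> {1..m}"
  shows "perm_outer i n \<sigma> (perm_outer (\<sigma> i) n (inv_into UNIV \<sigma>) j) = j"
  using perm_outer_inverse[OF permutes_inv[OF assms(1)] permutes_mem[OF assms]]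
    permutes_inv_inv[OF assms(1)] permutes_inverses[OF assms(1)] by simp

lemma perm_outer_inv:
  assumes "\<sigma> permutes {1..m}" "i \<in> {1..m}"
  shows "inv_into UNIV (perm_outer i n \<sigma>) = perm_outer (\<sigma> i) n (inv_into UNIV \<sigma>)"
  using perm_outer_inverse[OF assms] perm_outer_inverse'[OF assms]
  by (intro inv_unique_comp ext) simp_all

lemma perm_outer_permutes:
  assumes "\<sigma> permutes {1..m}" "i \<in> {1..m}"
  shows "perm_outer i n \<sigma> permutes {1..m + n - 1}"
proof -
  have "bij (perm_outer i n \<sigma>)"
    using perm_outer_inverse[OF assms] perm_outer_inverse'[OF assms]
    by (intro o_bij[of "perm_outer (\<sigma> i) n (inv_into UNIV \<sigma>)"] ext) simp_all
  \<comment> \<open>Outside the range there remain \<open>0\<close>, which lies before the block,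
    and inputs beyond \<open>m + n - 1\<close>, for which \<open>j + 1 - n\<close> exceeds
    \<open>m\<close>. Both \<open>0\<close> and \<open>j + 1 - n\<close> are fixed by
    \<sigma>.\<close>
  moreover have "perm_outer i n \<sigma> j = j" if j: "j \<notin> {1..m + n - 1}" for j
  proof -
    have pos: "1 \<le> \<sigma> i" "\<sigma> i \<le> m" using permutes_mem[OF assms] by auto
    show ?thesis
    proof (cases "j = 0")
      case True
      then show ?thesis using assms pos permutes_not_in[OF assms(1), of 0]
        by (simp add: perm_outer_def shift_input_def)
    next
      case False
      then have "m + n \<le> j" "j + 1 - n \<notin> {1..m}" using j assms(2) by auto
      then show ?thesis using assms pos permutes_not_in[OF assms(1), of "j + 1 - n"]
        by (auto simp: perm_outer_def shift_input_def)
    qed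
  qed
  ultimately show ?thesis unfolding permutes_def bij_iff by blast
qed

section \<open>Quotients by operad ideals\<close>

lemma operad_idealD:
  assumes "operad_ideal P I"
  shows "subspace_of (I n) (arity_space P n)"
    "\<And>\<sigma> x. \<sigma> permutes {1..n} \<Longrightarrow> x \<in> I n \<Longrightarrow> sym_act P n \<sigma> x \<in> I n"
    "\<And>m i x y. i \<in> {1..m} \<Longrightarrow> x \<in> I m \<Longrightarrow> y \<in> ops P n \<Longrightarrow> pcomp P m n i x y \<in> I (m + n - 1)"
    "\<And>m i x y. i \<in> {1..m} \<Longrightarrow> x \<in> ops P m \<Longrightarrow> y \<in> I n \<Longrightarrow> pcomp P m n i x y \<in> I (m + n - 1)"
  using assms unfolding operad_ideal_def sym_submodule_def by auto

lemma pcomp_closed: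
  assumes "operad P" "i \<in> {1..m}" "x \<in> ops P m" "y \<in> ops P n"
  shows "pcomp P m n i x y \<in> ops P (m + n - 1)"
  using linear_mapsD(1)[OF operad.pcomp_linear_left[OF assms(1,2,4)] assms(3)] .

context
  fixes P :: "('k::field, 'a) operad" and I :: "nat \<Rightarrow> 'a set"
  assumes P: "operad P" and I: "operad_ideal P I"
begin

interpretation P: operad P by (rule P)

private abbreviation "cls n x \<equiv> I n +>\<^bsub>arity_space P n\<^esub> x"
private abbreviation "Q \<equiv> quot_operad P I"
private lemmas A = P.arity_vectorspace operad_idealD(1)[OF I]
private lemmas act = linear_mapsD[OF P.act_linear]

lemma quot_operad_arity: "arity_space Q n = quot_vs (arity_space P n) (I n)"
  by (simp add: quot_operad_def)

lemma quot_operad_ops: "ops Q n = {cls n x | x. x \<in> ops P n}"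
  unfolding quot_operad_arity by (rule quot_vs_carrier[OF A])

lemma quot_operad_act:
  "\<sigma> permutes {1..n} \<Longrightarrow> x \<in> ops P n \<Longrightarrow> sym_act Q n \<sigma> (cls n x) = cls n (sym_act P n \<sigma> x)"
  unfolding quot_operad_def operad.simps
  by (rule coset_map_eq[OF A A P.act_linear operad_idealD(2)[OF I]])

lemma quot_operad_unit: "op_unit Q = cls 1 (op_unit P)"
  by (simp add: quot_operad_def)

lemma quot_operad_pcomp:
  assumes "i \<in> {1..m}" "x \<in> ops P m" "y \<in> ops P n"
  shows "pcomp Q m n i (cls m x) (cls n y) = cls (m + n - 1) (pcomp P m n i x y)"
  unfolding quot_operad_def operad.simps
  by (rule coset_map2_eq[OF A A A P.pcomp_linear_left[OF assms(1)] P.pcomp_linear_right[OF assms(1)]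
      operad_idealD(3)[OF I assms(1)] operad_idealD(4)[OF I assms(1)] assms(2,3)])

lemma quot_operad_operad: "operad Q"
proof (rule operad.intro)
  note eval = quot_operad_act quot_operad_pcomp quot_operad_unit act P.unit_closed
  show "vectorspace class_ring (arity_space Q n)" for n
    unfolding quot_operad_arity by (rule quot_vs_vectorspace[OF A])
  show "op_unit Q \<in> ops Q 1"
    unfolding quot_operad_unit quot_operad_ops using P.unit_closed by blast
  fix n :: nat
  show "sym_act Q n \<sigma> \<in> linear_maps (arity_space Q n) (arity_space Q n)" if "\<sigma> permutes {1..n}" for \<sigma>
    unfolding quot_operad_arity unfolding quot_operad_def operad.simps
    by (rule coset_map_linear_maps[OF A A P.act_linear[OF that] operad_idealD(2)[OF I that]])
  fix x assume "x \<in> ops Q n"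
  then obtain x0 where x: "x = cls n x0" "x0 \<in> ops P n" unfolding quot_operad_ops by blast
  show "sym_act Q n id x = x"
    using x P.act_id permutes_id[of "{1..n}"] by (simp add: eval del: permutes_id)
  show "sym_act Q n (\<sigma> \<circ> \<tau>) x = sym_act Q n \<tau> (sym_act Q n \<sigma> x)"
    if "\<sigma> permutes {1..n}" "\<tau> permutes {1..n}" for \<sigma> \<tau>
    using x that P.act_comp permutes_compose[OF that(2,1)] by (simp add: eval)
  show "pcomp Q 1 n 1 (op_unit Q) x = x"
    using x P.unit_left P.unit_closed quot_operad_pcomp[of 1 1 "op_unit P" x0 n] by (simp add: quot_operad_unit)
  show "pcomp Q n 1 i x (op_unit Q) = x" if "i \<in> {1..n}" for i
    using x that P.unit_right P.unit_closed quot_operad_pcomp[of i n x0 "op_unit P" 1] by (simp add: quot_operad_unit)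
next
  \<comment> \<open>With a representative \<open>y\<close> of the other argument fixed, composition
    coincides on the carrier with a one-variable coset map, whose linearity is already
    known.\<close>
  show "(\<lambda>x. pcomp Q m n i x x') \<in> linear_maps (arity_space Q m) (arity_space Q (m + n - 1))"
    if i: "i \<in> {1..m}" and x': "x' \<in> ops Q n" for i m n x'
  proof -
    obtain y where y: "x' = cls n y" "y \<in> ops P n" using x' unfolding quot_operad_ops by blast
    have "(\<lambda>A. \<Union>x\<in>A. cls (m + n - 1) (pcomp P m n i x y)) \<in> linear_maps (arity_space Q m) (arity_space Q (m + n - 1))"
      unfolding quot_operad_arity 
      by (rule coset_map_linear_maps[OF A A P.pcomp_linear_left[OF i y(2)] operad_idealD(3)[OF I i _ y(2)]])
    then show ?thesis
    proof (rule linear_maps_cong)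
      fix z assume "z \<in> ops Q m"
      then obtain w where w: "z = cls m w" "w \<in> ops P m" unfolding quot_operad_ops by blast
      have "(\<Union>x\<in>cls m w. cls (m + n - 1) (pcomp P m n i x y)) = cls (m + n - 1) (pcomp P m n i w y)"
        by (rule coset_map_eq[OF A A P.pcomp_linear_left[OF i y(2)] operad_idealD(3)[OF I i _ y(2)] w(2)])
      then show "pcomp Q m n i z x' = (\<Union>x\<in>z. cls (m + n - 1) (pcomp P m n i x y))"
        using i y w by (simp add: quot_operad_pcomp)
    qed (unfold quot_operad_arity, rule quot_vs_vectorspace[OF A])
  qed
next
  show "(\<lambda>y. pcomp Q m n i x' y) \<in> linear_maps (arity_space Q n) (arity_space Q (m + n - 1))"
    if i: "i \<in> {1..m}" and x': "x' \<in> ops Q m" for i m n x'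
  proof -
    obtain y where y: "x' = cls m y" "y \<in> ops P m" using x' unfolding quot_operad_ops by blast
    have "(\<lambda>A. \<Union>x\<in>A. cls (m + n - 1) (pcomp P m n i y x)) \<in> linear_maps (arity_space Q n) (arity_space Q (m + n - 1))"
      unfolding quot_operad_arity 
      by (rule coset_map_linear_maps[OF A A P.pcomp_linear_right[OF i y(2)] operad_idealD(4)[OF I i y(2)]])
    then show ?thesis
    proof (rule linear_maps_cong)
      fix z assume "z \<in> ops Q n"
      then obtain w where w: "z = cls n w" "w \<in> ops P n" unfolding quot_operad_ops by blast
      have "(\<Union>x\<in>cls n w. cls (m + n - 1) (pcomp P m n i y x)) = cls (m + n - 1) (pcomp P m n i y w)"
        by (rule coset_map_eq[OF A A P.pcomp_linear_right[OF i y(2)] operad_idealD(4)[OF I i y(2)] w(2)])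
      then show "pcomp Q m n i x' z = (\<Union>x\<in>z. cls (m + n - 1) (pcomp P m n i y x))"
        using i y w by (simp add: quot_operad_pcomp)
    qed (unfold quot_operad_arity, rule quot_vs_vectorspace[OF A])
  qed
next
  fix i l j m n x y z
  assume *: "i \<in> {1..l}" "j \<in> {1..m}" and "x \<in> ops Q l" "y \<in> ops Q m" "z \<in> ops Q n"
  then obtain x0 y0 z0 where x: "x = cls l x0" "x0 \<in> ops P l" "y = cls m y0" "y0 \<in> ops P m" "z = cls n z0" "z0 \<in> ops P n"
    unfolding quot_operad_ops by blast
  \<comment> \<open>Subtraction is truncated: the two resulting arities agree because
    \<open>l\<close> and \<open>m\<close> are positive, which the ranges of \<open>i\<close> and
    \<open>j\<close> ensure.\<close>
  have i: "i + j - 1 \<in> {1..l + m - 1}" "l + (m + n - 1) - 1 = l + m - 1 + n - 1" using * by auto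
  show "pcomp Q (l + m - 1) n (i + j - 1) (pcomp Q l m i x y) z = pcomp Q l (m + n - 1) i x (pcomp Q m n j y z)"
    using P.sequential_assoc[OF * x(2,4,6)] x *
      quot_operad_pcomp[OF *(1) x(2,4)] quot_operad_pcomp[OF *(2) x(4,6)]
      quot_operad_pcomp[OF *(1) x(2) pcomp_closed[OF P *(2) x(4,6)]]
      quot_operad_pcomp[OF i(1) pcomp_closed[OF P *(1) x(2,4)] x(6)] i(2)
    by simp
next
  fix i k l m n x y z
  assume *: "1 \<le> i" "i < k" "k \<le> l" and "x \<in> ops Q l" "y \<in> ops Q m" "z \<in> ops Q n"
  then obtain x0 y0 z0 where x: "x = cls l x0" "x0 \<in> ops P l" "y = cls m y0" "y0 \<in> ops P m" "z = cls n z0" "z0 \<in> ops P n"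
    unfolding quot_operad_ops by blast
  have i: "k + m - 1 \<in> {1..l + m - 1}" "i \<in> {1..l + n - 1}" "i \<in> {1..l}" "k \<in> {1..l}"
      "l + n - 1 + m - 1 = l + m - 1 + n - 1" using * by auto
  show "pcomp Q (l + m - 1) n (k + m - 1) (pcomp Q l m i x y) z = pcomp Q (l + n - 1) m i (pcomp Q l n k x z) y"
    using P.parallel_assoc[OF * x(2,4,6)] x
      quot_operad_pcomp[OF i(3) x(2,4)] quot_operad_pcomp[OF i(4) x(2,6)]
      quot_operad_pcomp[OF i(1) pcomp_closed[OF P i(3) x(2,4)] x(6)]
      quot_operad_pcomp[OF i(2) pcomp_closed[OF P i(4) x(2,6)] x(4)] i(5)
    by simp
next
  fix i m n \<sigma> x y
  assume *: "i \<in> {1..m}" "\<sigma> permutes {1..n}" and "x \<in> ops Q m" "y \<in> ops Q n"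
  then obtain x0 y0 where x: "x = cls m x0" "x0 \<in> ops P m" "y = cls n y0" "y0 \<in> ops P n"
    unfolding quot_operad_ops by blast
  show "pcomp Q m n i x (sym_act Q n \<sigma> y) = sym_act Q (m + n - 1) (perm_inner i n \<sigma>) (pcomp Q m n i x y)"
    using P.equivariant_inner[OF * x(2,4)] x
      quot_operad_act[OF *(2) x(4)] quot_operad_pcomp[OF *(1) x(2) act(1)[OF *(2) x(4)]] quot_operad_pcomp[OF *(1) x(2,4)]
      quot_operad_act[OF perm_inner_permutes[OF *(2,1)] pcomp_closed[OF P *(1) x(2,4)]] by simp
next
  fix i m n \<sigma> x y
  assume *: "i \<in> {1..m}" "\<sigma> permutes {1..m}" and "x \<in> ops Q m" "y \<in> ops Q n"
  then obtain x0 y0 where x: "x = cls m x0" "x0 \<in> ops P m" "y = cls n y0" "y0 \<in> ops P n"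
    unfolding quot_operad_ops by blast
  show "pcomp Q m n i (sym_act Q m \<sigma> x) y = sym_act Q (m + n - 1) (perm_outer i n \<sigma>) (pcomp Q m n (\<sigma> i) x y)"
    using P.equivariant_outer[OF * x(2,4)] x
      quot_operad_act[OF *(2) x(2)] quot_operad_pcomp[OF *(1) act(1)[OF *(2) x(2)] x(4)]
      quot_operad_pcomp[OF permutes_mem[OF *(2,1)] x(2,4)]
      quot_operad_act[OF perm_outer_permutes[OF *(2,1)] pcomp_closed[OF P permutes_mem[OF *(2,1)] x(2,4)]] by simp
qed

end

subsection \<open>Homomorphisms between quotients\<close>

definition quot_hom :: "('k::field, 'b) operad \<Rightarrow> (nat \<Rightarrow> 'b set) \<Rightarrow> (nat \<Rightarrow> 'a \<Rightarrow> 'b) \<Rightarrow> nat \<Rightarrow> 'a set \<Rightarrow> 'b set" where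
  "quot_hom Q J \<phi> n A = (\<Union>x\<in>A. J n +>\<^bsub>arity_space Q n\<^esub> \<phi> n x)"

lemma operad_homD:
  assumes "\<phi> \<in> operad_hom P Q"
  shows "\<phi> n \<in> linear_maps (arity_space P n) (arity_space Q n)"
    "\<And>x. x \<in> ops P n \<Longrightarrow> \<phi> n x \<in> ops Q n"
    "\<And>\<sigma> x. \<sigma> permutes {1..n} \<Longrightarrow> x \<in> ops P n \<Longrightarrow> \<phi> n (sym_act P n \<sigma> x) = sym_act Q n \<sigma> (\<phi> n x)"
    "\<phi> 1 (op_unit P) = op_unit Q"
    "\<And>m i x y. i \<in> {1..m} \<Longrightarrow> x \<in> ops P m \<Longrightarrow> y \<in> ops P n \<Longrightarrow>
        \<phi> (m + n - 1) (pcomp P m n i x y) = pcomp Q m n i (\<phi> m x) (\<phi> n y)"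
  using assms linear_mapsD(1)[of "\<phi> n" "arity_space P n" "arity_space Q n"] unfolding operad_hom_def by auto

lemma
  assumes P: "operad P" "operad_ideal P I" and Q: "operad Q" "operad_ideal Q J"
    and \<phi>: "\<phi> \<in> operad_hom P Q" and IJ: "\<And>n x. x \<in> I n \<Longrightarrow> \<phi> n x \<in> J n"
  shows quot_hom_eq: "\<And>n x. x \<in> ops P n \<Longrightarrow>
      quot_hom Q J \<phi> n (I n +>\<^bsub>arity_space P n\<^esub> x) = J n +>\<^bsub>arity_space Q n\<^esub> \<phi> n x"
    and quot_hom_operad_hom: "quot_hom Q J \<phi> \<in> operad_hom (quot_operad P I) (quot_operad Q J)"
proof -
  interpret P: operad P by fact
  interpret Q: operad Q by fact
  note A = P.arity_vectorspace operad_idealD(1)[OF P(2)]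
  note B = Q.arity_vectorspace operad_idealD(1)[OF Q(2)]
  note hom = operad_homD[OF \<phi>]
  show eq: "quot_hom Q J \<phi> n (I n +>\<^bsub>arity_space P n\<^esub> x) = J n +>\<^bsub>arity_space Q n\<^esub> \<phi> n x"
    if "x \<in> ops P n" for n x
    unfolding quot_hom_def by (rule coset_map_eq[OF A B hom(1) IJ that])
  show "quot_hom Q J \<phi> \<in> operad_hom (quot_operad P I) (quot_operad Q J)"
    unfolding operad_hom_def
  proof (intro CollectI conjI allI impI; (elim conjE)?)
    show "quot_hom Q J \<phi> n \<in> linear_maps (arity_space (quot_operad P I) n) (arity_space (quot_operad Q J) n)" for n
      unfolding quot_operad_arity[OF P] quot_operad_arity[OF Q] quot_hom_def
      by (rule coset_map_linear_maps[OF A B hom(1) IJ])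
    show "quot_hom Q J \<phi> 1 (op_unit (quot_operad P I)) = op_unit (quot_operad Q J)"
      unfolding quot_operad_unit[OF P] quot_operad_unit[OF Q] using eq[OF P.unit_closed] hom(4) by simp
    fix n \<sigma> x assume *: "\<sigma> permutes {1..n}" "x \<in> ops (quot_operad P I) n"
    then obtain x0 where x: "x = I n +>\<^bsub>arity_space P n\<^esub> x0" "x0 \<in> ops P n" unfolding quot_operad_ops[OF P] by blast
    show "quot_hom Q J \<phi> n (sym_act (quot_operad P I) n \<sigma> x) = sym_act (quot_operad Q J) n \<sigma> (quot_hom Q J \<phi> n x)"
      using * x hom linear_mapsD(1)[OF P.act_linear]
      by (simp add: quot_operad_act[OF P] quot_operad_act[OF Q] eq)
  next
    fix m n i x y assume *: "i \<in> {1..m}" and "x \<in> ops (quot_operad P I) m" "y \<in> ops (quot_operad P I) n"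
    then obtain x0 y0 where x: "x = I m +>\<^bsub>arity_space P m\<^esub> x0" "x0 \<in> ops P m"
      "y = I n +>\<^bsub>arity_space P n\<^esub> y0" "y0 \<in> ops P n"
      unfolding quot_operad_ops[OF P] by blast
    show "quot_hom Q J \<phi> (m + n - 1) (pcomp (quot_operad P I) m n i x y) =
        pcomp (quot_operad Q J) m n i (quot_hom Q J \<phi> m x) (quot_hom Q J \<phi> n y)"
      unfolding x(1,3) quot_operad_pcomp[OF P * x(2,4)] eq[OF x(2)] eq[OF x(4)] eq[OF pcomp_closed[OF P(1) * x(2,4)]]
        quot_operad_pcomp[OF Q * hom(2)[OF x(2)] hom(2)[OF x(4)]] hom(5)[OF * x(2,4)] ..
  qed
qed

lemma quot_operad_isomorphic:
  assumes P: "operad P" "operad_ideal P I" and Q: "operad Q" "operad_ideal Q J"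
    and \<phi>: "\<phi> \<in> operad_hom P Q" and \<psi>: "\<psi> \<in> operad_hom Q P"
    and \<psi>\<phi>: "\<And>n x. x \<in> ops P n \<Longrightarrow> \<psi> n (\<phi> n x) = x" and \<phi>\<psi>: "\<And>n y. y \<in> ops Q n \<Longrightarrow> \<phi> n (\<psi> n y) = y"
    and IJ: "\<And>n x. x \<in> I n \<Longrightarrow> \<phi> n x \<in> J n" and JI: "\<And>n y. y \<in> J n \<Longrightarrow> \<psi> n y \<in> I n"
  shows "operad_isomorphic (quot_operad P I) (quot_operad Q J)"
  unfolding operad_isomorphic_def
proof (intro conjI bexI allI)
  note eq = quot_hom_eq[OF P Q \<phi> IJ] quot_hom_eq[OF Q P \<psi> JI]
  note hom = quot_hom_operad_hom[OF P Q \<phi> IJ] quot_hom_operad_hom[OF Q P \<psi> JI]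
  show "operad (quot_operad P I)" "operad (quot_operad Q J)"
    by (rule quot_operad_operad[OF P], rule quot_operad_operad[OF Q])
  show "quot_hom Q J \<phi> \<in> operad_hom (quot_operad P I) (quot_operad Q J)" by (rule hom)
  show "bij_betw (quot_hom Q J \<phi> n) (ops (quot_operad P I) n) (ops (quot_operad Q J) n)" for n
  proof (rule bij_betw_byWitness[where f'="quot_hom P I \<psi> n"])
    show "\<forall>a\<in>ops (quot_operad P I) n. quot_hom P I \<psi> n (quot_hom Q J \<phi> n a) = a"
      unfolding quot_operad_ops[OF P] using operad_homD(2)[OF \<phi>] by (auto simp: eq \<psi>\<phi>)
    show "\<forall>a\<in>ops (quot_operad Q J) n. quot_hom Q J \<phi> n (quot_hom P I \<psi> n a) = a"
      unfolding quot_operad_ops[OF Q] using operad_homD(2)[OF \<psi>] by (auto simp: eq \<phi>\<psi>)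
  qed (use operad_homD(2)[OF hom(1)] operad_homD(2)[OF hom(2)] in auto)
qed

subsection \<open>Generated ideals\<close>

text \<open>This ideal keeps \<open>generated_ideal\<close> inside the operad; otherwise the
  intersection defining it could range over no ideal at all and be the whole type.\<close>

lemma operad_ideal_full:
  assumes "operad P"
  shows "operad_ideal P (ops P)"
proof -
  interpret operad P by fact
  have "subspace_of (ops P n) (arity_space P n)" for n
  proof -
    interpret vectorspace class_ring "arity_space P n" by (rule arity_vectorspace)
    show ?thesis by (intro subspace_ofI arity_vectorspace) (auto simp: vectorspace_smult[OF arity_vectorspace])
  qed
  then show ?thesis
    unfolding operad_ideal_def sym_submodule_def
    using linear_mapsD(1)[OF act_linear] linear_mapsD(1)[OF pcomp_linear_left] by blast
qed

lemma operad_ideal_vimage: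
  assumes P: "operad P" and Q: "operad Q" "operad_ideal Q J" and \<phi>: "\<phi> \<in> operad_hom P Q"
  shows "operad_ideal P (\<lambda>n. {x \<in> ops P n. \<phi> n x \<in> J n})"
proof -
  interpret P: operad P by fact
  interpret Q: operad Q by fact
  note hom = operad_homD[OF \<phi>]
  show ?thesis
    unfolding operad_ideal_def sym_submodule_def
  proof (intro conjI allI impI; (elim conjE)?)
    show "subspace_of {x \<in> ops P n. \<phi> n x \<in> J n} (arity_space P n)" for n
      by (rule subspace_of_vimage[OF P.arity_vectorspace Q.arity_vectorspace hom(1) operad_idealD(1)[OF Q(2)]])
    show "sym_act P n \<sigma> x \<in> {x \<in> ops P n. \<phi> n x \<in> J n}"
      if "\<sigma> permutes {1..n}" "x \<in> {x \<in> ops P n. \<phi> n x \<in> J n}" for n \<sigma> x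
      using that hom(3) operad_idealD(2)[OF Q(2)] linear_mapsD(1)[OF P.act_linear] by auto
    show "pcomp P m n i x y \<in> {x \<in> ops P (m + n - 1). \<phi> (m + n - 1) x \<in> J (m + n - 1)}"
      if i: "i \<in> {1..m}" and x: "x \<in> {x \<in> ops P m. \<phi> m x \<in> J m}" and y: "y \<in> ops P n" for m n i x y
    proof -
      have "x \<in> ops P m" "\<phi> m x \<in> J m" using x by auto
      then show ?thesis
        by (simp add: hom(5)[OF i _ y] operad_idealD(3)[OF Q(2) i _ hom(2)[OF y]] pcomp_closed[OF P i _ y]
            del: One_nat_def)
    qed
    show "pcomp P m n i x y \<in> {x \<in> ops P (m + n - 1). \<phi> (m + n - 1) x \<in> J (m + n - 1)}"
      if i: "i \<in> {1..m}" and x: "x \<in> ops P m" and y: "y \<in> {x \<in> ops P n. \<phi> n x \<in> J n}" for m n i x y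
    proof -
      have "y \<in> ops P n" "\<phi> n y \<in> J n" using y by auto
      then show ?thesis
        by (simp add: hom(5)[OF i x] operad_idealD(4)[OF Q(2) i hom(2)[OF x]] pcomp_closed[OF P i x]
            del: One_nat_def)
    qed
  qed
qed

lemma generated_ideal_superset: "x \<in> R n \<Longrightarrow> x \<in> generated_ideal P R n"
  by (auto simp: generated_ideal_def)

lemma generated_ideal_least:
  assumes "operad_ideal P I" "\<And>n. R n \<subseteq> I n" "x \<in> generated_ideal P R n"
  shows "x \<in> I n"
  using assms by (auto simp: generated_ideal_def)

lemma generated_ideal_ideal:
  assumes P: "operad P" and R: "\<And>n. R n \<subseteq> ops P n"
  shows "operad_ideal P (generated_ideal P R)"
proof -
  interpret P: operad P by fact
  let ?G = "generated_ideal P R"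
  have memI: "x \<in> ?G n" if "\<And>I. operad_ideal P I \<Longrightarrow> (\<And>m. R m \<subseteq> I m) \<Longrightarrow> x \<in> I n" for x n
    unfolding generated_ideal_def using that by blast
  have ops: "x \<in> ops P n" if "x \<in> ?G n" for x n
    using generated_ideal_least[OF operad_ideal_full[OF P] R that] .
  show ?thesis
    unfolding operad_ideal_def sym_submodule_def
  proof (intro conjI allI impI; (elim conjE)?)
    note sub = subspace_ofD[OF operad_idealD(1)]
    show "subspace_of (?G n) (arity_space P n)" for n
    proof (intro subspace_ofI P.arity_vectorspace)
      show "?G n \<subseteq> ops P n" using ops by blast
      show "\<zero>\<^bsub>arity_space P n\<^esub> \<in> ?G n" by (rule memI) (rule sub(2))
      show "x \<oplus>\<^bsub>arity_space P n\<^esub> y \<in> ?G n" if "x \<in> ?G n" "y \<in> ?G n" for x y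
        by (rule memI) (rule sub(3)[OF _ generated_ideal_least[OF _ _ that(1)] generated_ideal_least[OF _ _ that(2)]])
      show "c \<odot>\<^bsub>arity_space P n\<^esub> x \<in> ?G n" if "x \<in> ?G n" for c x
        by (rule memI) (rule sub(4)[OF _ generated_ideal_least[OF _ _ that]])
    qed
    show "sym_act P n \<sigma> x \<in> ?G n" if "\<sigma> permutes {1..n}" "x \<in> ?G n" for n \<sigma> x
      by (rule memI) (rule operad_idealD(2)[OF _ that(1) generated_ideal_least[OF _ _ that(2)]])
    show "pcomp P m n i x y \<in> ?G (m + n - 1)" if "i \<in> {1..m}" "x \<in> ?G m" "y \<in> ops P n" for m n i x y
      by (rule memI) (rule operad_idealD(3)[OF _ that(1) generated_ideal_least[OF _ _ that(2)] that(3)])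
    show "pcomp P m n i x y \<in> ?G (m + n - 1)" if "i \<in> {1..m}" "x \<in> ops P m" "y \<in> ?G n" for m n i x y
      by (rule memI) (rule operad_idealD(4)[OF _ that(1,2) generated_ideal_least[OF _ _ that(3)]])
  qed
qed

text \<open>Preimages of ideals under operad homomorphisms are ideals. A homomorphism therefore maps
  one generated ideal into another as soon as it does so for the generators, and no description of
  the ideals in higher arities is required.\<close>

lemma generated_quot_isomorphic:
  assumes P: "operad P" "\<And>n. R n \<subseteq> ops P n" and Q: "operad Q" "\<And>n. S n \<subseteq> ops Q n"
    and \<phi>: "\<phi> \<in> operad_hom P Q" and \<psi>: "\<psi> \<in> operad_hom Q P"
    and \<psi>\<phi>: "\<And>n x. x \<in> ops P n \<Longrightarrow> \<psi> n (\<phi> n x) = x" and \<phi>\<psi>: "\<And>n y. y \<in> ops Q n \<Longrightarrow> \<phi> n (\<psi> n y) = y"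
    and RS: "\<And>n x. x \<in> R n \<Longrightarrow> \<phi> n x \<in> generated_ideal Q S n"
    and SR: "\<And>n y. y \<in> S n \<Longrightarrow> \<psi> n y \<in> generated_ideal P R n"
  shows "operad_isomorphic (quot_operad P (generated_ideal P R)) (quot_operad Q (generated_ideal Q S))"
proof -
  note ideal = generated_ideal_ideal[of P R, OF P] generated_ideal_ideal[of Q S, OF Q]
  show ?thesis
  proof (rule quot_operad_isomorphic[OF P(1) ideal(1) Q(1) ideal(2) \<phi> \<psi> \<psi>\<phi> \<phi>\<psi>])
    show "\<phi> n x \<in> generated_ideal Q S n" if "x \<in> generated_ideal P R n" for n x
    proof -
      have "R n \<subseteq> {x \<in> ops P n. \<phi> n x \<in> generated_ideal Q S n}" for n using P(2)[of n] RS by blast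
      from generated_ideal_least[OF operad_ideal_vimage[OF P(1) Q(1) ideal(2) \<phi>] this that] show ?thesis by blast
    qed
    show "\<psi> n y \<in> generated_ideal P R n" if "y \<in> generated_ideal Q S n" for n y
    proof -
      have "S n \<subseteq> {y \<in> ops Q n. \<psi> n y \<in> generated_ideal P R n}" for n using Q(2)[of n] SR by blast
      from generated_ideal_least[OF operad_ideal_vimage[OF Q(1) P(1) ideal(1) \<psi>] this that] show ?thesis by blast
    qed
  qed
qed

section \<open>The free operad as a quotient of an operad of trees\<close>

subsection \<open>Relabelling and grafting\<close>

lemma relabel_relabel: "relabel f (relabel g t) = relabel (\<lambda>j. f (g j)) t"
  by (induction t) auto

lemma relabel_cong: "(\<And>j. j \<in> set (leaves t) \<Longrightarrow> f j = g j) \<Longrightarrow> relabel f t = relabel g t"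
  by (induction t) auto

lemma relabel_ident: "(\<And>j. j \<in> set (leaves t) \<Longrightarrow> f j = j) \<Longrightarrow> relabel f t = t"
  by (induction t) auto

lemma leaves_relabel [simp]: "leaves (relabel f t) = map f (leaves t)"
  by (induction t) auto

lemma labels_relabel [simp]: "labels (relabel f t) = labels t"
  by (induction t) auto

lemma leaves_nonempty [simp]: "leaves t \<noteq> []"
  by (induction t) auto

lemma leaves_map_ptree [simp]: "leaves (map_ptree f t) = leaves t"
  by (induction t) auto

lemma treesD:
  assumes "t \<in> trees V n"
  shows "labels t \<subseteq> carrier V" "distinct (leaves t)" "set (leaves t) = {1..n}" "1 \<le> n"
proof -
  show *: "labels t \<subseteq> carrier V" "distinct (leaves t)" "set (leaves t) = {1..n}"
    using assms by (auto simp: trees_def)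
  show "1 \<le> n"
  proof (rule ccontr)
    assume "\<not> 1 \<le> n"
    then have "set (leaves t) = {}" using *(3) by simp
    then show False by simp
  qed
qed

lemma relabel_trees:
  assumes "t \<in> trees V n" "\<sigma> permutes {1..n}"
  shows "relabel \<sigma> t \<in> trees V n"
  using assms permutes_image[OF assms(2)] inj_on_subset[OF permutes_inj[OF assms(2)] subset_UNIV]
  by (auto simp: trees_def distinct_map)

lemma labels_graft: "labels (graft i n t s) \<subseteq> labels t \<union> labels s"
  by (induction t) auto

lemma leaves_graft: "leaves (graft i n t s) =
    concat (map (\<lambda>j. if j = i then map (\<lambda>k. k + i - 1) (leaves s) else [shift_input i n j]) (leaves t))"
  by (induction t) auto

lemma distinct_concat_map:
  assumes "distinct xs" "\<And>x. x \<in> set xs \<Longrightarrow> distinct (g x)"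
    "\<And>x y. x \<in> set xs \<Longrightarrow> y \<in> set xs \<Longrightarrow> x \<noteq> y \<Longrightarrow> set (g x) \<inter> set (g y) = {}"
  shows "distinct (concat (map g xs))"
  using assms
proof (induction xs)
  case (Cons x xs)
  have "set (g x) \<inter> set (g y) = {}" if "y \<in> set xs" for y
    using Cons.prems(1) that by (intro Cons.prems(3)) auto
  then have "set (g x) \<inter> \<Union> (set ` set (map g xs)) = {}" by auto
  then show ?case using Cons by simp
qed simp

text \<open>Leaf \<open>i\<close> is replaced by the block \<open>{i..<i + n}\<close>, and
  \<open>shift_input\<close> sends the other leaves injectively onto the rest of
  \<open>{1..m + n - 1}\<close>. A tree has at least one leaf, so \<open>n\<close> is positive
  here.\<close>

lemma graft_trees:
  assumes t: "t \<in> trees V m" and s: "s \<in> trees V n" and i: "i \<in> {1..m}"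
  shows "graft i n t s \<in> trees V (m + n - 1)"
proof -
  let ?g = "\<lambda>j. if j = i then map (\<lambda>k. k + i - 1) (leaves s) else [shift_input i n j]"
  note t = treesD[OF t] and s = treesD[OF s]
  have img: "(\<lambda>k. k + i - 1) ` {1..n} = {i..<i + n}"
  proof (intro equalityI subsetI)
    fix x assume "x \<in> {i..<i + n}"
    then have "x = (x + 1 - i) + i - 1" "x + 1 - i \<in> {1..n}" using i by auto
    then show "x \<in> (\<lambda>k. k + i - 1) ` {1..n}" by blast
  qed (use i in auto)
  have g: "set (?g j) = (if j = i then {i..<i + n} else {shift_input i n j})" for j
    by (simp only: if_distrib[of set] set_map s(3) img) simp
  have "set (leaves (graft i n t s)) = (\<Union>j\<in>{1..m}. set (?g j))"
    unfolding leaves_graft set_concat set_map t(3) by blast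
  also have "\<dots> = {1..m + n - 1}"
  proof (intro equalityI subsetI)
    fix x assume "x \<in> (\<Union>j\<in>{1..m}. set (?g j))"
    then obtain j where j: "j \<in> {1..m}" "x \<in> (if j = i then {i..<i + n} else {shift_input i n j})"
      unfolding g by blast
    then show "x \<in> {1..m + n - 1}"
      using i s(4) by (cases "j = i") (auto simp: shift_input_def split: if_splits)
  next
    fix x assume x: "x \<in> {1..m + n - 1}"
    consider "x < i" | "i \<le> x" "x < i + n" | "i + n \<le> x" by linarith
    then show "x \<in> (\<Union>j\<in>{1..m}. set (?g j))"
    proof cases
      case 1
      then have "x \<in> {1..m}" "x \<in> set (?g x)" using x i by (auto simp: shift_input_def)
      then show ?thesis by blast
    next
      case 2
      then have "x \<in> set (?g i)" unfolding g by simp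
      then show ?thesis using i by blast
    next
      case 3
      then have "x + 1 - n \<in> {1..m}" "x \<in> set (?g (x + 1 - n))"
        unfolding g using x i s(4) by (auto simp: shift_input_def)
      then show ?thesis by blast
    qed
  qed
  finally have "set (leaves (graft i n t s)) = {1..m + n - 1}" .
  moreover have "distinct (leaves (graft i n t s))"
    unfolding leaves_graft
  proof (rule distinct_concat_map)
    show "distinct (?g j)" if "j \<in> set (leaves t)" for j
      using s i by (auto simp: distinct_map inj_on_def)
    show "set (?g x) \<inter> set (?g y) = {}" if "x \<in> set (leaves t)" "y \<in> set (leaves t)" "x \<noteq> y" for x y
      unfolding g using that t(3) i s(4) by (auto simp: shift_input_def split: if_splits)
  qed (rule t)
  moreover have "labels (graft i n t s) \<subseteq> carrier V"
    using labels_graft[of i n t s] t(1) s(1) by auto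
  ultimately show ?thesis by (simp add: trees_def)
qed

lemma graft_unit: "graft (Suc 0) n (Leaf (Suc 0)) s = s" "graft i (Suc 0) t (Leaf (Suc 0)) = t"
  by (auto intro: relabel_ident) (induction t, auto simp: shift_input_def)

lemma graft_relabel_add:
  assumes "1 \<le> i" "1 \<le> j"
  shows "graft (i + j - 1) n (relabel (\<lambda>k. k + i - 1) s) u = relabel (\<lambda>k. k + i - 1) (graft j n s u)"
proof (induction s)
  case (Leaf k)
  show ?case
  proof (cases "k = j")
    case True
    then show ?thesis using assms by (auto simp: relabel_relabel intro!: relabel_cong)
  next
    case False
    then have "k + i - 1 \<noteq> i + j - 1" using assms by auto
    then show ?thesis using assms False by (auto simp: shift_input_def)
  qed
qed simp

text \<open>After the first grafting only leaves coming from \<open>s\<close> can carry the number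
  \<open>i + j - 1\<close>: the shifted leaves of \<open>t\<close> avoid the block
  \<open>{i..<i + m}\<close> in which it lies. The second grafting thus takes place inside
  \<open>s\<close>.\<close>

lemma graft_sequential:
  assumes "1 \<le> i" "j \<in> {1..m}"
  shows "graft (i + j - 1) n (graft i m t s) u = graft i (m + n - 1) t (graft j n s u)"
proof (induction t)
  case (Leaf k)
  show ?case
  proof (cases "k = i")
    case True
    then show ?thesis using graft_relabel_add[of i j n s u] assms by simp
  next
    case False
    then have "shift_input i m k \<noteq> i + j - 1" using assms by (auto simp: shift_input_def)
    then show ?thesis using assms False by (auto simp: shift_input_def)
  qed
qed simp

lemma graft_below: "(\<And>j. j \<in> set (leaves t) \<Longrightarrow> j < p) \<Longrightarrow> graft p n t s = t"
  by (induction t) (auto simp: shift_input_def)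

lemma graft_above: "(\<And>j. j \<in> set (leaves t) \<Longrightarrow> p < j) \<Longrightarrow> graft p n t s = relabel (\<lambda>j. j + n - 1) t"
  by (induction t) (auto simp: shift_input_def)

text \<open>The two insertions do not interact: at leaf \<open>i\<close> the leaves of
  \<open>s\<close> stay below \<open>k + m - 1\<close>, and at leaf \<open>k\<close> the leaves of
  \<open>u\<close> lie above \<open>i\<close> and are merely shifted by
  \<open>m - 1\<close>.\<close>

lemma graft_parallel:
  assumes "1 \<le> i" "i < k" "set (leaves s) = {1..m}" "set (leaves u) \<subseteq> {1..}" "1 \<le> m"
  shows "graft (k + m - 1) n (graft i m t s) u = graft i m (graft k n t u) s"
proof (induction t)
  case (Leaf j)
  consider "j = i" | "j = k" | "j \<noteq> i" "j \<noteq> k" by blast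
  then show ?case
  proof cases
    case 1
    have "graft (k + m - 1) n (relabel (\<lambda>k. k + i - 1) s) u = relabel (\<lambda>k. k + i - 1) s"
      by (rule graft_below) (use assms in auto)
    then show ?thesis using 1 assms by (simp add: shift_input_def)
  next
    case 2
    have "graft i m (relabel (\<lambda>j. j + k - 1) u) s = relabel (\<lambda>j. j + m - 1) (relabel (\<lambda>j. j + k - 1) u)"
      by (rule graft_above) (use assms in force)
    also have "\<dots> = relabel (\<lambda>j. j + (k + m - 1) - 1) u"
      unfolding relabel_relabel by (rule relabel_cong) (use assms in auto)
    finally show ?thesis using 2 assms by (simp add: shift_input_def)
  next
    case 3
    then consider "j < i" | "i < j" "j < k" | "k < j" by linarith
    then show ?thesis using assms(1,2,5) by cases (cases m; cases j; simp add: shift_input_def)+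
  qed
qed simp

lemma graft_relabel_inner:
  assumes "set (leaves s) \<subseteq> {1..n}" "1 \<le> i"
  shows "graft i n t (relabel \<tau> s) = relabel (perm_inner i n \<tau>) (graft i n t s)"
proof (induction t)
  case (Leaf j)
  show ?case
  proof (cases "j = i")
    case True
    have "\<tau> k + i - 1 = perm_inner i n \<tau> (k + i - 1)" if "k \<in> set (leaves s)" for k
    proof -
      have "1 \<le> k" "k \<le> n" using that assms by auto
      then show ?thesis using assms by (auto simp: perm_inner_def)
    qed
    then show ?thesis using True by (auto simp: relabel_relabel intro!: relabel_cong)
  next
    case False
    then show ?thesis using assms by (auto simp: shift_input_def perm_inner_def)
  qed
qed simp

text \<open>The action relabels by inverse permutations, so this is applied with
  \<open>inv_into UNIV \<sigma>\<close> for \<tau> and \<open>\<sigma> i\<close> for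
  \<open>p\<close>; grafting after relabelling then happens at leaf \<open>i\<close>.\<close>

lemma graft_relabel_outer:
  assumes "set (leaves s) \<subseteq> {1..n}" "1 \<le> n" "1 \<le> p" "1 \<le> \<tau> p" "inj \<tau>"
  shows "graft (\<tau> p) n (relabel \<tau> t) s = relabel (perm_outer p n \<tau>) (graft p n t s)"
proof (induction t)
  case (Leaf j)
  show ?case
  proof (cases "j = p")
    case True
    have "k + \<tau> p - 1 = perm_outer p n \<tau> (k + p - 1)" if "k \<in> set (leaves s)" for k
    proof -
      have "1 \<le> k" "k \<le> n" using that assms by auto
      then show ?thesis using assms by (auto simp: perm_outer_def)
    qed
    then show ?thesis using True by (auto simp: relabel_relabel intro!: relabel_cong)
  next
    case False
    then have "\<tau> j \<noteq> \<tau> p" using assms(5) by (auto dest: injD)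
    then show ?thesis using False assms(1-4) by (auto simp: shift_input_def perm_outer_def)
  qed
qed simp

subsection \<open>The operad of trees\<close>

text \<open>Formal sums of trees form an operad before any relation is imposed. The free operad is
  literally its quotient by \<open>tree_kernel\<close>, so the theory of quotient operads yields its
  axioms and is used a second time when relations are divided out.\<close>

definition tree_operad :: "('k::field, 'v) s2_module \<Rightarrow> ('k, 'v ptree \<Rightarrow>\<^sub>0 'k) operad" where
  "tree_operad V =
     \<lparr>arity_space = (\<lambda>n. free_vs (trees V n)),
      sym_act = (\<lambda>n \<sigma>. push (relabel (inv_into UNIV \<sigma>))),
      op_unit = single (Leaf 1) 1,
      pcomp = (\<lambda>m n i. push2 (graft i n))\<rparr>"

lemma tree_operad_simps [simp]:
  "arity_space (tree_operad V) n = free_vs (trees V n)"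
  "sym_act (tree_operad V) n \<sigma> = push (relabel (inv_into UNIV \<sigma>))"
  "op_unit (tree_operad V) = single (Leaf 1) 1"
  "pcomp (tree_operad V) m n i = push2 (graft i n)"
  by (simp_all add: tree_operad_def)

lemma push_push: "push f (push g p) = push (\<lambda>x. f (g x)) p"
  using subset_UNIV[of "keys p"]
  by (induction p rule: poly_mapping_keys_induct) (simp_all add: push_add)

lemma push_ident:
  assumes "keys p \<subseteq> X" "\<And>x. x \<in> X \<Longrightarrow> f x = x"
  shows "push f p = p"
  using assms(1) by (induction p rule: poly_mapping_keys_induct) (simp_all add: push_add assms(2))

text \<open>Both sides are trilinear, so the identity between basis elements suffices; the arguments
  are expanded one at a time, beginning with \<open>r\<close>.\<close>

lemma push2_assoc_eq:
  assumes p: "keys p \<subseteq> X" and q: "keys q \<subseteq> Y" and r: "keys r \<subseteq> Z"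
    and eq: "\<And>x y z. x \<in> X \<Longrightarrow> y \<in> Y \<Longrightarrow> z \<in> Z \<Longrightarrow> f (g x y) z = f' x (g' y z)"
  shows "push2 f (push2 g p q) r = push2 f' p (push2 g' q r)"
proof -
  have 1: "push2 f (push2 g (single x c) (single y d)) r =
      push2 f' (single x c) (push2 g' (single y d) r)"
    if "x \<in> X" "y \<in> Y" for x y c d
    using r by (induction r rule: poly_mapping_keys_induct) (simp_all add: push2_add_right eq that mult.assoc)
  have 2: "push2 f (push2 g (single x c) q) r = push2 f' (single x c) (push2 g' q r)"
    if "x \<in> X" for x c
    using q by (induction q rule: poly_mapping_keys_induct)
      (simp_all add: push2_add_right push2_add_left 1 that del: push2_single)
  show ?thesis
    using p by (induction p rule: poly_mapping_keys_induct) (simp_all add: push2_add_right push2_add_left 2)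
qed

lemma push2_commute_eq:
  assumes p: "keys p \<subseteq> X" and q: "keys q \<subseteq> Y" and r: "keys r \<subseteq> Z"
    and eq: "\<And>x y z. x \<in> X \<Longrightarrow> y \<in> Y \<Longrightarrow> z \<in> Z \<Longrightarrow> f (g x y) z = f' (g' x z) y"
  shows "push2 f (push2 g p q) r = push2 f' (push2 g' p r) q"
proof -
  have 1: "push2 f (push2 g (single x c) (single y d)) r =
      push2 f' (push2 g' (single x c) r) (single y d)"
    if "x \<in> X" "y \<in> Y" for x y c d
    using r by (induction r rule: poly_mapping_keys_induct) (simp_all add: push2_add_right push2_add_left eq that ac_simps)
  have 2: "push2 f (push2 g (single x c) q) r = push2 f' (push2 g' (single x c) r) q"
    if "x \<in> X" for x c
    using q by (induction q rule: poly_mapping_keys_induct)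
      (simp_all add: push2_add_right push2_add_left 1 that del: push2_single)
  show ?thesis
    using p by (induction p rule: poly_mapping_keys_induct) (simp_all add: push2_add_right push2_add_left 2)
qed

lemma push_push2_eq:
  assumes p: "keys p \<subseteq> X" and q: "keys q \<subseteq> Y"
    and eq: "\<And>x y. x \<in> X \<Longrightarrow> y \<in> Y \<Longrightarrow> h (f x y) = f' (g x) (g' y)"
  shows "push h (push2 f p q) = push2 f' (push g p) (push g' q)"
proof -
  have 1: "push h (push2 f (single x c) q) = push2 f' (push g (single x c)) (push g' q)"
    if "x \<in> X" for x c
    using q by (induction q rule: poly_mapping_keys_induct) (simp_all add: push2_add_right push_add eq that)
  show ?thesis
    using p by (induction p rule: poly_mapping_keys_induct) (simp_all add: push2_add_left push_add 1 del: push_single)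
qed

lemma push_id: "push (\<lambda>x. x) p = p"
  by (rule push_ident[OF subset_UNIV]) simp

lemma tree_operad_operad: "operad (tree_operad V)"
proof (rule operad.intro; (unfold tree_operad_simps free_vs_simps mem_Collect_eq)?)
  show "vectorspace class_ring (free_vs (trees V n) :: ('a, _) module)" for n by (rule free_vs_vectorspace)
  show "push (relabel (inv_into UNIV \<sigma>)) \<in> linear_maps (free_vs (trees V n)) (free_vs (trees V n))"
    if "\<sigma> permutes {1..n}" for \<sigma> n
    using relabel_trees[OF _ permutes_inv[OF that]] by (rule push_linear)
  show "push (relabel (inv_into UNIV id)) x = x" for x :: "'b ptree \<Rightarrow>\<^sub>0 'a"
    by (rule push_ident[OF subset_UNIV]) (simp add: relabel_ident inv_id)
  show "push (relabel (inv_into UNIV (\<sigma> \<circ> \<tau>))) x = push (relabel (inv_into UNIV \<tau>)) (push (relabel (inv_into UNIV \<sigma>)) x)"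
    if "\<sigma> permutes {1..n}" "\<tau> permutes {1..n}" for \<sigma> \<tau> n and x :: "'b ptree \<Rightarrow>\<^sub>0 'a"
    using o_inv_distrib[OF permutes_bij[OF that(1)] permutes_bij[OF that(2)]]
    by (simp add: push_push relabel_relabel comp_def)
  show "keys (single (Leaf 1) (1::'a)) \<subseteq> trees V 1"
    by (simp add: trees_def)
  show "(\<lambda>x. push2 (graft i n) x y) \<in> linear_maps (free_vs (trees V m)) (free_vs (trees V (m + n - 1)))"
    if "i \<in> {1..m}" "keys y \<subseteq> trees V n" for i m n and y :: "'b ptree \<Rightarrow>\<^sub>0 'a"
    using graft_trees[OF _ _ that(1)] that(2) by (rule push2_linear_left)
  show "push2 (graft i n) x \<in> linear_maps (free_vs (trees V n)) (free_vs (trees V (m + n - 1)))"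
    if "i \<in> {1..m}" "keys x \<subseteq> trees V m" for i m n and x :: "'b ptree \<Rightarrow>\<^sub>0 'a"
    using graft_trees[OF _ _ that(1)] that(2) by (rule push2_linear_right)
  show "push2 (graft 1 n) (single (Leaf 1) 1) y = y" for n and y :: "'b ptree \<Rightarrow>\<^sub>0 'a"
    unfolding push2_single_left by (rule push_ident[OF subset_UNIV]) (simp add: graft_unit del: graft.simps)
  show "push2 (graft i 1) x (single (Leaf 1) 1) = x" for i and x :: "'b ptree \<Rightarrow>\<^sub>0 'a"
    unfolding push2_single_right by (rule push_ident[OF subset_UNIV]) (simp add: graft_unit)
  show "push2 (graft (i + j - 1) n) (push2 (graft i m) x y) z = push2 (graft i (m + n - 1)) x (push2 (graft j n) y z)"
    if "i \<in> {1..l}" "j \<in> {1..m}" for i j l m n and x y z :: "'b ptree \<Rightarrow>\<^sub>0 'a"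
    using that by (intro push2_assoc_eq[OF subset_UNIV subset_UNIV subset_UNIV] graft_sequential) auto
  show "push2 (graft (k + m - 1) n) (push2 (graft i m) x y) z = push2 (graft i m) (push2 (graft k n) x z) y"
    if "1 \<le> i" "i < k" "keys y \<subseteq> trees V m" "keys z \<subseteq> trees V n"
    for i k m n and x y z :: "'b ptree \<Rightarrow>\<^sub>0 'a"
    using that(1,2) treesD(3,4)[of _ V]
    by (intro push2_commute_eq[OF subset_UNIV that(3,4)] graft_parallel) auto
  show "push2 (graft i n) x (push (relabel (inv_into UNIV \<sigma>)) y) =
      push (relabel (inv_into UNIV (perm_inner i n \<sigma>))) (push2 (graft i n) x y)"
    if "i \<in> {1..m}" "\<sigma> permutes {1..n}" "keys y \<subseteq> trees V n" for i m n \<sigma> and x y :: "'b ptree \<Rightarrow>\<^sub>0 'a"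
  proof -
    have "1 \<le> i" using that by auto
    then have "push (relabel (inv_into UNIV (perm_inner i n \<sigma>))) (push2 (graft i n) x y) =
        push2 (graft i n) (push (\<lambda>x. x) x) (push (relabel (inv_into UNIV \<sigma>)) y)"
      unfolding perm_inner_inv[OF that(2) \<open>1 \<le> i\<close>] using treesD(3)[of _ V n]
      by (intro push_push2_eq[OF subset_UNIV that(3)] graft_relabel_inner[symmetric]) auto
    then show ?thesis by (simp add: push_id)
  qed
  show "push2 (graft i n) (push (relabel (inv_into UNIV \<sigma>)) x) y =
      push (relabel (inv_into UNIV (perm_outer i n \<sigma>))) (push2 (graft (\<sigma> i) n) x y)"
    if i: "i \<in> {1..m}" and \<sigma>: "\<sigma> permutes {1..m}" and y: "keys y \<subseteq> trees V n"
    for i m n \<sigma> and x y :: "'b ptree \<Rightarrow>\<^sub>0 'a"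
  proof -
    have pos: "1 \<le> i" "1 \<le> \<sigma> i" using i permutes_mem[OF \<sigma> i] by auto
    have *: "inv_into UNIV \<sigma> (\<sigma> i) = i" "inj (inv_into UNIV \<sigma>)"
      using permutes_inverses(2)[OF \<sigma>] permutes_inj[OF permutes_inv[OF \<sigma>]] by auto
    have "graft i n (relabel (inv_into UNIV \<sigma>) t) s = relabel (perm_outer (\<sigma> i) n (inv_into UNIV \<sigma>)) (graft (\<sigma> i) n t s)"
      if "s \<in> trees V n" for t s
      using graft_relabel_outer[of s n "\<sigma> i" "inv_into UNIV \<sigma>" t] treesD[OF that] pos * by simp
    then have "push (relabel (inv_into UNIV (perm_outer i n \<sigma>))) (push2 (graft (\<sigma> i) n) x y) =
        push2 (graft i n) (push (relabel (inv_into UNIV \<sigma>)) x) (push (\<lambda>x. x) y)"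
      unfolding perm_outer_inv[OF \<sigma> i] by (intro push_push2_eq[OF subset_UNIV y]) simp
    then show ?thesis by (simp add: push_id)
  qed
qed

subsection \<open>The ideal of tree relations\<close>

lemma s2_moduleD:
  assumes "s2_module V"
  shows "vectorspace class_ring V" "swap V \<in> linear_maps V V"
    "\<And>x. x \<in> carrier V \<Longrightarrow> swap V x \<in> carrier V" "\<And>x. x \<in> carrier V \<Longrightarrow> swap V (swap V x) = x"
    "\<And>x y. x \<in> carrier V \<Longrightarrow> y \<in> carrier V \<Longrightarrow> x \<oplus>\<^bsub>V\<^esub> y \<in> carrier V"
    "\<And>c x. x \<in> carrier V \<Longrightarrow> c \<odot>\<^bsub>V\<^esub> x \<in> carrier V"
proof -
  interpret s2_module V by fact
  show "vectorspace class_ring V" by unfold_locales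
  show "swap V \<in> linear_maps V V" by (rule swap_linear)
  show "swap V x \<in> carrier V" if "x \<in> carrier V" for x using linear_mapsD(1)[OF swap_linear that] .
  show "swap V (swap V x) = x" if "x \<in> carrier V" for x by (rule swap_swap[OF that])
  show "x \<oplus>\<^bsub>V\<^esub> y \<in> carrier V" if "x \<in> carrier V" "y \<in> carrier V" for x y using that by simp
  show "c \<odot>\<^bsub>V\<^esub> x \<in> carrier V" if "x \<in> carrier V" for c x using that by (simp add: smult_closed)
qed

text \<open>What a context contributes does not depend on its filling. Together with the same fact
  for leaves, this lets a vertex be relabelled or its subtrees be exchanged without leaving
  \<open>trees V n\<close>.\<close>

lemma tree_context_labels: "tree_context C \<Longrightarrow> \<exists>L. \<forall>t. labels (C t) = L \<union> labels t"
proof (induction rule: tree_context.induct)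
  case hole
  then show ?case by (intro exI[of _ "{}"]) simp
next
  case (left C v r)
  then obtain L where "\<And>t. labels (C t) = L \<union> labels t" by blast
  then show ?case by (intro exI[of _ "insert v (L \<union> labels r)"]) auto
next
  case (right C v l)
  then obtain L where "\<And>t. labels (C t) = L \<union> labels t" by blast
  then show ?case by (intro exI[of _ "insert v (L \<union> labels l)"]) auto
qed

lemma tree_context_leaves: "tree_context C \<Longrightarrow> \<exists>xs ys. \<forall>t. leaves (C t) = xs @ leaves t @ ys"
proof (induction rule: tree_context.induct)
  case hole
  then show ?case by (intro exI[of _ "[]"]) simp
next
  case (left C v r)
  then obtain xs ys where "\<And>t. leaves (C t) = xs @ leaves t @ ys" by blast
  then show ?case by (intro exI[of _ xs] exI[of _ "ys @ leaves r"]) auto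
next
  case (right C v l)
  then obtain xs ys where "\<And>t. leaves (C t) = xs @ leaves t @ ys" by blast
  then show ?case by (intro exI[of _ "leaves l @ xs"] exI[of _ ys]) auto
qed

lemma tree_context_trees:
  assumes "tree_context C" "C (Node a l r) \<in> trees V n"
  shows "a \<in> carrier V" "b \<in> carrier V \<Longrightarrow> C (Node b l r) \<in> trees V n"
    "b \<in> carrier V \<Longrightarrow> C (Node b r l) \<in> trees V n"
proof -
  obtain L where L: "\<And>t. labels (C t) = L \<union> labels t" using tree_context_labels[OF assms(1)] by blast
  obtain xs ys where xs: "\<And>t. leaves (C t) = xs @ leaves t @ ys" using tree_context_leaves[OF assms(1)] by blast
  show "a \<in> carrier V" "b \<in> carrier V \<Longrightarrow> C (Node b l r) \<in> trees V n"
    "b \<in> carrier V \<Longrightarrow> C (Node b r l) \<in> trees V n"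
    using assms(2) by (auto simp: trees_def L xs)
qed

lemma tree_context_compose: "tree_context C \<Longrightarrow> tree_context D \<Longrightarrow> tree_context (\<lambda>t. C (D t))"
  by (induction rule: tree_context.induct) (auto intro: tree_context.intros)

definition s2_hom :: "('k::field, 'v) s2_module \<Rightarrow> ('k, 'w) s2_module \<Rightarrow> ('v \<Rightarrow> 'w) set" where
  "s2_hom V W = {f \<in> linear_maps V W. \<forall>x\<in>carrier V. f (swap V x) = swap W (f x)}"

abbreviation tree_kernel :: "('k::field, 'v) s2_module \<Rightarrow> nat \<Rightarrow> ('v ptree \<Rightarrow>\<^sub>0 'k) set" where
  "tree_kernel V n \<equiv> span_in (free_vs (trees V n)) (tree_relations V n)"

lemma tree_relations_carrier:
  assumes "s2_module V"
  shows "tree_relations V n \<subseteq> carrier (free_vs (trees V n))"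
proof
  note V = s2_moduleD[OF assms]
  fix x assume "x \<in> tree_relations V n"
  then show "x \<in> carrier (free_vs (trees V n))"
    unfolding tree_relations_def free_vs_simps
    by (elim UnE CollectE exE conjE; hypsubst)
      (intro CollectI keys_diff_subset keys_single_subset; auto intro: tree_context_trees V)+
qed

lemma tree_relations_cases [consumes 1, case_names add smult swap]:
  assumes "x \<in> tree_relations V n"
  obtains C a b l r where "tree_context C" "C (Node a l r) \<in> trees V n" "C (Node b l r) \<in> trees V n"
      "x = single (C (Node (a \<oplus>\<^bsub>V\<^esub> b) l r)) 1
        - single (C (Node a l r)) 1 - single (C (Node b l r)) 1"
  | C a c l r where "tree_context C" "C (Node a l r) \<in> trees V n"
      "x = single (C (Node (c \<odot>\<^bsub>V\<^esub> a) l r)) 1 - single (C (Node a l r)) c"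
  | C a l r where "tree_context C" "C (Node a l r) \<in> trees V n"
      "x = single (C (Node a l r)) 1 - single (C (Node (swap V a) r l)) 1"
  using assms unfolding tree_relations_def by blast

text \<open>A common criterion for relabelling, grafting, change of generators and
  \<open>TSu\<close>: the vertex at which a relation takes place must again sit in a context, with a
  label that depends linearly on the old one. The separate function \<open>f'\<close> for exchanged
  subtrees is there for \<open>TSu\<close>, whose labels depend on the side on which leaves lie; for
  maps acting on labels alone \<open>f'\<close> is \<open>f\<close>.\<close>

lemma tree_relations_push:
  assumes V: "s2_module V" and W: "s2_module W"
    and trees: "\<And>t. t \<in> trees V m \<Longrightarrow> h t \<in> trees W m'"
    and ctx: "\<And>C a l r. tree_context C \<Longrightarrow> C (Node a l r) \<in> trees V m \<Longrightarrow>
      \<exists>C' f f' l' r'. tree_context C' \<and> f \<in> linear_maps V W \<and>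
        (\<forall>a\<in>carrier V. h (C (Node a l r)) = C' (Node (f a) l' r') \<and>
          h (C (Node a r l)) = C' (Node (f' a) r' l') \<and> f' (swap V a) = swap W (f a))"
    and p: "p \<in> tree_kernel V m"
  shows "push h p \<in> tree_kernel W m'"
proof (rule linear_span_in[OF free_vs_vectorspace free_vs_vectorspace push_linear tree_relations_carrier[OF V]
      span_in_subspace[OF free_vs_vectorspace tree_relations_carrier[OF W]] _ p])
  show "h t \<in> trees W m'" if "t \<in> trees V m" for t by (rule trees[OF that])
  note V = s2_moduleD[OF V]
  fix x assume "x \<in> tree_relations V m"
  then have "push h x \<in> tree_relations W m'"
  proof (cases rule: tree_relations_cases)
    case (add C a b l r)
    from ctx[OF add(1,2)] obtain C' f l' r' where C': "tree_context C'" "f \<in> linear_maps V W"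
      "\<And>a. a \<in> carrier V \<Longrightarrow> h (C (Node a l r)) = C' (Node (f a) l' r')" by blast
    have ab: "a \<in> carrier V" "b \<in> carrier V" using tree_context_trees(1)[OF add(1,2)] tree_context_trees(1)[OF add(1,3)] by auto
    then have "push h x = single (C' (Node (f a \<oplus>\<^bsub>W\<^esub> f b) l' r')) 1
        - single (C' (Node (f a) l' r')) 1 - single (C' (Node (f b) l' r')) 1"
      using V(5)[OF ab] by (simp add: add(4) push_diff C' linear_mapsD(2)[OF C'(2) ab])
    moreover have "C' (Node (f a) l' r') \<in> trees W m'" "C' (Node (f b) l' r') \<in> trees W m'"
      using trees[OF add(2)] trees[OF add(3)] ab by (simp_all add: C')
    ultimately show ?thesis unfolding tree_relations_def using C'(1) by blast
  next
    case (smult C a c l r)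
    from ctx[OF smult(1,2)] obtain C' f l' r' where C': "tree_context C'" "f \<in> linear_maps V W"
      "\<And>a. a \<in> carrier V \<Longrightarrow> h (C (Node a l r)) = C' (Node (f a) l' r')" by blast
    have a: "a \<in> carrier V" by (rule tree_context_trees(1)[OF smult(1,2)])
    then have "push h x = single (C' (Node (c \<odot>\<^bsub>W\<^esub> f a) l' r')) 1
        - single (C' (Node (f a) l' r')) c"
      using V(6)[OF a] by (simp add: smult(3) push_diff C' linear_mapsD(3)[OF C'(2) a])
    moreover have "C' (Node (f a) l' r') \<in> trees W m'"
      using trees[OF smult(2)] a by (simp add: C')
    ultimately show ?thesis unfolding tree_relations_def using C'(1) by blast
  next
    case (swap C a l r)
    from ctx[OF swap(1,2)] obtain C' f f' l' r' where C': "tree_context C'"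
      "\<And>a. a \<in> carrier V \<Longrightarrow> h (C (Node a l r)) = C' (Node (f a) l' r')"
      "\<And>a. a \<in> carrier V \<Longrightarrow> h (C (Node a r l)) = C' (Node (f' a) r' l')"
      "\<And>a. a \<in> carrier V \<Longrightarrow> f' (s2_module.swap V a) = s2_module.swap W (f a)" by blast
    have a: "a \<in> carrier V" by (rule tree_context_trees(1)[OF swap(1,2)])
    then have "push h x = single (C' (Node (f a) l' r')) 1
        - single (C' (Node (s2_module.swap W (f a)) r' l')) 1"
      using V(3)[OF a] by (simp add: swap(3) push_diff C')
    moreover have "C' (Node (f a) l' r') \<in> trees W m'"
      using trees[OF swap(2)] a by (simp add: C')
    ultimately show ?thesis unfolding tree_relations_def using C'(1) by blast
  qed
  then show "push h x \<in> tree_kernel W m'"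
    by (rule span_in_superset[OF free_vs_vectorspace tree_relations_carrier[OF W]])
qed

lemma tree_context_map:
  assumes "tree_context C" and h: "\<And>v l r. h (Node v l r) = Node (f v) (h l) (h r)"
  shows "\<exists>C'. tree_context C' \<and> (\<forall>t. h (C t) = C' (h t))"
  using assms(1)
proof (induction rule: tree_context.induct)
  case hole
  then show ?case by (intro exI[of _ "\<lambda>t. t"]) (simp add: tree_context.hole)
next
  case (left C v r)
  then obtain C' where "tree_context C'" "\<And>t. h (C t) = C' (h t)" by blast
  then show ?case by (intro exI[of _ "\<lambda>t. Node (f v) (C' t) (h r)"]) (simp add: tree_context.left h)
next
  case (right C v l)
  then obtain C' where "tree_context C'" "\<And>t. h (C t) = C' (h t)" by blast
  then show ?case by (intro exI[of _ "\<lambda>t. Node (f v) (h l) (C' t)"]) (simp add: tree_context.right h)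
qed

text \<open>Here \<open>h\<close> changes labels uniformly, so one label map serves for both orders
  of the subtrees; the outer context \<open>D\<close> accounts for grafting into a fixed
  tree.\<close>

lemma tree_kernel_push_map:
  fixes V :: "('k::field, 'v) s2_module" and W :: "('k, 'w) s2_module"
  assumes V: "s2_module V" and W: "s2_module W" and f: "f \<in> s2_hom V W"
    and h: "\<And>v l r. h (Node v l r) = Node (f v) (h l) (h r)" and D: "tree_context D"
    and trees: "\<And>t. t \<in> trees V m \<Longrightarrow> D (h t) \<in> trees W m'" and p: "p \<in> tree_kernel V m"
  shows "push (\<lambda>t. D (h t)) p \<in> tree_kernel W m'"
proof (rule tree_relations_push[OF V W trees _ p])
  fix C a l r assume "tree_context (C :: 'v ptree \<Rightarrow> 'v ptree)"
  from tree_context_map[OF this, of h f, OF h] obtain C' where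
    C': "tree_context C'" "\<And>t. h (C t) = C' (h t)" by blast
  show "\<exists>C' g g' l' r'. tree_context C' \<and> g \<in> linear_maps V W \<and>
      (\<forall>a\<in>carrier V. D (h (C (Node a l r))) = C' (Node (g a) l' r') \<and>
        D (h (C (Node a r l))) = C' (Node (g' a) r' l') \<and> g' (swap V a) = swap W (g a))"
    by (rule exI[of _ "\<lambda>t. D (C' t)"], rule exI[of _ f], rule exI[of _ f], rule exI[of _ "h l"], rule exI[of _ "h r"])
      (use f in \<open>simp add: C' h s2_hom_def tree_context_compose[OF D]\<close>)
qed

lemma s2_hom_id: "(\<lambda>v. v) \<in> s2_hom V V"
  by (simp add: s2_hom_def linear_maps_id)

lemma graft_no_leaf: "i \<notin> set (leaves t) \<Longrightarrow> graft i n t s = relabel (shift_input i n) t"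
  by (induction t) auto

text \<open>As leaf \<open>i\<close> occurs only once, everything except the inserted tree is fixed.
  Composition with a fixed outer tree thus becomes filling the hole of a context.\<close>

lemma graft_is_context:
  "distinct (leaves t) \<Longrightarrow> i \<in> set (leaves t) \<Longrightarrow>
    \<exists>C. tree_context C \<and> (\<forall>s. graft i n t s = C (relabel (\<lambda>k. k + i - 1) s))"
proof (induction t)
  case (Leaf j)
  then show ?case by (intro exI[of _ "\<lambda>t. t"]) (simp add: tree_context.hole)
next
  case (Node v l r)
  show ?case
  proof (cases "i \<in> set (leaves l)")
    case True
    then obtain C where "tree_context C" "\<And>s. graft i n l s = C (relabel (\<lambda>k. k + i - 1) s)"
      using Node by auto
    moreover have "i \<notin> set (leaves r)" using True Node.prems by auto
    ultimately show ?thesis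
      by (intro exI[of _ "\<lambda>t. Node v (C t) (relabel (shift_input i n) r)"]) (simp add: tree_context.left graft_no_leaf)
  next
    case False
    then obtain C where "tree_context C" "\<And>s. graft i n r s = C (relabel (\<lambda>k. k + i - 1) s)"
      using Node by auto
    then show ?thesis using False
      by (intro exI[of _ "\<lambda>t. Node v (relabel (shift_input i n) l) (C t)"]) (simp add: tree_context.right graft_no_leaf)
  qed
qed

lemma single_map_times: "single x c = Poly_Mapping.map ((*) c) (single x (1::'k::field))"
  by simp

text \<open>Composition is linear in the argument outside the kernel, so that argument may be taken
  to be a single tree. Grafting is then a map on trees of the kind already known to preserve the
  relations.\<close>

lemma tree_kernel_ideal:
  fixes V :: "('k::field, 'v) s2_module"
  assumes V: "s2_module V"
  shows "operad_ideal (tree_operad V) (tree_kernel V)"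
  unfolding operad_ideal_def sym_submodule_def tree_operad_simps
proof (intro conjI allI impI; (elim conjE)?)
  note vs = free_vs_vectorspace[where ?'k='k]
  note sub = span_in_subspace[OF vs tree_relations_carrier[OF V]]
  note subD = subspace_ofD[OF sub, unfolded free_vs_simps]
  show "subspace_of (tree_kernel V n) (free_vs (trees V n))" for n by (rule sub)
  show "push (relabel (inv_into UNIV \<sigma>)) x \<in> tree_kernel V n"
    if \<sigma>: "\<sigma> permutes {1..n}" and x: "x \<in> tree_kernel V n" for n \<sigma> x
    by (rule tree_kernel_push_map[OF V V s2_hom_id _ tree_context.hole relabel_trees[OF _ permutes_inv[OF \<sigma>]] x]) simp
  show "push2 (graft i n) x y \<in> tree_kernel V (m + n - 1)"
    if i: "i \<in> {1..m}" and x: "x \<in> tree_kernel V m" and y: "y \<in> carrier (free_vs (trees V n))" for m n i x y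
  proof -
    have 1: "push (\<lambda>t. graft i n t s) x \<in> tree_kernel V (m + n - 1)" if s: "s \<in> trees V n" for s
      by (rule tree_kernel_push_map[OF V V s2_hom_id _ tree_context.hole graft_trees[OF _ s i] x]) simp
    from y have "keys y \<subseteq> trees V n" by simp
    then show ?thesis
    proof (induction rule: poly_mapping_keys_induct)
      case (single s c)
      show ?case
        unfolding single_map_times[of s c] push2_map_times push2_single_right by (rule subD(4)[OF 1[OF single]])
    qed (simp_all add: push2_add_right subD)
  qed
  show "push2 (graft i n) x y \<in> tree_kernel V (m + n - 1)"
    if i: "i \<in> {1..m}" and x: "x \<in> carrier (free_vs (trees V m))" and y: "y \<in> tree_kernel V n" for m n i x y
  proof -
    have 1: "push (graft i n t) y \<in> tree_kernel V (m + n - 1)" if t: "t \<in> trees V m" for t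
    proof -
      obtain D where D: "tree_context D" "\<And>s. graft i n t s = D (relabel (\<lambda>k. k + i - 1) s)"
        using graft_is_context[of t i n] treesD[OF t] i by auto
      have "push (\<lambda>s. D (relabel (\<lambda>k. k + i - 1) s)) y \<in> tree_kernel V (m + n - 1)"
      proof (rule tree_kernel_push_map[OF V V s2_hom_id _ D(1) _ y])
        show "D (relabel (\<lambda>k. k + i - 1) s) \<in> trees V (m + n - 1)" if "s \<in> trees V n" for s
          using graft_trees[OF t that i] by (simp only: D(2))
      qed simp
      then show ?thesis by (simp only: D(2)[abs_def])
    qed
    from x have "keys x \<subseteq> trees V m" by simp
    then show ?thesis
    proof (induction rule: poly_mapping_keys_induct)
      case (single t c)
      show ?case
        unfolding single_map_times[of t c] push2_map_times push2_single_left by (rule subD(4)[OF 1[OF single]])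
    qed (simp_all add: push2_add_left subD)
  qed
qed

lemma free_operad_eq_quot: "free_operad V = quot_operad (tree_operad V) (tree_kernel V)"
  by (simp add: free_operad_def quot_operad_def tree_class_def Let_def)

lemma free_operad_operad: "s2_module V \<Longrightarrow> operad (free_operad V)"
  unfolding free_operad_eq_quot by (intro quot_operad_operad tree_operad_operad tree_kernel_ideal)

lemma tree_class_eq_coset: "tree_class V n p = tree_kernel V n +>\<^bsub>arity_space (tree_operad V) n\<^esub> p"
  by (simp add: tree_class_def Let_def)

lemma free_operad_arity: "arity_space (free_operad V) n = quot_vs (free_vs (trees V n)) (tree_kernel V n)"
  by (simp add: free_operad_def Let_def)

context
  fixes V :: "('k::field, 'v) s2_module"
  assumes V: "s2_module V"
begin

lemma free_operad_vectorspace: "vectorspace class_ring (arity_space (free_operad V) n)"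
  using free_operad_operad[OF V] by (rule operad.arity_vectorspace)

lemma free_operad_ops: "ops (free_operad V) n = {tree_class V n p | p. keys p \<subseteq> trees V n}"
  unfolding free_operad_eq_quot tree_class_eq_coset
  by (simp add: quot_operad_ops[OF tree_operad_operad tree_kernel_ideal[OF V]])

lemma tree_class_linear: "tree_class V n \<in> linear_maps (free_vs (trees V n)) (arity_space (free_operad V) n)"
  using coset_linear[OF free_vs_vectorspace span_in_subspace[OF free_vs_vectorspace tree_relations_carrier[OF V]], of n]
  unfolding free_operad_arity tree_class_def Let_def .

lemma tree_class_eqI:
  assumes "p - q \<in> tree_kernel V n" "keys p \<subseteq> trees V n" "keys q \<subseteq> trees V n"
  shows "tree_class V n p = tree_class V n q"
  using coset_eq_iff[OF free_vs_vectorspace span_in_subspace[OF free_vs_vectorspace tree_relations_carrier[OF V]], of p n q]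
    assms unfolding tree_class_def Let_def by simp

lemma free_operad_act:
  assumes "\<sigma> permutes {1..n}" "keys p \<subseteq> trees V n"
  shows "sym_act (free_operad V) n \<sigma> (tree_class V n p) = tree_class V n (push (relabel (inv_into UNIV \<sigma>)) p)"
  using quot_operad_act[OF tree_operad_operad tree_kernel_ideal[OF V] assms(1), of p] assms(2)
  unfolding free_operad_eq_quot tree_class_eq_coset by simp

lemma free_operad_linear_eq:
  assumes N: "vectorspace class_ring N"
    and h: "h \<in> linear_maps (arity_space (free_operad V) n) N" and h': "h' \<in> linear_maps (arity_space (free_operad V) n) N"
    and eq: "\<And>t. t \<in> trees V n \<Longrightarrow> h (tree_class V n (single t 1)) = h' (tree_class V n (single t 1))"
    and x: "x \<in> ops (free_operad V) n"
  shows "h x = h' x"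
proof -
  obtain p where p: "x = tree_class V n p" "keys p \<subseteq> trees V n" using x unfolding free_operad_ops by blast
  show ?thesis unfolding p(1)
    by (rule free_vs_linear_eq[OF N linear_maps_compose[OF tree_class_linear h] linear_maps_compose[OF tree_class_linear h'] eq p(2)])
qed

end

subsection \<open>Functoriality of the free operad\<close>

definition free_hom ::
    "('k::field, 'w) s2_module \<Rightarrow> ('v \<Rightarrow> 'w) \<Rightarrow> nat \<Rightarrow> ('v ptree \<Rightarrow>\<^sub>0 'k) set \<Rightarrow> ('w ptree \<Rightarrow>\<^sub>0 'k) set" where
  "free_hom W f = quot_hom (tree_operad W) (tree_kernel W) (\<lambda>n. push (map_ptree f))"

lemma map_ptree_relabel: "map_ptree f (relabel g t) = relabel g (map_ptree f t)"
  by (induction t) auto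

lemma map_ptree_graft: "map_ptree f (graft i n t s) = graft i n (map_ptree f t) (map_ptree f s)"
  by (induction t) (auto simp: map_ptree_relabel)

context
  fixes V :: "('k::field, 'v) s2_module" and W :: "('k, 'w) s2_module" and f :: "'v \<Rightarrow> 'w"
  assumes V: "s2_module V" and W: "s2_module W" and f: "f \<in> s2_hom V W"
begin

lemma map_ptree_trees: "t \<in> trees V n \<Longrightarrow> map_ptree f t \<in> trees W n"
  using f linear_mapsD(1)[of f V W] by (auto simp: trees_def ptree.set_map s2_hom_def)

lemma tree_operad_map: "(\<lambda>n. push (map_ptree f)) \<in> operad_hom (tree_operad V) (tree_operad W)"
  unfolding operad_hom_def tree_operad_simps
proof (intro CollectI conjI allI impI; (elim conjE)?)
  show "push (map_ptree f) \<in> linear_maps (free_vs (trees V n)) (free_vs (trees W n))" for n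
    by (rule push_linear[OF map_ptree_trees])
  show "push (map_ptree f) (push2 (graft i n) x y) = push2 (graft i n) (push (map_ptree f) x) (push (map_ptree f) y)"
    for i n x y
    by (rule push_push2_eq[OF subset_UNIV subset_UNIV]) (rule map_ptree_graft)
qed (simp_all add: push_push map_ptree_relabel)

lemma tree_operad_map_kernel: "p \<in> tree_kernel V n \<Longrightarrow> push (map_ptree f) p \<in> tree_kernel W n"
  by (rule tree_kernel_push_map[OF V W f _ tree_context.hole map_ptree_trees]) simp

lemma free_hom_operad_hom: "free_hom W f \<in> operad_hom (free_operad V) (free_operad W)"
  unfolding free_hom_def free_operad_eq_quot
  by (rule quot_hom_operad_hom[OF tree_operad_operad tree_kernel_ideal[OF V] tree_operad_operad tree_kernel_ideal[OF W]
      tree_operad_map tree_operad_map_kernel])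

lemma free_hom_class:
  "keys p \<subseteq> trees V n \<Longrightarrow> free_hom W f n (tree_class V n p) = tree_class W n (push (map_ptree f) p)"
  using quot_hom_eq[OF tree_operad_operad tree_kernel_ideal[OF V] tree_operad_operad tree_kernel_ideal[OF W]
      tree_operad_map tree_operad_map_kernel, of p n]
  unfolding free_hom_def tree_class_eq_coset by simp

end

lemma free_hom_inverse:
  assumes V: "s2_module V" and W: "s2_module W" and f: "f \<in> s2_hom V W" and g: "g \<in> s2_hom W V"
    and gf: "\<And>v. v \<in> carrier V \<Longrightarrow> g (f v) = v" and x: "x \<in> ops (free_operad V) n"
  shows "free_hom V g n (free_hom W f n x) = x"
proof -
  obtain p where p: "x = tree_class V n p" "keys p \<subseteq> trees V n" using x unfolding free_operad_ops[OF V] by blast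
  have "keys (push (map_ptree f) p) \<subseteq> trees W n"
    using linear_mapsD(1)[OF push_linear[of "trees V n" "map_ptree f" "trees W n", OF map_ptree_trees[OF V W f]], of p]
      p(2) by simp
  moreover have "map_ptree g (map_ptree f t) = t" if "t \<in> trees V n" for t
    using treesD(1)[OF that] gf by (auto simp: ptree.map_comp intro!: ptree.map_ident_strong)
  ultimately show ?thesis
    using p by (simp add: free_hom_class[OF V W f] free_hom_class[OF W V g] push_push push_ident)
qed

section \<open>Tensor products of modules over the symmetric group\<close>

lemma with_swap_simps [simp]:
  "carrier (with_swap M s) = carrier M" "zero (with_swap M s) = zero M" "add (with_swap M s) = add M"
  "module.smult (with_swap M s) = module.smult M" "swap (with_swap M s) = s"
  by (simp_all add: with_swap_def)

lemma linear_maps_with_swap [simp]: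
  "linear_maps (with_swap M s) N = linear_maps M N" "linear_maps N (with_swap M s) = linear_maps N M"
  by (simp_all add: LinearCombinations.module_hom_def)

lemma s2_moduleI:
  assumes "vectorspace class_ring V" "swap V \<in> linear_maps V V" "\<And>x. x \<in> carrier V \<Longrightarrow> swap V (swap V x) = x"
  shows "s2_module V"
  using assms by (simp add: s2_module_def s2_module_axioms_def)

lemma s2_module_with_swap:
  assumes "vectorspace class_ring M" "s \<in> linear_maps M M" "\<And>x. x \<in> carrier M \<Longrightarrow> s (s x) = x"
  shows "s2_module (with_swap M s)"
  using assms by (intro s2_moduleI) (auto intro: vectorspace_transfer[OF assms(1)])

lemma tensor_s2_simps [simp]:
  "carrier (tensor_s2 V W) = carrier (tensor_vs V W)" "zero (tensor_s2 V W) = zero (tensor_vs V W)"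
  "add (tensor_s2 V W) = add (tensor_vs V W)" "module.smult (tensor_s2 V W) = module.smult (tensor_vs V W)"
  "linear_maps (tensor_s2 V W) N = linear_maps (tensor_vs V W) N"
  "linear_maps N (tensor_s2 V W) = linear_maps N (tensor_vs V W)"
  by (simp_all add: tensor_s2_def)

lemma bilinear_onD:
  assumes "bilinear_on V W K \<beta>"
  shows "w \<in> carrier W \<Longrightarrow> (\<lambda>v. \<beta> v w) \<in> linear_maps V K" "v \<in> carrier V \<Longrightarrow> \<beta> v \<in> linear_maps W K"
    "v \<in> carrier V \<Longrightarrow> w \<in> carrier W \<Longrightarrow> \<beta> v w \<in> carrier K"
  using assms linear_mapsD(1)[of "\<beta> v" W K] by (auto simp: bilinear_on_def)

lemma tensor_s2_module:
  fixes V :: "('k::field, 'v) s2_module" and W :: "('k, 'w) s2_module"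
  assumes V: "s2_module V" and W: "s2_module W"
  shows "s2_module (tensor_s2 V W)"
    and swap_pure_tensor: "\<And>v w. v \<in> carrier V \<Longrightarrow> w \<in> carrier W \<Longrightarrow>
      swap (tensor_s2 V W) (pure_tensor V W v w) = pure_tensor V W (swap V v) (swap W w)"
proof -
  let ?F = "free_vs (carrier V \<times> carrier W) :: ('k, _) module"
  let ?N = "span_in ?F (bilinearity_relations V W)"
  let ?h = "push (map_prod (swap V) (swap W)) :: _ \<Rightarrow> (_ \<Rightarrow>\<^sub>0 'k)"
  note V = s2_moduleD[OF V] and W = s2_moduleD[OF W]
  note rel = bilinearity_relations_carrier[OF V(1) W(1)]
  note N = free_vs_vectorspace span_in_subspace[OF free_vs_vectorspace rel]
  note linV = linear_mapsD[OF V(2)] and linW = linear_mapsD[OF W(2)]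
  have h: "?h \<in> linear_maps ?F ?F"
    using V(3) W(3) by (intro push_linear) auto
  have hN: "?h p \<in> ?N" if "p \<in> ?N" for p
  proof (rule linear_span_in[OF N(1) N(1) h rel N(2) _ that])
    fix x assume "x \<in> bilinearity_relations V W"
    then consider
      (1) a b w where "x = single (a \<oplus>\<^bsub>V\<^esub> b, w) 1 - single (a, w) 1 - single (b, w) 1"
        "a \<in> carrier V" "b \<in> carrier V" "w \<in> carrier W"
    | (2) v a b where "x = single (v, a \<oplus>\<^bsub>W\<^esub> b) 1 - single (v, a) 1 - single (v, b) 1"
        "a \<in> carrier W" "b \<in> carrier W" "v \<in> carrier V"
    | (3) c v w where "x = single (c \<odot>\<^bsub>V\<^esub> v, w) 1 - single (v, w) c"
        "v \<in> carrier V" "w \<in> carrier W"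
    | (4) c v w where "x = single (v, c \<odot>\<^bsub>W\<^esub> w) 1 - single (v, w) c"
        "w \<in> carrier W" "v \<in> carrier V"
      unfolding bilinearity_relations_def by blast
    \<comment> \<open>Linearity of the two swaps turns each relation into one of the same
      kind.\<close>
    then have "?h x \<in> bilinearity_relations V W"
    proof cases
      case 1
      show ?thesis
        using V(3)[OF 1(2)] V(3)[OF 1(3)] W(3)[OF 1(4)]
        unfolding 1(1) push_diff push_single map_prod_simp linV(2)[OF 1(2,3)] bilinearity_relations_def by blast
    next
      case 2
      show ?thesis
        using W(3)[OF 2(2)] W(3)[OF 2(3)] V(3)[OF 2(4)]
        unfolding 2(1) push_diff push_single map_prod_simp linW(2)[OF 2(2,3)] bilinearity_relations_def by blast
    next
      case 3
      show ?thesis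
        using V(3)[OF 3(2)] W(3)[OF 3(3)]
        unfolding 3(1) push_diff push_single map_prod_simp linV(3)[OF 3(2)] bilinearity_relations_def by blast
    next
      case 4
      show ?thesis
        using W(3)[OF 4(2)] V(3)[OF 4(3)]
        unfolding 4(1) push_diff push_single map_prod_simp linW(3)[OF 4(2)] bilinearity_relations_def by blast
    qed
    then show "?h x \<in> ?N" by (rule span_in_superset[OF N(1) rel])
  qed
  let ?s = "swap (tensor_s2 V W)"
  have s: "?s = (\<lambda>A. \<Union>p\<in>A. ?N +>\<^bsub>?F\<^esub> ?h p)"
    by (simp add: tensor_s2_def tensor_class_def Let_def)
  have lin: "?s \<in> linear_maps (tensor_vs V W) (tensor_vs V W)"
    unfolding s tensor_vs_def Let_def by (rule coset_map_linear_maps[OF N N h hN])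
  show swap: "?s (pure_tensor V W v w) = pure_tensor V W (swap V v) (swap W w)"
    if "v \<in> carrier V" "w \<in> carrier W" for v w
    unfolding s pure_tensor_def tensor_class_def Let_def
    using that coset_map_eq[OF N N h hN, of "single (v, w) 1"] by simp
  note vs = tensor_vs_vectorspace[OF V(1) W(1)]
  show "s2_module (tensor_s2 V W)"
  proof (rule s2_moduleI)
    show "vectorspace class_ring (tensor_s2 V W)"
      by (rule vectorspace_transfer[OF vs]) simp_all
    show "?s \<in> linear_maps (tensor_s2 V W) (tensor_s2 V W)" using lin by simp
    fix x assume "x \<in> carrier (tensor_s2 V W)"
    then have x: "x \<in> carrier (tensor_vs V W)" by simp
    show "?s (?s x) = x"
      by (rule tensor_linear_eq[OF V(1) W(1) vs linear_maps_compose[OF lin lin] linear_maps_id _ x])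
        (simp add: swap V W)
  qed
qed

section \<open>The sign module, the tri labels and the PostLie generators\<close>

lemma sgn_s2_simps [simp]:
  "carrier sgn_s2 = UNIV" "zero sgn_s2 = 0" "add sgn_s2 = (+)" "module.smult sgn_s2 = (*)" "swap sgn_s2 = uminus"
  by (simp_all add: sgn_s2_def)

lemma sgn_s2_module: "s2_module (sgn_s2 :: ('k::field, 'k) s2_module)"
proof (rule s2_moduleI)
  show "vectorspace class_ring (sgn_s2 :: ('k, 'k) s2_module)"
  proof (rule vectorspaceI, goal_cases)
    case (6 x)
    then show ?case by (intro bexI[of _ "- x"]) simp_all
  qed (simp_all add: algebra_simps)
qed (auto intro!: linear_mapsI)

lemma tri_flip_flip [simp]: "tri_flip (tri_flip s) = s"
  by (cases s) auto

lemma lookup_push_tri_flip: "lookup (push tri_flip p) s = lookup p (tri_flip s)"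
  using subset_UNIV[of "keys p"]
proof (induction p rule: poly_mapping_keys_induct)
  case (single x c)
  have "tri_flip x = s \<longleftrightarrow> x = tri_flip s" by auto
  then show ?case by (simp add: lookup_single when_def)
qed (simp_all add: push_add lookup_add)

lemma tri_s2_simps [simp]:
  "carrier tri_s2 = UNIV" "zero tri_s2 = 0" "add tri_s2 = (+)"
  "module.smult tri_s2 = (\<lambda>c. Poly_Mapping.map ((*) c))" "swap tri_s2 = push tri_flip"
  by (simp_all add: tri_s2_def)

lemma tri_s2_module: "s2_module tri_s2"
  unfolding tri_s2_def
proof (rule s2_module_with_swap[OF free_vs_vectorspace])
  show "push tri_flip \<in> linear_maps (free_vs UNIV) (free_vs UNIV)" by (rule push_linear) simp
  show "push tri_flip (push tri_flip p) = p" for p by (rule poly_mapping_eqI) (simp add: lookup_push_tri_flip)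
qed

definition postlie_swap :: "(postlie_op \<Rightarrow>\<^sub>0 'k::field) \<Rightarrow> (postlie_op \<Rightarrow>\<^sub>0 'k)" where
  "postlie_swap p = single Circ (lookup p Circ_Op)
        + single Circ_Op (lookup p Circ)
        - single Bracket (lookup p Bracket)"

lemma postlie_eqI:
  assumes "lookup p Circ = lookup q Circ" "lookup p Circ_Op = lookup q Circ_Op"
    "lookup p Bracket = lookup q Bracket"
  shows "p = q"
proof (rule poly_mapping_eqI)
  show "lookup p s = lookup q s" for s using assms by (cases s) auto
qed

lemma tri_eqI:
  assumes "lookup p Prec = lookup q Prec" "lookup p Succ = lookup q Succ"
    "lookup p Dot = lookup q Dot"
  shows "p = q"
proof (rule poly_mapping_eqI)
  show "lookup p s = lookup q s" for s using assms by (cases s) auto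
qed

lemma lookup_postlie_swap [simp]:
  "lookup (postlie_swap p) Circ = lookup p Circ_Op"
  "lookup (postlie_swap p) Circ_Op = lookup p Circ"
  "lookup (postlie_swap p) Bracket = - lookup p Bracket"
  by (simp_all add: postlie_swap_def lookup_add lookup_minus lookup_single)

lemma postlie_s2_simps [simp]:
  "carrier postlie_s2 = UNIV" "zero postlie_s2 = 0" "add postlie_s2 = (+)"
  "module.smult postlie_s2 = (\<lambda>c. Poly_Mapping.map ((*) c))" "swap postlie_s2 = postlie_swap"
  by (simp_all add: postlie_s2_def postlie_swap_def fun_eq_iff)

lemma postlie_s2_module: "s2_module postlie_s2"
proof (rule s2_moduleI)
  show "vectorspace class_ring postlie_s2"
    by (rule vectorspace_transfer[OF free_vs_vectorspace[of UNIV]]) simp_all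
  show "swap postlie_s2 \<in> linear_maps postlie_s2 postlie_s2"
    by (intro linear_mapsI) (auto intro!: postlie_eqI simp: lookup_add)
qed (auto intro!: postlie_eqI)

subsection \<open>Generators of the black product\<close>

context
  fixes V :: "('k::field, 'v) s2_module" and W :: "('k, 'w) s2_module"
  assumes V: "s2_module V" and W: "s2_module W"
begin

private lemmas black_vsV = s2_moduleD(1)[OF V]
private lemmas black_vsW = s2_moduleD(1)[OF W]
private lemmas black_T = tensor_s2_module(1)[OF V W]
private lemmas black_vsT = s2_moduleD(1)[OF black_T]
private lemmas black_vsS = s2_moduleD(1)[OF sgn_s2_module]

lemma black_s2_module: "s2_module (black_s2 V W)"
  unfolding black_s2_def by (rule tensor_s2_module(1)[OF black_T sgn_s2_module])

lemma black_pure_linear: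
  "(\<lambda>x. pure_tensor (tensor_s2 V W) sgn_s2 x 1) \<in> linear_maps (tensor_vs V W) (black_s2 V W)"
  using bilinear_onD(1)[OF pure_tensor_bilinear[OF black_vsT black_vsS], of 1]
  by (simp add: black_s2_def)

lemma black_tensor_bilinear: "bilinear_on V W (black_s2 V W) (black_tensor V W)"
  unfolding bilinear_on_def black_tensor_def
  using linear_maps_compose[OF bilinear_onD(1)[OF pure_tensor_bilinear[OF black_vsV black_vsW]] black_pure_linear]
    linear_maps_compose[OF bilinear_onD(2)[OF pure_tensor_bilinear[OF black_vsV black_vsW]] black_pure_linear]
  by blast

lemma pure_tensor_sgn:
  assumes "x \<in> carrier (tensor_vs V W)"
  shows "pure_tensor (tensor_s2 V W) sgn_s2 x c = c \<odot>\<^bsub>black_s2 V W\<^esub> pure_tensor (tensor_s2 V W) sgn_s2 x 1"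
  using linear_mapsD(3)[OF bilinear_onD(2)[OF pure_tensor_bilinear[OF black_vsT black_vsS]], of x 1 c] assms
  by (simp add: black_s2_def)

text \<open>The factor \<open>sgn\<close> turns the last component \<open>1\<close> into
  \<open>-1\<close>, which bilinearity of the tensor product lets out as a scalar.\<close>

lemma swap_black_tensor:
  assumes "v \<in> carrier V" "w \<in> carrier W"
  shows "swap (black_s2 V W) (black_tensor V W v w) = (- 1) \<odot>\<^bsub>black_s2 V W\<^esub> black_tensor V W (swap V v) (swap W w)"
proof -
  have *: "pure_tensor V W v w \<in> carrier (tensor_vs V W)" "pure_tensor V W (swap V v) (swap W w) \<in> carrier (tensor_vs V W)"
    using assms s2_moduleD(3)[OF V] s2_moduleD(3)[OF W] by (auto intro!: bilinear_onD(3)[OF pure_tensor_bilinear[OF black_vsV black_vsW]])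
  have "swap (black_s2 V W) (black_tensor V W v w) = pure_tensor (tensor_s2 V W) sgn_s2 (pure_tensor V W (swap V v) (swap W w)) (- 1)"
    using swap_pure_tensor[OF black_T sgn_s2_module, of "pure_tensor V W v w" 1] * swap_pure_tensor[OF V W assms]
    by (simp add: black_s2_def black_tensor_def)
  then show ?thesis using pure_tensor_sgn[OF *(2), of "- 1"] by (simp add: black_tensor_def)
qed

text \<open>In the outer tensor product \<open>x \<otimes> c\<close> equals
  \<open>c (x \<otimes> 1)\<close>, so equality reduces to the inner tensor product and its pure
  tensors.\<close>

lemma black_linear_eq:
  assumes K: "vectorspace class_ring K" and h: "h \<in> linear_maps (black_s2 V W) K" and h': "h' \<in> linear_maps (black_s2 V W) K"
    and eq: "\<And>v w. v \<in> carrier V \<Longrightarrow> w \<in> carrier W \<Longrightarrow> h (black_tensor V W v w) = h' (black_tensor V W v w)"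
    and x: "x \<in> carrier (black_s2 V W)"
  shows "h x = h' x"
proof (rule tensor_linear_eq[OF black_vsT black_vsS K])
  show "h \<in> linear_maps (tensor_vs (tensor_s2 V W) sgn_s2) K" "h' \<in> linear_maps (tensor_vs (tensor_s2 V W) sgn_s2) K"
    "x \<in> carrier (tensor_vs (tensor_s2 V W) sgn_s2)"
    using h h' x by (simp_all add: black_s2_def)
  fix y c assume "y \<in> carrier (tensor_s2 V W)"
  then have y: "y \<in> carrier (tensor_vs V W)" by simp
  have "h (pure_tensor (tensor_s2 V W) sgn_s2 y 1) = h' (pure_tensor (tensor_s2 V W) sgn_s2 y 1)"
    by (rule tensor_linear_eq[OF black_vsV black_vsW K linear_maps_compose[OF black_pure_linear h] linear_maps_compose[OF black_pure_linear h'] _ y])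
      (use eq in \<open>simp add: black_tensor_def\<close>)
  then show "h (pure_tensor (tensor_s2 V W) sgn_s2 y c) = h' (pure_tensor (tensor_s2 V W) sgn_s2 y c)"
    using linear_mapsD(1)[OF black_pure_linear y]
    by (simp add: pure_tensor_sgn[OF y, of c] linear_mapsD(3)[OF h] linear_mapsD(3)[OF h'])
qed

lemma black_ex:
  assumes K: "vectorspace class_ring K" and \<beta>: "bilinear_on V W K \<beta>"
  shows "\<exists>h\<in>linear_maps (black_s2 V W) K. \<forall>v\<in>carrier V. \<forall>w\<in>carrier W. h (black_tensor V W v w) = \<beta> v w"
proof -
  interpret K: vectorspace class_ring K by fact
  obtain g where g: "g \<in> linear_maps (tensor_vs V W) K"
      "\<And>v w. v \<in> carrier V \<Longrightarrow> w \<in> carrier W \<Longrightarrow> g (pure_tensor V W v w) = \<beta> v w"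
    using tensor_ex[OF black_vsV black_vsW K \<beta>] by blast
  note lg = linear_mapsD[OF g(1)]
  have "bilinear_on (tensor_s2 V W) sgn_s2 K (\<lambda>x c. c \<odot>\<^bsub>K\<^esub> g x)"
    unfolding bilinear_on_def tensor_s2_simps
    using linear_maps_smult[OF K g(1)]
    by (auto intro!: linear_mapsI simp: lg vectorspace_smult[OF K])
  then obtain h where h: "h \<in> linear_maps (tensor_vs (tensor_s2 V W) sgn_s2) K"
      "\<And>x c. x \<in> carrier (tensor_vs V W) \<Longrightarrow> h (pure_tensor (tensor_s2 V W) sgn_s2 x c) = c \<odot>\<^bsub>K\<^esub> g x"
    using tensor_ex[OF black_vsT black_vsS K] by fastforce
  have "h (black_tensor V W v w) = \<beta> v w" if "v \<in> carrier V" "w \<in> carrier W" for v w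
  proof -
    have "\<beta> v w \<in> carrier K" using bilinear_onD(3)[OF \<beta> that] .
    then show ?thesis
      using that by (simp add: black_tensor_def g(2) h(2) vectorspace_smult[OF K]
          bilinear_onD(3)[OF pure_tensor_bilinear[OF black_vsV black_vsW]])
  qed
  then show ?thesis using h(1) by (intro bexI[of _ h]) (auto simp: black_s2_def)
qed

end

section \<open>Trisuccessor labels as PostLie labels\<close>

definition tri_to_postlie :: "(tri \<Rightarrow>\<^sub>0 'k::field) \<Rightarrow> (postlie_op \<Rightarrow>\<^sub>0 'k)" where
  "tri_to_postlie p = single Circ (lookup p Prec)
     - single Circ_Op (lookup p Succ) + single Bracket (lookup p Dot)"

definition postlie_to_tri :: "(postlie_op \<Rightarrow>\<^sub>0 'k::field) \<Rightarrow> (tri \<Rightarrow>\<^sub>0 'k)" where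
  "postlie_to_tri p = single Prec (lookup p Circ)
     - single Succ (lookup p Circ_Op) + single Dot (lookup p Bracket)"

lemma lookup_tri_to_postlie [simp]:
  "lookup (tri_to_postlie p) Circ = lookup p Prec"
  "lookup (tri_to_postlie p) Circ_Op = - lookup p Succ"
  "lookup (tri_to_postlie p) Bracket = lookup p Dot"
  by (simp_all add: tri_to_postlie_def lookup_add lookup_minus lookup_single)

lemma lookup_postlie_to_tri [simp]:
  "lookup (postlie_to_tri p) Prec = lookup p Circ"
  "lookup (postlie_to_tri p) Succ = - lookup p Circ_Op"
  "lookup (postlie_to_tri p) Dot = lookup p Bracket"
  by (simp_all add: postlie_to_tri_def lookup_add lookup_minus lookup_single)

lemma tri_to_postlie_linear: "tri_to_postlie \<in> linear_maps tri_s2 postlie_s2"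
  by (intro linear_mapsI) (auto intro!: postlie_eqI simp: lookup_add)

lemma postlie_to_tri_linear: "postlie_to_tri \<in> linear_maps postlie_s2 tri_s2"
  by (intro linear_mapsI) (auto intro!: tri_eqI simp: lookup_add)

lemma tri_postlie_inverse: "postlie_to_tri (tri_to_postlie p) = p" "tri_to_postlie (postlie_to_tri q) = q"
  by (auto intro: tri_eqI postlie_eqI)

text \<open>The sign is absorbed by the factor \<open>sgn\<close> in the generators of the black product.\<close>

lemma postlie_swap_tri: "postlie_swap (tri_to_postlie p) = - tri_to_postlie (push tri_flip p)"
  by (auto intro!: postlie_eqI simp: lookup_push_tri_flip)

text \<open>The PostLie operation at a vertex with leaf sets \<open>L\<close> and \<open>R\<close> on its two sides.\<close>

definition path_label :: "nat set \<Rightarrow> nat set \<Rightarrow> nat set \<Rightarrow> (postlie_op \<Rightarrow>\<^sub>0 'k::field)" where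
  "path_label J L R =
     (if L \<inter> J \<noteq> {} \<and> R \<inter> J \<noteq> {} then single Bracket 1
      else if L \<inter> J \<noteq> {} then single Circ 1
      else if R \<inter> J \<noteq> {} then - single Circ_Op 1
      else single Circ 1 - single Circ_Op 1 + single Bracket 1)"

text \<open>Isolates the label that \<open>tsu_tree\<close> puts at a vertex as a function of the
  two leaf sets alone, with the case distinction of \<open>path_label\<close>, so that the
  isomorphism of generators can match the two case by case.\<close>

definition hat_label :: "('k::field, 'v) s2_module \<Rightarrow> nat set \<Rightarrow> nat set \<Rightarrow> nat set \<Rightarrow> 'v \<Rightarrow> ('v \<times> (tri \<Rightarrow>\<^sub>0 'k) \<Rightarrow>\<^sub>0 'k) set" where
  "hat_label V J L R v =
     (if L \<inter> J \<noteq> {} \<and> R \<inter> J \<noteq> {} then tri_label V Dot v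
      else if L \<inter> J \<noteq> {} then tri_label V Prec v
      else if R \<inter> J \<noteq> {} then tri_label V Succ v
      else star_label V v)"

text \<open>The sign on \<open>Circ_Op\<close> makes all four cases change sign together, including
  the sum for vertices off the paths. Every sign in the symmetry of the path relators stems from
  this.\<close>

lemma postlie_swap_path_label: "postlie_swap (path_label J L R) = - path_label J R L"
  by (auto intro!: postlie_eqI simp: path_label_def lookup_add lookup_minus lookup_single)

context
  fixes V :: "('k::field, 'v) s2_module"
  assumes V: "s2_module V"
begin

private lemmas vsV = s2_moduleD(1)[OF V]
private lemmas vsT = s2_moduleD(1)[OF tri_s2_module]

lemma hat_s2_module: "s2_module (hat V)"
  unfolding hat_def by (rule tensor_s2_module(1)[OF V tri_s2_module])

private lemmas vsH = s2_moduleD(1)[OF hat_s2_module]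
private lemmas B = black_s2_module[OF postlie_s2_module V]
private lemmas vsB = s2_moduleD(1)[OF B]
private lemmas pure = pure_tensor_bilinear[OF vsV vsT]
private lemmas black = black_tensor_bilinear[OF postlie_s2_module V]

lemma pure_tensor_tri:
  "v \<in> carrier V \<Longrightarrow> pure_tensor V tri_s2 v q \<in> carrier (hat V)"
  "(\<lambda>v. pure_tensor V tri_s2 v q) \<in> linear_maps V (hat V)"
  using bilinear_onD(1,3)[OF pure] by (simp_all add: hat_def)

lemma tri_label_linear: "tri_label V s \<in> linear_maps V (hat V)"
  unfolding tri_label_def using pure_tensor_tri(2) by (simp add: eta_contract_eq)

lemma star_label_linear: "star_label V \<in> linear_maps V (hat V)"
  using linear_maps_add[OF vsH linear_maps_add[OF vsH tri_label_linear tri_label_linear] tri_label_linear]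
  unfolding star_label_def by (simp add: star_label_def[abs_def])

lemma hat_label_linear: "hat_label V J L R \<in> linear_maps V (hat V)"
proof -
  have "hat_label V J L R \<in> {tri_label V Dot, tri_label V Prec, tri_label V Succ, star_label V}"
    by (cases "L \<inter> J = {}"; cases "R \<inter> J = {}") (simp_all add: hat_label_def[abs_def])
  then show ?thesis using tri_label_linear star_label_linear by auto
qed

lemma swap_tri_label:
  assumes "v \<in> carrier V"
  shows "swap (hat V) (tri_label V s v) = tri_label V (tri_flip s) (swap V v)"
  using swap_pure_tensor[OF V tri_s2_module assms] by (simp add: tri_label_def hat_def)

lemma swap_hat_label:
  assumes v: "v \<in> carrier V"
  shows "swap (hat V) (hat_label V J L R v) = hat_label V J R L (swap V v)"
proof -
  interpret H: vectorspace class_ring "hat V" by (rule vsH)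
  have t: "tri_label V s x \<in> carrier (hat V)" if "x \<in> carrier V" for s x
    using linear_mapsD(1)[OF tri_label_linear that] .
  have "swap (hat V) (star_label V v) = star_label V (swap V v)"
    unfolding star_label_def
    using t[OF v] t[OF s2_moduleD(3)[OF V v]] linear_mapsD(2)[OF s2_moduleD(2)[OF hat_s2_module]]
    by (simp add: swap_tri_label[OF v] H.a_ac)
  then show ?thesis by (auto simp: hat_label_def swap_tri_label[OF v])
qed

text \<open>Both maps arise from universal properties of tensor products. Equivariance of
  \<open>f\<close> is a cancellation of two signs, one from \<open>sgn\<close> and one from the
  exchange of PostLie labels; equivariance of \<open>g\<close> then follows formally because
  \<open>g\<close> is inverse to \<open>f\<close>.\<close>

lemma hat_black_iso_ex:
  "\<exists>f g. f \<in> s2_hom (hat V) (black_s2 postlie_s2 V) \<and> g \<in> s2_hom (black_s2 postlie_s2 V) (hat V) \<and>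
     (\<forall>x\<in>carrier (hat V). g (f x) = x) \<and> (\<forall>y\<in>carrier (black_s2 postlie_s2 V). f (g y) = y) \<and>
     (\<forall>J L R. \<forall>v\<in>carrier V. f (hat_label V J L R v) = black_tensor postlie_s2 V (path_label J L R) v)"
proof -
  let ?B = "black_s2 postlie_s2 V" and ?b = "black_tensor postlie_s2 V"
  interpret B: vectorspace class_ring ?B by (rule vsB)
  interpret H: vectorspace class_ring "hat V" by (rule vsH)
  note sw = s2_moduleD[OF V] and swB = s2_moduleD[OF B] and swH = s2_moduleD[OF hat_s2_module]
  have b: "?b q v \<in> carrier ?B" if "v \<in> carrier V" for q v
    using bilinear_onD(3)[OF black] that by simp
  have "bilinear_on V tri_s2 ?B (\<lambda>v q. ?b (tri_to_postlie q) v)"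
    unfolding bilinear_on_def
    using bilinear_onD(2)[OF black] linear_maps_compose[OF tri_to_postlie_linear bilinear_onD(1)[OF black]] by auto
  then obtain f where f: "f \<in> linear_maps (hat V) ?B"
      "\<And>v q. v \<in> carrier V \<Longrightarrow> f (pure_tensor V tri_s2 v q) = ?b (tri_to_postlie q) v"
    using tensor_ex[OF vsV vsT vsB] by (fastforce simp: hat_def)
  have "bilinear_on postlie_s2 V (hat V) (\<lambda>q v. pure_tensor V tri_s2 v (postlie_to_tri q))"
    unfolding bilinear_on_def
    using pure_tensor_tri(2) linear_maps_compose[OF postlie_to_tri_linear bilinear_onD(2)[OF pure]] by (auto simp: hat_def)
  then obtain g where g: "g \<in> linear_maps ?B (hat V)"
      "\<And>v q. v \<in> carrier V \<Longrightarrow> g (?b q v) = pure_tensor V tri_s2 v (postlie_to_tri q)"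
    using black_ex[OF postlie_s2_module V vsH] by fastforce
  have hat_eq: "h x = h' x" if "vectorspace class_ring K" "h \<in> linear_maps (hat V) K" "h' \<in> linear_maps (hat V) K"
    "\<And>v q. v \<in> carrier V \<Longrightarrow> h (pure_tensor V tri_s2 v q) = h' (pure_tensor V tri_s2 v q)" "x \<in> carrier (hat V)"
    for h h' x and K :: "('k, 'z, 'y) module_scheme"
    using tensor_linear_eq[OF vsV vsT that(1), of h h' x] that by (simp add: hat_def)
  note black_eq = black_linear_eq[OF postlie_s2_module V]
  have gf: "g (f x) = x" if "x \<in> carrier (hat V)" for x
    by (rule hat_eq[OF vsH linear_maps_compose[OF f(1) g(1)] linear_maps_id _ that]) (simp add: f g tri_postlie_inverse)
  have fg: "f (g y) = y" if "y \<in> carrier ?B" for y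
    by (rule black_eq[OF vsB linear_maps_compose[OF g(1) f(1)] linear_maps_id _ that]) (simp add: f g tri_postlie_inverse)
  have f_swap: "f (swap (hat V) x) = swap ?B (f x)" if "x \<in> carrier (hat V)" for x
  proof (rule hat_eq[OF vsB linear_maps_compose[OF swH(2) f(1)] linear_maps_compose[OF f(1) swB(2)] _ that])
    fix v q assume v: "v \<in> carrier V"
    have m: "- p = Poly_Mapping.map ((*) (- 1)) p" for p :: "postlie_op \<Rightarrow>\<^sub>0 'k" by (rule poly_mapping_eqI) simp
    have "swap ?B (f (pure_tensor V tri_s2 v q)) = (- 1) \<odot>\<^bsub>?B\<^esub> ?b (postlie_swap (tri_to_postlie q)) (swap V v)"
      using swap_black_tensor[OF postlie_s2_module V, of "tri_to_postlie q" v] v by (simp add: f(2))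
    also have "?b (postlie_swap (tri_to_postlie q)) (swap V v) = (- 1) \<odot>\<^bsub>?B\<^esub> ?b (tri_to_postlie (push tri_flip q)) (swap V v)"
      unfolding postlie_swap_tri m using linear_mapsD(3)[OF bilinear_onD(1)[OF black sw(3)[OF v]]] by simp
    also have "(- 1) \<odot>\<^bsub>?B\<^esub> \<dots> = ?b (tri_to_postlie (push tri_flip q)) (swap V v)"
      using b[OF sw(3)[OF v]] by (simp add: vectorspace_smult[OF vsB] flip: vectorspace_smult(4)[OF vsB])
    also have "\<dots> = f (swap (hat V) (pure_tensor V tri_s2 v q))"
      using swap_pure_tensor[OF V tri_s2_module v, of q] f(2) sw(3)[OF v] by (simp add: hat_def)
    finally show "f (swap (hat V) (pure_tensor V tri_s2 v q)) = swap ?B (f (pure_tensor V tri_s2 v q))" ..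
  qed
  have g_swap: "g (swap ?B y) = swap (hat V) (g y)" if "y \<in> carrier ?B" for y
  proof -
    have gy: "g y \<in> carrier (hat V)" using linear_mapsD(1)[OF g(1) that] .
    have "g (swap ?B y) = g (swap ?B (f (g y)))" by (simp add: fg that)
    also have "\<dots> = swap (hat V) (g y)" by (simp flip: f_swap[OF gy] add: gf swH(3)[OF gy])
    finally show ?thesis .
  qed
  have label: "f (hat_label V J L R v) = ?b (path_label J L R) v" if v: "v \<in> carrier V" for J L R v
  proof -
    have t: "f (tri_label V Prec v) = ?b (single Circ 1) v"
      "f (tri_label V Succ v) = ?b (- single Circ_Op 1) v"
      "f (tri_label V Dot v) = ?b (single Bracket 1) v"
      unfolding tri_label_def f(2)[OF v] by (simp_all add: tri_to_postlie_def lookup_single)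
    have "f (star_label V v) = ?b (single Circ 1) v \<oplus>\<^bsub>?B\<^esub> ?b (- single Circ_Op 1) v
        \<oplus>\<^bsub>?B\<^esub> ?b (single Bracket 1) v"
      unfolding star_label_def
      using linear_mapsD(1)[OF tri_label_linear v] linear_mapsD(2)[OF f(1)] by (simp add: t)
    also have "\<dots> = ?b (single Circ 1 + - single Circ_Op 1 + single Bracket 1) v"
      by (simp only: linear_mapsD(2)[OF bilinear_onD(1)[OF black v], simplified])
    finally have "f (star_label V v) = \<dots>" .
    then show ?thesis by (simp add: hat_label_def path_label_def t)
  qed
  show ?thesis
    by (rule exI[of _ f], rule exI[of _ g]) (use f(1) g(1) f_swap g_swap gf fg label in \<open>auto simp: s2_hom_def\<close>)
qed

section \<open>The trisuccessor map on trees and on the free operad\<close>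

lemma tsu_tree_Node:
  "tsu_tree V J (Node v l r) = Node (hat_label V J (set (leaves l)) (set (leaves r)) v) (tsu_tree V J l) (tsu_tree V J r)"
  by (simp add: hat_label_def)

lemma leaves_tsu_tree: "leaves (tsu_tree V J t) = leaves t"
  by (induction t) auto

lemma tsu_tree_trees: "t \<in> trees V n \<Longrightarrow> tsu_tree V J t \<in> trees (hat V) n"
proof -
  have "labels t \<subseteq> carrier V \<Longrightarrow> labels (tsu_tree V J t) \<subseteq> carrier (hat V)"
  proof (induction t)
    case (Node v l r)
    then show ?case
      using linear_mapsD(1)[OF hat_label_linear, of v] by (simp add: tsu_tree_Node del: tsu_tree.simps)
  qed simp
  then show "t \<in> trees V n \<Longrightarrow> tsu_tree V J t \<in> trees (hat V) n"
    by (simp add: trees_def leaves_tsu_tree)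
qed

text \<open>Labels between the root and the hole depend on the leaves of the filling, so the new
  context serves only fillings with a prescribed leaf set \<open>L\<close>. This suffices, since
  changing a label or exchanging subtrees preserves the leaf set.\<close>

lemma tsu_tree_context:
  "tree_context C \<Longrightarrow> \<exists>C'. tree_context C' \<and> (\<forall>t. set (leaves t) = L \<longrightarrow> tsu_tree V J (C t) = C' (tsu_tree V J t))"
proof (induction rule: tree_context.induct)
  case hole
  then show ?case by (intro exI[of _ "\<lambda>t. t"]) (simp add: tree_context.hole)
next
  case (left C v r)
  then obtain C' where C': "tree_context C'" "\<And>t. set (leaves t) = L \<Longrightarrow> tsu_tree V J (C t) = C' (tsu_tree V J t)" by blast
  obtain xs ys where xs: "\<And>t. leaves (C t) = xs @ leaves t @ ys" using tree_context_leaves[OF left(1)] by blast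
  show ?case
    by (intro exI[of _ "\<lambda>t. Node (hat_label V J (set xs \<union> L \<union> set ys) (set (leaves r)) v) (C' t) (tsu_tree V J r)"])
      (simp add: tree_context.left C' tsu_tree_Node xs Un_assoc del: tsu_tree.simps)
next
  case (right C v l)
  then obtain C' where C': "tree_context C'" "\<And>t. set (leaves t) = L \<Longrightarrow> tsu_tree V J (C t) = C' (tsu_tree V J t)" by blast
  obtain xs ys where xs: "\<And>t. leaves (C t) = xs @ leaves t @ ys" using tree_context_leaves[OF right(1)] by blast
  show ?case
    by (intro exI[of _ "\<lambda>t. Node (hat_label V J (set (leaves l)) (set xs \<union> L \<union> set ys) v) (tsu_tree V J l) (C' t)"])
      (simp add: tree_context.right C' tsu_tree_Node xs Un_assoc del: tsu_tree.simps)
qed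

text \<open>Exchanging the subtrees of a vertex interchanges its two leaf sets, so
  \<open>hat_label\<close> with interchanged sets serves as the second label function, and
  \<open>swap_hat_label\<close> is the compatibility required of it.\<close>

lemma tsu_tree_kernel: "p \<in> tree_kernel V n \<Longrightarrow> push (tsu_tree V J) p \<in> tree_kernel (hat V) n"
proof (rule tree_relations_push[OF V hat_s2_module tsu_tree_trees])
  fix C a and l r :: "'v ptree" assume "tree_context (C :: 'v ptree \<Rightarrow> 'v ptree)"
  from tsu_tree_context[OF this, of "set (leaves l) \<union> set (leaves r)" J] obtain C' where
    C': "tree_context C'" "\<And>t. set (leaves t) = set (leaves l) \<union> set (leaves r) \<Longrightarrow> tsu_tree V J (C t) = C' (tsu_tree V J t)" by blast
  let ?g = "hat_label V J (set (leaves l)) (set (leaves r))" and ?g' = "hat_label V J (set (leaves r)) (set (leaves l))"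
  show "\<exists>C' g g' l' r'. tree_context C' \<and> g \<in> linear_maps V (hat V) \<and>
      (\<forall>a\<in>carrier V. tsu_tree V J (C (Node a l r)) = C' (Node (g a) l' r') \<and>
        tsu_tree V J (C (Node a r l)) = C' (Node (g' a) r' l') \<and> g' (swap V a) = swap (hat V) (g a))"
    by (rule exI[of _ C'], rule exI[of _ ?g], rule exI[of _ ?g'],
        rule exI[of _ "tsu_tree V J l"], rule exI[of _ "tsu_tree V J r"])
      (simp add: C' hat_label_linear tsu_tree_Node swap_hat_label Un_commute del: tsu_tree.simps)
qed

lemma
  shows tsu_map_linear: "tsu_map V n J \<in> linear_maps (arity_space (free_operad V) n) (arity_space (free_operad (hat V)) n)"
    and tsu_map_class: "keys p \<subseteq> trees V n \<Longrightarrow>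
      tsu_map V n J (tree_class V n p) = tree_class (hat V) n (push (tsu_tree V J) p)"
proof -
  note A = free_vs_vectorspace span_in_subspace[OF free_vs_vectorspace tree_relations_carrier[OF V], of n]
  note B = free_vs_vectorspace span_in_subspace[OF free_vs_vectorspace tree_relations_carrier[OF hat_s2_module], of n]
  have lin: "push (tsu_tree V J) \<in> linear_maps (free_vs (trees V n)) (free_vs (trees (hat V) n))"
    by (rule push_linear[OF tsu_tree_trees])
  note * = A B lin tsu_tree_kernel
  show "tsu_map V n J \<in> linear_maps (arity_space (free_operad V) n) (arity_space (free_operad (hat V)) n)"
    using coset_map_linear_maps[OF *] unfolding free_operad_arity tsu_map_def[abs_def] tree_class_def Let_def by simp
  show "keys p \<subseteq> trees V n \<Longrightarrow>
      tsu_map V n J (tree_class V n p) = tree_class (hat V) n (push (tsu_tree V J) p)"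
    using coset_map_eq[OF *, of p] unfolding tsu_map_def tree_class_def Let_def by simp
qed

end

section \<open>Operations of arity three\<close>

lemma atLeastAtMost_3: "{1..3} = {1, 2, 3 :: nat}"
  by auto

text \<open>The three cyclic orders come first; in the case distinctions below the last three are
  those that require an exchange or a sign.\<close>

definition arrangements3 :: "(nat \<times> nat \<times> nat) set" where
  "arrangements3 = {(1, 2, 3), (2, 3, 1), (3, 1, 2), (2, 1, 3), (3, 2, 1), (1, 3, 2)}"

lemma arrangements3I:
  assumes "distinct [a, b, c]" "{a, b, c} = {1..3}"
  shows "(a, b, c) \<in> arrangements3"
proof -
  have "a \<in> {1, 2, 3}" "b \<in> {1, 2, 3}" "c \<in> {1, 2, 3}" using assms(2) unfolding atLeastAtMost_3 by blast+
  then show ?thesis using assms(1) by (auto simp: arrangements3_def)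
qed

lemma arrangements3D:
  assumes "(a, b, c) \<in> arrangements3"
  shows "distinct [a, b, c]" "{a, b, c} = {1..3}"
  using assms unfolding atLeastAtMost_3 by (auto simp: arrangements3_def)

lemma arrangements3_cases [consumes 1]:
  assumes "(a, b, c) \<in> arrangements3"
  obtains "a = 1" "b = 2" "c = 3" | "a = 2" "b = 3" "c = 1" | "a = 3" "b = 1" "c = 2"
    | "a = 2" "b = 1" "c = 3" | "a = 3" "b = 2" "c = 1" | "a = 1" "b = 3" "c = 2"
  using assms unfolding arrangements3_def by blast

lemma trees3_iff:
  "Node v (Node w (Leaf a) (Leaf b)) (Leaf c) \<in> trees V 3 \<longleftrightarrow> v \<in> carrier V \<and> w \<in> carrier V \<and> (a, b, c) \<in> arrangements3"
  "Node v (Leaf c) (Node w (Leaf a) (Leaf b)) \<in> trees V 3 \<longleftrightarrow> v \<in> carrier V \<and> w \<in> carrier V \<and> (a, b, c) \<in> arrangements3"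
proof -
  have "(a, b, c) \<in> arrangements3 \<longleftrightarrow> distinct [a, b, c] \<and> {a, b, c} = {1..3}"
    using arrangements3I arrangements3D by blast
  then show "Node v (Node w (Leaf a) (Leaf b)) (Leaf c) \<in> trees V 3 \<longleftrightarrow> v \<in> carrier V \<and> w \<in> carrier V \<and> (a, b, c) \<in> arrangements3"
    "Node v (Leaf c) (Node w (Leaf a) (Leaf b)) \<in> trees V 3 \<longleftrightarrow> v \<in> carrier V \<and> w \<in> carrier V \<and> (a, b, c) \<in> arrangements3"
    by (auto simp: trees_def insert_commute)
qed

lemma length_leaves_pos: "1 \<le> length (leaves t)"
  by (cases "leaves t") (use leaves_nonempty[of t] in auto)

lemma length_leaves_1: "length (leaves t) = Suc 0 \<Longrightarrow> \<exists>j. t = Leaf j"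
proof (cases t)
  case (Node v l r)
  then show "length (leaves t) = Suc 0 \<Longrightarrow> ?thesis" using length_leaves_pos[of l] length_leaves_pos[of r] by simp
qed simp

lemma length_leaves_2: "length (leaves t) = 2 \<Longrightarrow> \<exists>w a b. t = Node w (Leaf a) (Leaf b)"
proof (cases t)
  case (Node v l r)
  moreover assume "length (leaves t) = 2"
  ultimately have "length (leaves l) = Suc 0" "length (leaves r) = Suc 0"
    using length_leaves_pos[of l] length_leaves_pos[of r] by auto
  then show ?thesis using Node length_leaves_1 by blast
qed simp

lemma trees3_cases:
  assumes "t \<in> trees V 3"
  obtains (left) v w a b c where "t = Node v (Node w (Leaf a) (Leaf b)) (Leaf c)"
      "v \<in> carrier V" "w \<in> carrier V" "(a, b, c) \<in> arrangements3"
    | (right) v w a b c where "t = Node v (Leaf c) (Node w (Leaf a) (Leaf b))"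
      "v \<in> carrier V" "w \<in> carrier V" "(a, b, c) \<in> arrangements3"
proof -
  have len: "length (leaves t) = 3"
    using treesD(2,3)[OF assms] distinct_card[of "leaves t"] by simp
  show thesis
  proof (cases t)
    case (Leaf j)
    then show ?thesis using len by simp
  next
    case (Node v l r)
    then have "length (leaves l) = 2 \<and> length (leaves r) = Suc 0 \<or> length (leaves l) = Suc 0 \<and> length (leaves r) = 2"
      using len length_leaves_pos[of l] length_leaves_pos[of r] by auto
    then show ?thesis
    proof
      assume "length (leaves l) = 2 \<and> length (leaves r) = Suc 0"
      then obtain w a b c where "l = Node w (Leaf a) (Leaf b)" "r = Leaf c"
        using length_leaves_1 length_leaves_2 by blast
      then show ?thesis using left[of v w a b c] assms Node by (simp add: trees3_iff)
    next
      assume "length (leaves l) = Suc 0 \<and> length (leaves r) = 2"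
      then obtain w a b c where "r = Node w (Leaf a) (Leaf b)" "l = Leaf c"
        using length_leaves_1 length_leaves_2 by blast
      then show ?thesis using right[of v c w a b] assms Node by (simp add: trees3_iff)
    qed
  qed
qed

lemma tree_context_length:
  assumes "tree_context C"
  shows "C = (\<lambda>t. t) \<or> (\<forall>t. length (leaves t) < length (leaves (C t)))"
  using assms
proof (induction rule: tree_context.induct)
  case (left C v r)
  have "length (leaves t) < length (leaves (C t)) + length (leaves r)" for t
    using left.IH length_leaves_pos[of r] by (auto intro: trans_less_add1)
  then show ?case by simp
next
  case (right C v l)
  have "length (leaves t) < length (leaves l) + length (leaves (C t))" for t
    using right.IH length_leaves_pos[of l] by (auto intro: trans_less_add2)
  then show ?case by simp
qed simp

text \<open>The filling has at least two leaves and a proper context strictly increases their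
  number, so with three leaves in all there is room for at most one vertex around the hole.\<close>

lemma tree_context3_cases:
  assumes C: "tree_context C" and t: "C (Node a l r) \<in> trees V 3"
  obtains (hole) "C = (\<lambda>t. t)"
    | (left) v p q c where "C = (\<lambda>t. Node v t (Leaf c))" "l = Leaf p" "r = Leaf q"
    | (right) v p q c where "C = (\<lambda>t. Node v (Leaf c) t)" "l = Leaf p" "r = Leaf q"
proof -
  have len2: "2 \<le> length (leaves (Node a l r))" using length_leaves_pos[of l] length_leaves_pos[of r] by simp
  have small: "D = (\<lambda>t. t) \<and> (\<exists>p q. l = Leaf p \<and> r = Leaf q)"
    if "tree_context D" "length (leaves (D (Node a l r))) = 2" for D
  proof -
    have D: "D = (\<lambda>t. t)"
    proof (rule ccontr)
      assume "D \<noteq> (\<lambda>t. t)"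
      then have "length (leaves (Node a l r)) < length (leaves (D (Node a l r)))"
        using tree_context_length[OF that(1)] by blast
      then show False using that(2) len2 by simp
    qed
    then show ?thesis using length_leaves_2[of "Node a l r"] that(2) by auto
  qed
  from C show thesis
  proof cases
    case hole
    then show ?thesis using that(1) by simp
  next
    case (left D v s)
    from t[unfolded left(1)] show ?thesis
    proof (cases rule: trees3_cases)
      case (left v' w a' b' c)
      then have "length (leaves (D (Node a l r))) = 2" by simp
      then show ?thesis using small[OF \<open>tree_context D\<close>] left(1) \<open>C = _\<close> that(2) by auto
    next
      \<comment> \<open>Impossible: the hole would lie in a subtree with a single leaf.\<close>
      case (right v' w a' b' c)
      then have "length (leaves (D (Node a l r))) = 1" by simp
      then show ?thesis using tree_context_length[OF \<open>tree_context D\<close>] len2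
        by (metis less_le_trans not_less numeral_One one_less_numeral_iff order.strict_implies_order semiring_norm(76))
    qed
  next
    case (right D v s)
    from t[unfolded right(1)] show ?thesis
    proof (cases rule: trees3_cases)
      case (left v' w a' b' c)
      then have "length (leaves (D (Node a l r))) = 1" by simp
      then show ?thesis using tree_context_length[OF \<open>tree_context D\<close>] len2
        by (metis less_le_trans not_less numeral_One one_less_numeral_iff order.strict_implies_order semiring_norm(76))
    next
      case (right v' w a' b' c)
      then have "length (leaves (D (Node a l r))) = 2" by simp
      then show ?thesis using small[OF \<open>tree_context D\<close>] right(1) \<open>C = _\<close> that(3) by auto
    qed
  qed
qed

text \<open>
  Every tree of arity three equals a unique \<open>comp3_tree u v w\<close> up to exchanging subtrees; \<open>nf3\<close> computes it.
\<close>

definition third_input :: "nat \<Rightarrow> tree_type" where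
  "third_input c = (if c = 3 then Type_I else if c = 1 then Type_II else Type_III)"

text \<open>The successor of \<open>a\<close> in the cyclic order of the three inputs is
  \<open>a mod 3 + 1\<close>. An inner pair not in cyclic order has to be exchanged, which applies
  \<open>swap\<close> to its label.\<close>

definition cyclic_label :: "('k::field, 'v) s2_module \<Rightarrow> nat \<Rightarrow> nat \<Rightarrow> 'v \<Rightarrow> 'v" where
  "cyclic_label V a b w = (if b = a mod 3 + 1 then w else swap V w)"

fun nf3 :: "('k::field, 'v) s2_module \<Rightarrow> 'v ptree \<Rightarrow> tree_type \<times> 'v \<times> 'v" where
  "nf3 V (Node v (Node w (Leaf a) (Leaf b)) (Leaf c)) = (third_input c, v, cyclic_label V a b w)"
| "nf3 V (Node v (Leaf c) (Node w (Leaf a) (Leaf b))) = (third_input c, swap V v, cyclic_label V a b w)"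

lemma nf3_comp3_tree: "nf3 V (comp3_tree u v w) = (u, v, w)"
  by (cases u) (simp_all add: third_input_def cyclic_label_def)

lemma comp3_tree_form: "\<exists>a b c. (a, b, c) \<in> arrangements3 \<and> (\<forall>v w. comp3_tree u v w = Node v (Node w (Leaf a) (Leaf b)) (Leaf c))"
  by (cases u) (auto simp: arrangements3_def)

lemma comp3_tree_trees: "v \<in> carrier V \<Longrightarrow> w \<in> carrier V \<Longrightarrow> comp3_tree u v w \<in> trees V 3"
  by (cases u) (simp_all add: trees3_iff arrangements3_def)

section \<open>The decomposition of arity three by tree type\<close>

context
  fixes V :: "('k::field, 'v) s2_module"
  assumes V: "s2_module V"
begin

private lemmas lin = linear_mapsD[OF tree_class_linear[OF V], unfolded free_vs_simps mem_Collect_eq]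
private lemmas rel = span_in_superset[OF free_vs_vectorspace tree_relations_carrier[OF V]]

lemma tree_class_add:
  assumes C: "tree_context C" and a: "C (Node a l r) \<in> trees V n" and b: "b \<in> carrier V"
  shows "tree_class V n (single (C (Node (a \<oplus>\<^bsub>V\<^esub> b) l r)) 1) =
    tree_class V n (single (C (Node a l r)) 1) \<oplus>\<^bsub>arity_space (free_operad V) n\<^esub>
    tree_class V n (single (C (Node b l r)) 1)"
proof -
  note ctx = tree_context_trees[OF C a]
  have ab: "C (Node (a \<oplus>\<^bsub>V\<^esub> b) l r) \<in> trees V n" using ctx(1,2) b s2_moduleD(5)[OF V] by blast
  have "single (C (Node (a \<oplus>\<^bsub>V\<^esub> b) l r)) 1 - (single (C (Node a l r)) 1 + single (C (Node b l r)) 1)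
      \<in> tree_kernel V n"
    by (rule rel) (use C a ctx(2)[OF b] in \<open>auto simp: tree_relations_def diff_diff_eq[symmetric]\<close>)
  then have "tree_class V n (single (C (Node (a \<oplus>\<^bsub>V\<^esub> b) l r)) 1) =
      tree_class V n (single (C (Node a l r)) 1 + single (C (Node b l r)) 1)"
    using ab a ctx(2)[OF b] by (intro tree_class_eqI[OF V]) (simp_all add: keys_add_subset keys_single_subset del: keys_single)
  then show ?thesis using a ctx(2)[OF b] by (simp add: lin(2) keys_single_subset del: keys_single)
qed

lemma tree_class_smult:
  assumes C: "tree_context C" and a: "C (Node a l r) \<in> trees V n"
  shows "tree_class V n (single (C (Node (c \<odot>\<^bsub>V\<^esub> a) l r)) 1) =
    c \<odot>\<^bsub>arity_space (free_operad V) n\<^esub> tree_class V n (single (C (Node a l r)) 1)"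
proof -
  note ctx = tree_context_trees[OF C a]
  have ca: "C (Node (c \<odot>\<^bsub>V\<^esub> a) l r) \<in> trees V n" using ctx(1,2) s2_moduleD(6)[OF V] by blast
  have "single (C (Node (c \<odot>\<^bsub>V\<^esub> a) l r)) 1 - single (C (Node a l r)) c \<in> tree_kernel V n"
    by (rule rel) (use C a in \<open>auto simp: tree_relations_def\<close>)
  then have "tree_class V n (single (C (Node (c \<odot>\<^bsub>V\<^esub> a) l r)) 1) = tree_class V n (single (C (Node a l r)) c)"
    using ca a by (intro tree_class_eqI[OF V]) (simp_all add: keys_single_subset del: keys_single)
  then show ?thesis using lin(3)[of "single (C (Node a l r)) 1" n c] a by simp
qed

lemma tree_class_swap:
  assumes C: "tree_context C" and a: "C (Node a l r) \<in> trees V n"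
  shows "tree_class V n (single (C (Node a l r)) 1) = tree_class V n (single (C (Node (swap V a) r l)) 1)"
proof -
  note ctx = tree_context_trees[OF C a]
  have sa: "C (Node (swap V a) r l) \<in> trees V n" using ctx(1,3) s2_moduleD(3)[OF V] by blast
  have "single (C (Node a l r)) 1 - single (C (Node (swap V a) r l)) 1 \<in> tree_kernel V n"
    by (rule rel) (use C a in \<open>auto simp: tree_relations_def\<close>)
  then show ?thesis using sa a by (intro tree_class_eqI[OF V]) (simp_all add: keys_single_subset del: keys_single)
qed

lemma comp3_closed: "v \<in> carrier V \<Longrightarrow> w \<in> carrier V \<Longrightarrow> comp3 V u v w \<in> carrier (free3 V)"
  unfolding comp3_def by (rule lin(1)) (simp add: comp3_tree_trees)

lemma comp3_bilinear: "bilinear_on V V (free3 V) (comp3 V u)"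
proof -
  obtain a b c where abc: "(a, b, c) \<in> arrangements3"
    "\<And>v w :: 'v. comp3_tree u v w = Node v (Node w (Leaf a) (Leaf b)) (Leaf c)" using comp3_tree_form by blast
  have t: "Node v (Node w (Leaf a) (Leaf b)) (Leaf c) \<in> trees V 3" if "v \<in> carrier V" "w \<in> carrier V" for v w
    using that abc(1) by (simp add: trees3_iff)
  have hole: "tree_context (\<lambda>t. t)" and inner: "tree_context (\<lambda>t. Node v t (Leaf c))" for v :: 'v
    by (rule tree_context.hole, rule tree_context.left[OF tree_context.hole])
  show ?thesis
    unfolding bilinear_on_def
  proof (intro conjI ballI linear_mapsI)
    fix w v assume vw: "w \<in> carrier V" "v \<in> carrier V"
    show "comp3 V u v w \<in> carrier (free3 V)" using comp3_closed vw by blast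
    show "comp3 V u (x \<odot>\<^bsub>V\<^esub> v) w = x \<odot>\<^bsub>free3 V\<^esub> comp3 V u v w" for x
      unfolding comp3_def abc(2) by (rule tree_class_smult[OF hole t[OF vw(2,1)]])
    show "comp3 V u w (x \<odot>\<^bsub>V\<^esub> v) = x \<odot>\<^bsub>free3 V\<^esub> comp3 V u w v" for x
      unfolding comp3_def abc(2) by (rule tree_class_smult[OF inner t[OF vw]])
    show "comp3 V u w v \<in> carrier (free3 V)" using comp3_closed vw by blast
    fix v' assume v': "v' \<in> carrier V"
    show "comp3 V u (v \<oplus>\<^bsub>V\<^esub> v') w = comp3 V u v w \<oplus>\<^bsub>free3 V\<^esub> comp3 V u v' w"
      unfolding comp3_def abc(2) by (rule tree_class_add[OF hole t[OF vw(2,1)] v'])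
    show "comp3 V u w (v \<oplus>\<^bsub>V\<^esub> v') = comp3 V u w v \<oplus>\<^bsub>free3 V\<^esub> comp3 V u w v'"
      unfolding comp3_def abc(2) by (rule tree_class_add[OF inner t[OF vw] v'])
  qed
qed

lemma cyclic_label_closed: "w \<in> carrier V \<Longrightarrow> cyclic_label V a b w \<in> carrier V"
  by (simp add: cyclic_label_def s2_moduleD(3)[OF V])

lemma cyclic_label_linear: "cyclic_label V a b \<in> linear_maps V V"
  using s2_moduleD(2)[OF V] linear_maps_id[of V] by (cases "b = a mod 3 + 1") (simp_all add: cyclic_label_def[abs_def])

lemma cyclic_label_swap:
  assumes "(a, b, c) \<in> arrangements3" "w \<in> carrier V"
  shows "cyclic_label V b a (swap V w) = cyclic_label V a b w"
  using assms(1) by (cases rule: arrangements3_cases) (simp_all add: cyclic_label_def s2_moduleD(4)[OF V assms(2)])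

text \<open>An exchange at the root brings the inner vertex to the left, and one at the inner vertex
  puts its leaves in cyclic order. Hence the elements \<open>comp3 V u v w\<close> span arity
  three.\<close>

lemma tree_class_nf3:
  assumes "t \<in> trees V 3"
  obtains u v w where "nf3 V t = (u, v, w)" "v \<in> carrier V" "w \<in> carrier V"
    "tree_class V 3 (single t 1) = comp3 V u v w"
proof -
  have inner: "tree_class V 3 (single (Node v (Node w (Leaf a) (Leaf b)) (Leaf c)) 1) =
      comp3 V (third_input c) v (cyclic_label V a b w)"
    if "(a, b, c) \<in> arrangements3" "v \<in> carrier V" "w \<in> carrier V" for a b c v w
  proof -
    have t: "Node v (Node w (Leaf a) (Leaf b)) (Leaf c) \<in> trees V 3" using that by (simp add: trees3_iff)
    note swap = tree_class_swap[OF tree_context.left[OF tree_context.hole] t]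
    from that(1) show ?thesis
    proof (cases rule: arrangements3_cases)
      case 4
      then show ?thesis using swap by (simp add: third_input_def cyclic_label_def comp3_def)
    next
      case 5
      then show ?thesis using swap by (simp add: third_input_def cyclic_label_def comp3_def)
    next
      case 6
      then show ?thesis using swap by (simp add: third_input_def cyclic_label_def comp3_def)
    qed (simp_all add: third_input_def cyclic_label_def comp3_def)
  qed
  from assms show thesis
  proof (cases rule: trees3_cases)
    case (left v w a b c)
    then show ?thesis using that inner cyclic_label_closed by simp
  next
    case (right v w a b c)
    have "tree_class V 3 (single t 1) =
        tree_class V 3 (single (Node (swap V v) (Node w (Leaf a) (Leaf b)) (Leaf c)) 1)"
      using tree_class_swap[OF tree_context.hole, of v "Leaf c" "Node w (Leaf a) (Leaf b)" 3] assms right(1) by simp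
    then show ?thesis using that inner cyclic_label_closed right s2_moduleD(3)[OF V] by simp
  qed
qed

lemma free3_linear_eq:
  assumes "vectorspace class_ring K" "h \<in> linear_maps (free3 V) K" "h' \<in> linear_maps (free3 V) K"
    and "\<And>u v w. v \<in> carrier V \<Longrightarrow> w \<in> carrier V \<Longrightarrow> h (comp3 V u v w) = h' (comp3 V u v w)"
    and "x \<in> carrier (free3 V)"
  shows "h x = h' x"
proof (rule free_operad_linear_eq[OF V assms(1-3) _ assms(5)])
  fix t assume "t \<in> trees V 3"
  then show "h (tree_class V 3 (single t 1)) = h' (tree_class V 3 (single t 1))"
    by (rule tree_class_nf3) (simp add: assms(4))
qed

text \<open>Additivity and homogeneity in \<open>x\<close>, for all \<open>y\<close> at once, are
  equalities of linear maps on \<open>free3 V\<close> and can be tested on the \<open>comp3\<close>.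
  This is what makes the curried construction of the black map bilinear.\<close>

lemma free3_family_linear:
  assumes M: "vectorspace class_ring M" and K: "vectorspace class_ring K"
    and h: "\<And>x. x \<in> carrier M \<Longrightarrow> h x \<in> linear_maps (free3 V) K"
    and comp3: "\<And>u v w. v \<in> carrier V \<Longrightarrow> w \<in> carrier V \<Longrightarrow> (\<lambda>x. h x (comp3 V u v w)) \<in> linear_maps M K"
    and y: "y \<in> carrier (free3 V)"
  shows "(\<lambda>x. h x y) \<in> linear_maps M K"
proof (rule linear_mapsI)
  interpret M: vectorspace class_ring M by fact
  fix x assume x: "x \<in> carrier M"
  show "h x y \<in> carrier K" using linear_mapsD(1)[OF h[OF x] y] .
  show "h (c \<odot>\<^bsub>M\<^esub> x) y = c \<odot>\<^bsub>K\<^esub> h x y" for c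
    using free3_linear_eq[OF K h linear_maps_smult[OF K h] _ y] linear_mapsD(3)[OF comp3] x vectorspace_smult(1)[OF M x]
    by simp
  fix z assume z: "z \<in> carrier M"
  show "h (x \<oplus>\<^bsub>M\<^esub> z) y = h x y \<oplus>\<^bsub>K\<^esub> h z y"
    using free3_linear_eq[OF K h linear_maps_add[OF K h h] _ y] linear_mapsD(2)[OF comp3] x z by simp
qed

text \<open>Directness of the sum over the tree types in usable form: a bilinear map may be
  prescribed independently for each type. Values on trees are set through \<open>nf3\<close>, and
  the tree relations are killed because the normal form is compatible with them.\<close>

lemma free3_ex:
  assumes K: "vectorspace class_ring K" and \<chi>: "\<And>u. bilinear_on V V K (\<chi> u)"
  shows "\<exists>h\<in>linear_maps (free3 V) K. \<forall>u. \<forall>v\<in>carrier V. \<forall>w\<in>carrier V. h (comp3 V u v w) = \<chi> u v w"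
proof -
  interpret K: vectorspace class_ring K by fact
  define g where "g t = (case nf3 V t of (u, v, w) \<Rightarrow> \<chi> u v w)" for t
  have g: "g t \<in> carrier K" if t: "t \<in> trees V 3" for t
    using t by (rule tree_class_nf3) (simp add: g_def bilinear_onD(3)[OF \<chi>])
  obtain h where h: "h \<in> linear_maps (free_vs (trees V 3)) K" "\<And>t. t \<in> trees V 3 \<Longrightarrow> h (single t 1) = g t"
    using free_vs_ex[OF K, where X="trees V 3" and g=g] g by blast
  have hc: "h (single t c) = c \<odot>\<^bsub>K\<^esub> g t" if "t \<in> trees V 3" for t c
    using linear_mapsD(3)[OF h(1), of "single t 1" c] h(2) that by simp
  \<comment> \<open>At the root and at the inner vertex alike, the value is linear in the label and
    invariant under exchange of the subtrees. This one fact disposes of all three kinds of tree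
    relations.\<close>
  have label: "\<exists>f\<in>linear_maps V K. \<forall>x\<in>carrier V. g (C (Node x l r)) = f x \<and> g (C (Node (swap V x) r l)) = f x"
    if C: "tree_context C" and t: "C (Node a l r) \<in> trees V 3" for C a l r
    using C t
  proof (cases rule: tree_context3_cases)
    case hole
    then have "Node a l r \<in> trees V 3" using t by simp
    then show ?thesis
    proof (cases rule: trees3_cases)
      case (left v w p q c)
      then show ?thesis using hole bilinear_onD(1)[OF \<chi> cyclic_label_closed[of w p q], of "third_input c"]
        by (intro bexI[of _ "\<lambda>x. \<chi> (third_input c) x (cyclic_label V p q w)"]) (auto simp: g_def s2_moduleD(4)[OF V])
    next
      case (right v w p q c)
      then show ?thesis
        using hole linear_maps_compose[OF s2_moduleD(2)[OF V] bilinear_onD(1)[OF \<chi> cyclic_label_closed[of w p q], of "third_input c"]]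
        by (intro bexI[of _ "\<lambda>x. \<chi> (third_input c) (swap V x) (cyclic_label V p q w)"]) (auto simp: g_def)
    qed
  next
    case (left v p q c)
    then have v: "v \<in> carrier V" "(p, q, c) \<in> arrangements3" using t by (simp_all add: trees3_iff)
    show ?thesis
      using left linear_maps_compose[OF cyclic_label_linear bilinear_onD(2)[OF \<chi> v(1)]]
      by (intro bexI[of _ "\<lambda>x. \<chi> (third_input c) v (cyclic_label V p q x)"]) (auto simp: g_def cyclic_label_swap[OF v(2)])
  next
    case (right v p q c)
    then have v: "v \<in> carrier V" "(p, q, c) \<in> arrangements3" using t by (simp_all add: trees3_iff)
    show ?thesis
      using right linear_maps_compose[OF cyclic_label_linear bilinear_onD(2)[OF \<chi> s2_moduleD(3)[OF V v(1)]]]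
      by (intro bexI[of _ "\<lambda>x. \<chi> (third_input c) (swap V v) (cyclic_label V p q x)"]) (auto simp: g_def cyclic_label_swap[OF v(2)])
  qed
  have minus: "h (p - q) = h p \<ominus>\<^bsub>K\<^esub> h q" if "keys p \<subseteq> trees V 3" "keys q \<subseteq> trees V 3" for p q
    using linear_maps_zero_minus(3)[OF free_vs_vectorspace K h(1), of p q] that by simp
  note keys = keys_diff_subset keys_single_subset
  have "h x \<in> {\<zero>\<^bsub>K\<^esub>}" if "x \<in> tree_kernel V 3" for x
  proof (rule linear_span_in[OF free_vs_vectorspace K h(1) tree_relations_carrier[OF V] subspace_of_zero[OF K] _ that])
    fix x assume "x \<in> tree_relations V 3"
    then have "h x = \<zero>\<^bsub>K\<^esub>"
    proof (cases rule: tree_relations_cases)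
      case (add C a b l r)
      obtain f where f: "f \<in> linear_maps V K" "\<And>x. x \<in> carrier V \<Longrightarrow> g (C (Node x l r)) = f x"
        using label[OF add(1,2)] by blast
      have ab: "a \<in> carrier V" "b \<in> carrier V" using tree_context_trees(1)[OF add(1,2)] tree_context_trees(1)[OF add(1,3)] by auto
      have t: "C (Node (a \<oplus>\<^bsub>V\<^esub> b) l r) \<in> trees V 3" using tree_context_trees(2)[OF add(1,2)] s2_moduleD(5)[OF V ab] by blast
      have "h x = (f a \<oplus>\<^bsub>K\<^esub> f b) \<ominus>\<^bsub>K\<^esub> f a \<ominus>\<^bsub>K\<^esub> f b"
        using t add ab s2_moduleD(5)[OF V ab] linear_mapsD(1)[OF f(1)]
        by (simp add: minus keys h(2) f(2) linear_mapsD(2)[OF f(1)] del: keys_single)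
      then show ?thesis using vectorspace_cancel(2)[OF K] linear_mapsD(1)[OF f(1)] ab by simp
    next
      case (smult C a c l r)
      obtain f where f: "f \<in> linear_maps V K" "\<And>x. x \<in> carrier V \<Longrightarrow> g (C (Node x l r)) = f x"
        using label[OF smult(1,2)] by blast
      have a: "a \<in> carrier V" using tree_context_trees(1)[OF smult(1,2)] .
      have t: "C (Node (c \<odot>\<^bsub>V\<^esub> a) l r) \<in> trees V 3" using tree_context_trees(2)[OF smult(1,2)] s2_moduleD(6)[OF V a] by blast
      have "h x = c \<odot>\<^bsub>K\<^esub> f a \<ominus>\<^bsub>K\<^esub> c \<odot>\<^bsub>K\<^esub> f a"
        using t smult a s2_moduleD(6)[OF V a]
        by (simp add: minus keys hc f(2) linear_mapsD[OF f(1)] vectorspace_smult[OF K] del: keys_single)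
      then show ?thesis using vectorspace_cancel(1)[OF K] linear_mapsD(1)[OF f(1)] a vectorspace_smult(1)[OF K] by simp
    next
      case (swap C a l r)
      obtain f where f: "f \<in> linear_maps V K" "\<And>x. x \<in> carrier V \<Longrightarrow> g (C (Node x l r)) = f x"
          "\<And>x. x \<in> carrier V \<Longrightarrow> g (C (Node (s2_module.swap V x) r l)) = f x"
        using label[OF swap(1,2)] by blast
      have a: "a \<in> carrier V" using tree_context_trees(1)[OF swap(1,2)] .
      have t: "C (Node (s2_module.swap V a) r l) \<in> trees V 3" using tree_context_trees(3)[OF swap(1,2)] s2_moduleD(3)[OF V a] by blast
      have "h x = f a \<ominus>\<^bsub>K\<^esub> f a"
        using t swap a by (simp add: minus keys h(2) f(2,3) del: keys_single)
      then show ?thesis using vectorspace_cancel(1)[OF K] linear_mapsD(1)[OF f(1)] a by simp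
    qed
    then show "h x \<in> {\<zero>\<^bsub>K\<^esub>}" by simp
  qed
  then obtain h' where h': "h' \<in> linear_maps (free3 V) K" "\<And>p. keys p \<subseteq> trees V 3 \<Longrightarrow> h' (tree_class V 3 p) = h p"
    using linear_quot_ex[OF free_vs_vectorspace span_in_subspace[OF free_vs_vectorspace tree_relations_carrier[OF V]] K h(1)]
    unfolding free_operad_arity tree_class_def Let_def by auto
  have "h' (comp3 V u v w) = \<chi> u v w" if "v \<in> carrier V" "w \<in> carrier V" for u v w
    using comp3_tree_trees[OF that, of u] by (simp add: comp3_def h'(2) h(2) g_def nf3_comp3_tree)
  then show ?thesis using h'(1) by blast
qed

end

section \<open>The map defining the black product\<close>

text \<open>\<open>black_map\<close> is chosen by \<open>SOME\<close>, so everything known about it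
  rests on the existence of a suitable map. Existence is obtained by currying: the universal
  property of arity three is applied to one factor after the other, then that of the tensor
  product.\<close>

lemma black_map_is_black_map:
  fixes V :: "('k::field, 'v) s2_module" and W :: "('k, 'w) s2_module"
  assumes V: "s2_module V" and W: "s2_module W"
  shows "is_black_map V W (black_map V W)"
proof -
  let ?B = "black_s2 V W" and ?b = "black_tensor V W"
  let ?K = "free3 ?B"
  note B = black_s2_module[OF V W]
  note K = free_operad_vectorspace[OF B, of 3]
  note vsV = s2_moduleD(1)[OF V] and vsW = s2_moduleD(1)[OF W]
  note free = free_operad_vectorspace[OF V, of 3] free_operad_vectorspace[OF W, of 3]
  interpret K: vectorspace class_ring ?K by (rule K)
  note b = black_tensor_bilinear[OF V W]
  note c = comp3_bilinear[OF B]
  define \<chi> where "\<chi> u v w u' v' w' = (if u = u' then comp3 ?B u (?b v v') (?b w w') else \<zero>\<^bsub>?K\<^esub>)" for u v w u' v' w'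
  have \<chi>1: "bilinear_on W W ?K (\<chi> u v w u')" if "v \<in> carrier V" "w \<in> carrier V" for u v w u'
    using that linear_maps_zero[OF K, of W]
      linear_maps_compose[OF bilinear_onD(2)[OF b] bilinear_onD(1)[OF c bilinear_onD(3)[OF b]]]
      linear_maps_compose[OF bilinear_onD(2)[OF b] bilinear_onD(2)[OF c bilinear_onD(3)[OF b]]]
    by (cases "u = u'") (simp_all add: bilinear_on_def \<chi>_def[abs_def])
  have \<chi>2: "bilinear_on V V ?K (\<lambda>v w. \<chi> u v w u' v' w')" if "v' \<in> carrier W" "w' \<in> carrier W" for u u' v' w'
    using that linear_maps_zero[OF K, of V]
      linear_maps_compose[OF bilinear_onD(1)[OF b] bilinear_onD(1)[OF c bilinear_onD(3)[OF b]]]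
      linear_maps_compose[OF bilinear_onD(1)[OF b] bilinear_onD(2)[OF c bilinear_onD(3)[OF b]]]
    by (cases "u = u'") (simp_all add: bilinear_on_def \<chi>_def)
  \<comment> \<open>Extension in the right factor, for a fixed \<open>comp3\<close> on the left. The
    implications make the existence claim hold for all arguments, so that a function
    \<open>H\<close> can be chosen.\<close>
  have "\<forall>u v w. \<exists>h. v \<in> carrier V \<longrightarrow> w \<in> carrier V \<longrightarrow> h \<in> linear_maps (free3 W) ?K \<and>
      (\<forall>u'. \<forall>v'\<in>carrier W. \<forall>w'\<in>carrier W. h (comp3 W u' v' w') = \<chi> u v w u' v' w')"
  proof (intro allI)
    fix u v w
    show "\<exists>h. v \<in> carrier V \<longrightarrow> w \<in> carrier V \<longrightarrow> h \<in> linear_maps (free3 W) ?K \<and>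
      (\<forall>u'. \<forall>v'\<in>carrier W. \<forall>w'\<in>carrier W. h (comp3 W u' v' w') = \<chi> u v w u' v' w')"
    proof (cases "v \<in> carrier V \<and> w \<in> carrier V")
      case True
      then have "bilinear_on W W ?K (\<chi> u v w u')" for u' using \<chi>1 by simp
      from free3_ex[OF W K this] obtain h where "h \<in> linear_maps (free3 W) ?K"
        "\<forall>u'. \<forall>v'\<in>carrier W. \<forall>w'\<in>carrier W. h (comp3 W u' v' w') = \<chi> u v w u' v' w'" by (rule bexE)
      then show ?thesis by (intro exI[of _ h]) simp
    qed auto
  qed
  then obtain H where H: "\<And>u v w. v \<in> carrier V \<Longrightarrow> w \<in> carrier V \<Longrightarrow> H u v w \<in> linear_maps (free3 W) ?K"
    "\<And>u v w u' v' w'. v \<in> carrier V \<Longrightarrow> w \<in> carrier V \<Longrightarrow> v' \<in> carrier W \<Longrightarrow> w' \<in> carrier W \<Longrightarrow>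
      H u v w (comp3 W u' v' w') = \<chi> u v w u' v' w'"
    by metis
  \<comment> \<open>\<open>H u v w\<close> was merely chosen for each \<open>v\<close> and
    \<open>w\<close>, but as a linear map it is determined by its values on the
    \<open>comp3\<close>; its bilinear dependence is inherited from \<open>\<chi>\<close>.\<close>
  have H_bil: "bilinear_on V V ?K (\<lambda>v w. H u v w y)" if y: "y \<in> carrier (free3 W)" for u y
    unfolding bilinear_on_def
  proof (intro conjI ballI)
    fix v assume v: "v \<in> carrier V"
    show "(\<lambda>x. H u x v y) \<in> linear_maps V ?K"
      by (rule free3_family_linear[OF W vsV K H(1) _ y])
        (use v in \<open>auto intro: linear_maps_cong[OF bilinear_onD(1)[OF \<chi>2] H(2) vsV]\<close>)
    show "(\<lambda>x. H u v x y) \<in> linear_maps V ?K"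
      by (rule free3_family_linear[OF W vsV K H(1) _ y])
        (use v in \<open>auto intro: linear_maps_cong[OF bilinear_onD(2)[OF \<chi>2] H(2) vsV]\<close>)
  qed
  \<comment> \<open>Extension in the left factor, now for an arbitrary element \<open>y\<close> on
    the right.\<close>
  have "\<forall>y. \<exists>h. y \<in> carrier (free3 W) \<longrightarrow> h \<in> linear_maps (free3 V) ?K \<and>
      (\<forall>u. \<forall>v\<in>carrier V. \<forall>w\<in>carrier V. h (comp3 V u v w) = H u v w y)"
  proof
    fix y
    show "\<exists>h. y \<in> carrier (free3 W) \<longrightarrow> h \<in> linear_maps (free3 V) ?K \<and>
      (\<forall>u. \<forall>v\<in>carrier V. \<forall>w\<in>carrier V. h (comp3 V u v w) = H u v w y)"
    proof (cases "y \<in> carrier (free3 W)")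
      case True
      then have "bilinear_on V V ?K (\<lambda>v w. H u v w y)" for u using H_bil by simp
      from free3_ex[OF V K this] obtain h where "h \<in> linear_maps (free3 V) ?K"
        "\<forall>u. \<forall>v\<in>carrier V. \<forall>w\<in>carrier V. h (comp3 V u v w) = H u v w y" by (rule bexE)
      then show ?thesis by (intro exI[of _ h]) simp
    qed auto
  qed
  then obtain G where G: "\<And>y. y \<in> carrier (free3 W) \<Longrightarrow> G y \<in> linear_maps (free3 V) ?K"
    "\<And>y u v w. y \<in> carrier (free3 W) \<Longrightarrow> v \<in> carrier V \<Longrightarrow> w \<in> carrier V \<Longrightarrow> G y (comp3 V u v w) = H u v w y"
    by metis
  have bil: "bilinear_on (free3 V) (free3 W) ?K (\<lambda>x y. G y x)"
    unfolding bilinear_on_def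
  proof (intro conjI ballI)
    show "(\<lambda>x. G y x) \<in> linear_maps (free3 V) ?K" if "y \<in> carrier (free3 W)" for y using G(1)[OF that] .
    fix x assume x: "x \<in> carrier (free3 V)"
    show "(\<lambda>y. G y x) \<in> linear_maps (free3 W) ?K"
      by (rule free3_family_linear[OF V free(2) K G(1) _ x])
        (auto intro: linear_maps_cong[OF H(1) G(2) free(2)])
  qed
  then obtain \<Psi> where \<Psi>: "\<Psi> \<in> linear_maps (tensor_vs (free3 V) (free3 W)) ?K"
    "\<And>x y. x \<in> carrier (free3 V) \<Longrightarrow> y \<in> carrier (free3 W) \<Longrightarrow> \<Psi> (pure_tensor (free3 V) (free3 W) x y) = G y x"
    using tensor_ex[OF free K bil] by blast
  have "is_black_map V W \<Psi>"
    unfolding is_black_map_def using \<Psi>(1)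
    by (auto simp: \<Psi>(2) comp3_closed[OF V] comp3_closed[OF W] G(2) H(2) \<chi>_def)
  then show ?thesis unfolding black_map_def by (rule someI[of "is_black_map V W"])
qed

section \<open>PostLie relations along paths\<close>

text \<open>The PostLie counterpart of \<open>tsu_tree\<close>. It depends on the shape and the
  leaves alone, so it is applied to trees whose vertices carry the label \<open>()\<close>.\<close>

primrec path_tree :: "nat set \<Rightarrow> 'x ptree \<Rightarrow> (postlie_op \<Rightarrow>\<^sub>0 'k::field) ptree" where
  "path_tree J (Leaf j) = Leaf j"
| "path_tree J (Node v l r) = Node (path_label J (set (leaves l)) (set (leaves r))) (path_tree J l) (path_tree J r)"

text \<open>
  Replacing the operation at each vertex by its label along the paths to \<open>J\<close> turns the sum of the three
  trees of arity three into a relation of PostLie; for \<open>J = {1, 2, 3}\<close>, \<open>{1}\<close>, \<open>{1, 2}\<close> these are the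
  three defining relations.
\<close>

definition path_relator :: "nat set \<Rightarrow> ((postlie_op \<Rightarrow>\<^sub>0 'k::field) ptree \<Rightarrow>\<^sub>0 'k)" where
  "path_relator J = single (path_tree J (comp3_tree Type_I () ())) 1
     + single (path_tree J (comp3_tree Type_II () ())) 1
     + single (path_tree J (comp3_tree Type_III () ())) 1"

lemma path_label_image: "inj \<tau> \<Longrightarrow> path_label (\<tau> ` J) (\<tau> ` L) (\<tau> ` R) = path_label J L R"
  by (simp add: path_label_def image_Int[symmetric])

lemma path_tree_relabel:
  assumes "inj \<tau>"
  shows "relabel \<tau> (path_tree J t) = path_tree (\<tau> ` J) (relabel \<tau> t)"
  by (induction t) (simp_all add: path_label_image[OF assms])

subsection \<open>Equality of trees in the free operad\<close>

text \<open>Equality in the free operad, expressed on representatives: calculations stay with formal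
  sums and pass to classes only at the end, through \<open>postlie_eq_class\<close>.\<close>

definition postlie_eq :: "((postlie_op \<Rightarrow>\<^sub>0 'k::field) ptree \<Rightarrow>\<^sub>0 'k) \<Rightarrow> ((postlie_op \<Rightarrow>\<^sub>0 'k) ptree \<Rightarrow>\<^sub>0 'k) \<Rightarrow> bool"
    (infix \<open>\<simeq>\<close> 50) where
  "p \<simeq> q \<longleftrightarrow> p - q \<in> tree_kernel postlie_s2 3"

lemmas postlie_kernel = span_in_subspace[OF free_vs_vectorspace tree_relations_carrier[OF postlie_s2_module]]
lemmas postlie_kernelD = subspace_ofD[OF postlie_kernel, unfolded free_vs_simps]

lemma postlie_kernel_uminus: "p \<in> tree_kernel postlie_s2 3 \<Longrightarrow> - p \<in> tree_kernel postlie_s2 3"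
proof -
  assume "p \<in> tree_kernel postlie_s2 3"
  then have "Poly_Mapping.map ((*) (- 1)) p \<in> tree_kernel postlie_s2 3" by (rule postlie_kernelD(4))
  moreover have "Poly_Mapping.map ((*) (- 1)) p = - p" by (rule poly_mapping_eqI) simp
  ultimately show ?thesis by simp
qed

lemma postlie_eq_refl: "p \<simeq> p"
  by (simp add: postlie_eq_def postlie_kernelD(2))

lemma postlie_eq_sym: "p \<simeq> q \<Longrightarrow> q \<simeq> p"
  using postlie_kernel_uminus[of "p - q"] by (simp add: postlie_eq_def)

lemma postlie_eq_trans [trans]: "p \<simeq> q \<Longrightarrow> q \<simeq> r \<Longrightarrow> p \<simeq> r"
  using postlie_kernelD(3)[of "p - q" 3 "q - r"] by (simp add: postlie_eq_def)

lemma postlie_eq_add: "p \<simeq> q \<Longrightarrow> p' \<simeq> q' \<Longrightarrow> p + p' \<simeq> q + q'"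
  using postlie_kernelD(3)[of "p - q" 3 "p' - q'"] by (simp add: postlie_eq_def algebra_simps)

lemma postlie_eq_uminus: "p \<simeq> q \<Longrightarrow> - p \<simeq> - q"
  using postlie_kernel_uminus[of "p - q"] by (simp add: postlie_eq_def)

lemma postlie_eq_class:
  assumes "p \<simeq> q" "keys p \<subseteq> trees postlie_s2 3" "keys q \<subseteq> trees postlie_s2 3"
  shows "tree_class postlie_s2 3 p = tree_class postlie_s2 3 q"
  using assms by (intro tree_class_eqI[OF postlie_s2_module]) (auto simp: postlie_eq_def)

lemmas postlie_rel = span_in_superset[OF free_vs_vectorspace tree_relations_carrier[OF postlie_s2_module]]

lemma
  fixes C :: "(postlie_op \<Rightarrow>\<^sub>0 'k::field) ptree \<Rightarrow> (postlie_op \<Rightarrow>\<^sub>0 'k) ptree"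
  assumes C: "tree_context C" and t: "C (Node a l r) \<in> trees postlie_s2 3"
  shows postlie_eq_swap:
      "single (C (Node a l r)) 1 \<simeq> single (C (Node (postlie_swap a) r l)) 1"
    and postlie_eq_neg:
      "single (C (Node (- a) l r)) 1 \<simeq> - single (C (Node a l r)) 1"
    and postlie_eq_plus:
      "single (C (Node (a + b) l r)) 1
        \<simeq> single (C (Node a l r)) 1 + single (C (Node b l r)) 1"
proof -
  have "single (C (Node a l r)) 1 - single (C (Node (swap postlie_s2 a) r l)) 1
      \<in> tree_relations postlie_s2 3"
    unfolding tree_relations_def using C t by blast
  from postlie_rel[OF this]
  show "single (C (Node a l r)) 1 \<simeq> single (C (Node (postlie_swap a) r l)) 1"
    by (simp add: postlie_eq_def)
  have "single (C (Node ((- 1) \<odot>\<^bsub>postlie_s2\<^esub> a) l r)) 1 - single (C (Node a l r)) (- 1)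
      \<in> tree_relations postlie_s2 3"
    unfolding tree_relations_def using C t by blast
  moreover have "(- 1) \<odot>\<^bsub>postlie_s2\<^esub> a = - a" by (rule poly_mapping_eqI) simp
  ultimately have "single (C (Node (- a) l r)) 1 - single (C (Node a l r)) (- 1)
      \<in> tree_kernel postlie_s2 3" by (metis postlie_rel)
  then show "single (C (Node (- a) l r)) 1 \<simeq> - single (C (Node a l r)) 1"
    by (simp add: postlie_eq_def single_uminus)
  have "C (Node b l r) \<in> trees postlie_s2 3" using tree_context_trees(2)[OF C t, of b] by simp
  then have "single (C (Node (a \<oplus>\<^bsub>postlie_s2\<^esub> b) l r)) 1 - single (C (Node a l r)) 1
      - single (C (Node b l r)) 1 \<in> tree_relations postlie_s2 3"
    unfolding tree_relations_def using C t by blast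
  from postlie_rel[OF this]
  show "single (C (Node (a + b) l r)) 1
        \<simeq> single (C (Node a l r)) 1 + single (C (Node b l r)) 1"
    by (simp add: postlie_eq_def diff_diff_eq)
qed

lemma tree_context_left3: "tree_context (\<lambda>t. Node v t (Leaf c))"
  by (rule tree_context.left[OF tree_context.hole])

lemma tree_context_right3: "tree_context (\<lambda>t. Node v (Leaf c) t)"
  by (rule tree_context.right[OF tree_context.hole])

lemma postlie_swap_single [simp]:
  "postlie_swap (single Circ 1) = single Circ_Op 1"
  "postlie_swap (single Circ_Op 1) = single Circ 1"
  "postlie_swap (single Bracket 1) = - single Bracket 1"
  by (auto intro!: postlie_eqI simp: lookup_single)

text \<open>The outer label sees only the set \<open>{a, b}\<close> and stays the same; the inner
  label changes sign under the exchange, and that sign comes out by linearity in the label.\<close>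

lemma path_tree_swap:
  assumes "(a, b, c) \<in> arrangements3"
  shows "single (path_tree J (Node v (Node w (Leaf b) (Leaf a)) (Leaf c))) 1
    \<simeq> - single (path_tree J (Node v (Node w (Leaf a) (Leaf b)) (Leaf c))) (1::'k::field)"
proof -
  let ?o = "path_label J {a, b} {c} :: postlie_op \<Rightarrow>\<^sub>0 'k" and ?i = "\<lambda>a b. path_label J {a} {b} :: postlie_op \<Rightarrow>\<^sub>0 'k"
  have bac: "(b, a, c) \<in> arrangements3" using assms arrangements3D[OF assms] by (intro arrangements3I) auto
  have "single (Node ?o (Node (?i b a) (Leaf b) (Leaf a)) (Leaf c)) (1::'k)
      \<simeq> single (Node ?o (Node (- ?i a b) (Leaf a) (Leaf b)) (Leaf c)) 1"
    using postlie_eq_swap[OF tree_context_left3, of ?o "?i b a" "Leaf b" "Leaf a" c] bac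
    by (simp add: trees3_iff postlie_swap_path_label)
  also have "\<dots> \<simeq> - single (Node ?o (Node (?i a b) (Leaf a) (Leaf b)) (Leaf c)) 1"
    using postlie_eq_neg[OF tree_context_left3, of ?o "?i a b" "Leaf a" "Leaf b" c] assms
    by (simp add: trees3_iff)
  finally show ?thesis by (simp add: insert_commute)
qed

lemma path_relator_keys: "keys (path_relator J) \<subseteq> trees postlie_s2 3"
  unfolding path_relator_def
  by (intro keys_add_subset keys_single_subset) (simp_all add: trees3_iff arrangements3_def)

text \<open>A cyclic permutation just reorders the three summands. A transposition reverses every
  inner pair as well, which costs one sign in each summand, hence one common sign.\<close>

lemma path_relator_relabel:
  assumes \<tau>: "\<tau> permutes {1..3}"
  shows "push (relabel \<tau>) (path_relator J) \<simeq> (path_relator (\<tau> ` J) :: _ \<Rightarrow>\<^sub>0 'k::field) \<or>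
    push (relabel \<tau>) (path_relator J) \<simeq> - (path_relator (\<tau> ` J) :: _ \<Rightarrow>\<^sub>0 'k)"
proof -
  have inj: "inj \<tau>" using permutes_inj[OF \<tau>] .
  define U where "U a b c = single
      (path_tree (\<tau> ` J) (Node () (Node () (Leaf a) (Leaf b)) (Leaf c)) :: (postlie_op \<Rightarrow>\<^sub>0 'k) ptree) (1::'k)" for a b c
  let ?p = "push (relabel \<tau>) (path_relator J) :: _ \<Rightarrow>\<^sub>0 'k" and ?q = "path_relator (\<tau> ` J) :: _ \<Rightarrow>\<^sub>0 'k"
  have rel: "?q = U 1 2 3 + U 2 3 1 + U 3 1 2"
    by (simp add: path_relator_def U_def del: path_tree.simps)
  have push: "?p = U (\<tau> 1) (\<tau> 2) (\<tau> 3) + U (\<tau> 2) (\<tau> 3) (\<tau> 1) + U (\<tau> 3) (\<tau> 1) (\<tau> 2)"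
    by (simp add: path_relator_def U_def push_add path_tree_relabel[OF inj] del: path_tree.simps)
  have flip: "U 2 1 3 \<simeq> - U 1 2 3" "U 3 2 1 \<simeq> - U 2 3 1" "U 1 3 2 \<simeq> - U 3 1 2"
    unfolding U_def by (rule path_tree_swap, simp add: arrangements3_def)+
  have "\<tau> ` {1..3} = {1..3}" using permutes_image[OF \<tau>] .
  then have "{\<tau> 1, \<tau> 2, \<tau> 3} = {1..3}" unfolding atLeastAtMost_3 by simp
  moreover have "distinct [\<tau> 1, \<tau> 2, \<tau> 3]" by (simp add: inj_eq[OF inj])
  ultimately have "(\<tau> 1, \<tau> 2, \<tau> 3) \<in> arrangements3" by (intro arrangements3I)
  then show ?thesis
  proof (cases rule: arrangements3_cases)
    case 1
    then show ?thesis unfolding push rel by (simp add: postlie_eq_refl)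
  next
    case 2
    then have "?p = ?q" unfolding push rel by (simp add: ac_simps)
    then show ?thesis by (simp add: postlie_eq_refl)
  next
    case 3
    then have "?p = ?q" unfolding push rel by (simp add: ac_simps)
    then show ?thesis by (simp add: postlie_eq_refl)
  next
    case 4
    then have "?p \<simeq> - ?q"
      using postlie_eq_add[OF postlie_eq_add[OF flip(1,3)] flip(2)] unfolding push rel by (simp add: algebra_simps)
    then show ?thesis ..
  next
    case 5
    then have "?p \<simeq> - ?q"
      using postlie_eq_add[OF postlie_eq_add[OF flip(2,1)] flip(3)] unfolding push rel by (simp add: algebra_simps)
    then show ?thesis ..
  next
    case 6
    then have "?p \<simeq> - ?q"
      using postlie_eq_add[OF postlie_eq_add[OF flip(3,2)] flip(1)] unfolding push rel by (simp add: algebra_simps)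
    then show ?thesis ..
  qed
qed

subsection \<open>The defining relations\<close>

lemma postlie_relators_keys: "p \<in> postlie_relators \<Longrightarrow> keys p \<subseteq> trees postlie_s2 3"
  unfolding postlie_relators_def Let_def
  by (elim insertE emptyE; hypsubst)
    (intro keys_add_subset keys_diff_subset keys_single_subset; simp add: trees3_iff arrangements3_def)+

lemma postlie_relators_path: "\<exists>p1 p2 p3. postlie_relators = {p1, p2, p3} \<and>
   p1 \<simeq> path_relator {1, 2, 3} \<and> p2 \<simeq> path_relator {1} \<and> (p3 :: (postlie_op \<Rightarrow>\<^sub>0 'k::field) ptree \<Rightarrow>\<^sub>0 'k) \<simeq> path_relator {1, 2}"
proof -
  define m where "m = (\<lambda>t :: (postlie_op \<Rightarrow>\<^sub>0 'k) ptree. single t (1::'k))"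
  define c where "c = (single Circ 1 :: postlie_op \<Rightarrow>\<^sub>0 'k)"
  define o' where "o' = (single Circ_Op 1 :: postlie_op \<Rightarrow>\<^sub>0 'k)"
  define b where "b = (single Bracket 1 :: postlie_op \<Rightarrow>\<^sub>0 'k)"
  let ?x = "Leaf 1" and ?y = "Leaf 2" and ?z = "Leaf 3"
  let ?p1 = "m (Node b (Node b ?x ?y) ?z) + m (Node b (Node b ?z ?x) ?y) + m (Node b (Node b ?y ?z) ?x)"
  let ?p2 = "m (Node c (Node c ?x ?y) ?z) - m (Node c ?x (Node c ?y ?z)) - m (Node c (Node c ?x ?z) ?y)
    + m (Node c ?x (Node c ?z ?y)) - m (Node c ?x (Node b ?y ?z))"
  let ?p3 = "m (Node c (Node b ?x ?y) ?z) - m (Node b (Node c ?x ?z) ?y) - m (Node b ?x (Node c ?y ?z))"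
  have rel: "postlie_relators = {?p1, ?p2, ?p3}"
    by (simp add: postlie_relators_def Let_def m_def c_def b_def)
  have swap: "postlie_swap c = o'" "postlie_swap o' = c" "postlie_swap b = - b"
    by (simp_all add: c_def o'_def b_def)
  have t1: "(\<lambda>t. Node v t (Leaf k)) (Node a (Leaf i) (Leaf j)) \<in> trees postlie_s2 3"
    and t2: "(\<lambda>t. Node v (Leaf k) t) (Node a (Leaf i) (Leaf j)) \<in> trees postlie_s2 3"
    and t3: "(\<lambda>t. t) (Node v (Node a (Leaf i) (Leaf j)) (Leaf k)) \<in> trees postlie_s2 3"
    and t4: "(\<lambda>t. t) (Node v (Leaf k) (Node a (Leaf i) (Leaf j))) \<in> trees postlie_s2 3"
    if "(i, j, k) \<in> arrangements3" for v a :: "postlie_op \<Rightarrow>\<^sub>0 'k" and i j k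
    using that by (simp_all add: trees3_iff)
  note l = tree_context_left3 and r = tree_context_right3 and h = tree_context.hole
  have arr: "(1, 2, 3) \<in> arrangements3" "(2, 3, 1) \<in> arrangements3" "(3, 1, 2) \<in> arrangements3" "(1, 3, 2) \<in> arrangements3" "(3, 2, 1) \<in> arrangements3"
    by (simp_all add: arrangements3_def)
  \<comment> \<open>Towards input \<open>1\<close> the vertex joining \<open>z\<close> and
    \<open>x\<close> turns right, and its label \<open>- o'\<close> on \<open>(z, x)\<close> means
    \<open>-(x \<circ> z)\<close>. This occurs both for \<open>J = {1}\<close> and for
    \<open>J = {1, 2}\<close>.\<close>
  have circ: "m (Node v (Node (- o') ?z ?x) ?y) \<simeq> - m (Node v (Node c ?x ?z) ?y)" for v
  proof -
    have "m (Node v (Node (- o') ?z ?x) ?y) \<simeq> - m (Node v (Node o' ?z ?x) ?y)"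
      unfolding m_def by (rule postlie_eq_neg[OF l t1[OF arr(3)]])
    also have "\<dots> \<simeq> - m (Node v (Node c ?x ?z) ?y)"
      using postlie_eq_uminus[OF postlie_eq_swap[OF l t1[OF arr(3)], of v o']] by (simp add: m_def swap)
    finally show ?thesis .
  qed
  have "path_relator {1, 2, 3} = m (Node b (Node b ?x ?y) ?z) + m (Node b (Node b ?y ?z) ?x) + m (Node b (Node b ?z ?x) ?y)"
    by (simp add: path_relator_def path_label_def m_def b_def)
  then have 1: "?p1 \<simeq> path_relator {1, 2, 3}" by (simp add: ac_simps postlie_eq_refl)
  have "path_relator {1, 2} = m (Node c (Node b ?x ?y) ?z) + m (Node b (Node c ?y ?z) ?x) + m (Node b (Node (- o') ?z ?x) ?y)"
    by (simp add: path_relator_def path_label_def m_def b_def c_def o'_def)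
  also have "\<dots> \<simeq> m (Node c (Node b ?x ?y) ?z) + (- m (Node b ?x (Node c ?y ?z))) + (- m (Node b (Node c ?x ?z) ?y))"
  proof (intro postlie_eq_add postlie_eq_refl circ)
    have "m (Node b (Node c ?y ?z) ?x) \<simeq> m (Node (- b) ?x (Node c ?y ?z))"
      using postlie_eq_swap[OF h t3[OF arr(2)], of b c] by (simp add: m_def swap)
    also have "\<dots> \<simeq> - m (Node b ?x (Node c ?y ?z))"
      unfolding m_def by (rule postlie_eq_neg[OF h t4[OF arr(2)]])
    finally show "m (Node b (Node c ?y ?z) ?x) \<simeq> - m (Node b ?x (Node c ?y ?z))" .
  qed
  also have "\<dots> = ?p3" by simp
  finally have 3: "?p3 \<simeq> path_relator {1, 2}" by (rule postlie_eq_sym)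
  \<comment> \<open>The vertex joining \<open>y\<close> and \<open>z\<close> lies on no path to
    input \<open>1\<close>, so it carries the sum of all three labels. Expanding it produces, up to
    sign, the three terms \<open>x \<circ> (y \<circ> z)\<close>,
    \<open>x \<circ> (z \<circ> y)\<close> and \<open>x \<circ> [y, z]\<close> of the second
    relator.\<close>
  let ?s = "c + - o' + b"
  have "path_relator {1} = m (Node c (Node c ?x ?y) ?z) + m (Node (- o') (Node ?s ?y ?z) ?x) + m (Node c (Node (- o') ?z ?x) ?y)"
    by (simp add: path_relator_def path_label_def m_def b_def c_def o'_def)
  also have "\<dots> \<simeq> m (Node c (Node c ?x ?y) ?z)
      + - (m (Node c ?x (Node c ?y ?z)) + - m (Node c ?x (Node c ?z ?y)) + m (Node c ?x (Node b ?y ?z)))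
      + (- m (Node c (Node c ?x ?z) ?y))"
  proof (intro postlie_eq_add postlie_eq_refl circ)
    have "m (Node (- o') (Node ?s ?y ?z) ?x) \<simeq> - m (Node o' (Node ?s ?y ?z) ?x)"
      unfolding m_def by (rule postlie_eq_neg[OF h t3[OF arr(2)]])
    also have "\<dots> \<simeq> - m (Node c ?x (Node ?s ?y ?z))"
      using postlie_eq_uminus[OF postlie_eq_swap[OF h t3[OF arr(2)], of o' ?s]] by (simp add: m_def swap)
    also have "\<dots> \<simeq> - (m (Node c ?x (Node c ?y ?z)) + - m (Node c ?x (Node c ?z ?y)) + m (Node c ?x (Node b ?y ?z)))"
    proof (rule postlie_eq_uminus)
      have "m (Node c ?x (Node ?s ?y ?z)) \<simeq> m (Node c ?x (Node (c + - o') ?y ?z)) + m (Node c ?x (Node b ?y ?z))"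
        unfolding m_def by (rule postlie_eq_plus[OF r t2[OF arr(2)]])
      also have "\<dots> \<simeq> m (Node c ?x (Node c ?y ?z)) + - m (Node c ?x (Node c ?z ?y)) + m (Node c ?x (Node b ?y ?z))"
      proof (intro postlie_eq_add postlie_eq_refl)
        have "m (Node c ?x (Node (c + - o') ?y ?z)) \<simeq> m (Node c ?x (Node c ?y ?z)) + m (Node c ?x (Node (- o') ?y ?z))"
          unfolding m_def by (rule postlie_eq_plus[OF r t2[OF arr(2)]])
        also have "\<dots> \<simeq> m (Node c ?x (Node c ?y ?z)) + - m (Node c ?x (Node c ?z ?y))"
        proof (intro postlie_eq_add postlie_eq_refl)
          have "m (Node c ?x (Node (- o') ?y ?z)) \<simeq> - m (Node c ?x (Node o' ?y ?z))"
            unfolding m_def by (rule postlie_eq_neg[OF r t2[OF arr(2)]])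
          also have "\<dots> \<simeq> - m (Node c ?x (Node c ?z ?y))"
            using postlie_eq_uminus[OF postlie_eq_swap[OF r t2[OF arr(2)], of c o']] by (simp add: m_def swap)
          finally show "m (Node c ?x (Node (- o') ?y ?z)) \<simeq> - m (Node c ?x (Node c ?z ?y))" .
        qed
        finally show "m (Node c ?x (Node (c + - o') ?y ?z)) \<simeq> m (Node c ?x (Node c ?y ?z)) + - m (Node c ?x (Node c ?z ?y))" .
      qed
      finally show "m (Node c ?x (Node ?s ?y ?z)) \<simeq> m (Node c ?x (Node c ?y ?z)) + - m (Node c ?x (Node c ?z ?y)) + m (Node c ?x (Node b ?y ?z))" .
    qed
    finally show "m (Node (- o') (Node ?s ?y ?z) ?x) \<simeq>
      - (m (Node c ?x (Node c ?y ?z)) + - m (Node c ?x (Node c ?z ?y)) + m (Node c ?x (Node b ?y ?z)))" .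
  qed
  also have "\<dots> = ?p2" by simp
  finally have 2: "?p2 \<simeq> path_relator {1}" by (rule postlie_eq_sym)
  show ?thesis
    by (rule exI[of _ ?p1], rule exI[of _ ?p2], rule exI[of _ ?p3]) (intro conjI rel 1 2 3)
qed

section \<open>Path relations span the PostLie relations\<close>

abbreviation path_relation :: "nat set \<Rightarrow> ((postlie_op \<Rightarrow>\<^sub>0 'k::field) ptree \<Rightarrow>\<^sub>0 'k) set" where
  "path_relation J \<equiv> tree_class postlie_s2 3 (path_relator J)"

text \<open>The action of \<sigma> relabels the leaves by the inverse of \<sigma>, so the set of
  marked inputs moves by the inverse as well.\<close>

lemma path_relation_act:
  fixes \<sigma> :: "nat \<Rightarrow> nat" and J :: "nat set"
  assumes \<sigma>: "\<sigma> permutes {1..3}"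
  shows "sym_act (free_operad postlie_s2) 3 \<sigma> (path_relation J) = (path_relation (inv_into UNIV \<sigma> ` J) :: (_ \<Rightarrow>\<^sub>0 'k::field) set) \<or>
    sym_act (free_operad postlie_s2) 3 \<sigma> (path_relation J) =
      (- 1) \<odot>\<^bsub>free3 postlie_s2\<^esub> (path_relation (inv_into UNIV \<sigma> ` J) :: (_ \<Rightarrow>\<^sub>0 'k) set)"
proof -
  let ?\<tau> = "inv_into UNIV \<sigma>" and ?V = "postlie_s2 :: ('k, _) s2_module"
  have \<tau>: "?\<tau> permutes {1..3}" by (rule permutes_inv[OF \<sigma>])
  have act: "sym_act (free_operad ?V) 3 \<sigma> (path_relation J) = tree_class ?V 3 (push (relabel ?\<tau>) (path_relator J))"
    by (rule free_operad_act[OF postlie_s2_module \<sigma> path_relator_keys])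
  have keys: "keys (push (relabel ?\<tau>) (path_relator J :: _ \<Rightarrow>\<^sub>0 'k)) \<subseteq> trees ?V 3"
    using linear_mapsD(1)[OF push_linear[of "trees ?V 3" "relabel ?\<tau>" "trees ?V 3", OF relabel_trees[OF _ \<tau>]], of "path_relator J"]
      by (simp add: path_relator_keys)
  have neg: "- path_relator (?\<tau> ` J) = Poly_Mapping.map ((*) (- 1)) (path_relator (?\<tau> ` J) :: _ \<Rightarrow>\<^sub>0 'k)"
    by (rule poly_mapping_eqI) simp
  from path_relator_relabel[OF \<tau>, of J, where ?'k='k] show ?thesis
  proof
    assume "push (relabel ?\<tau>) (path_relator J) \<simeq> (path_relator (?\<tau> ` J) :: _ \<Rightarrow>\<^sub>0 'k)"
    then show ?thesis using postlie_eq_class[OF _ keys path_relator_keys] act by simp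
  next
    assume "push (relabel ?\<tau>) (path_relator J) \<simeq> - (path_relator (?\<tau> ` J) :: _ \<Rightarrow>\<^sub>0 'k)"
    then have "tree_class ?V 3 (push (relabel ?\<tau>) (path_relator J)) = tree_class ?V 3 (- path_relator (?\<tau> ` J))"
      using keys by (intro postlie_eq_class) (simp_all add: path_relator_keys)
    also have "\<dots> = (- 1) \<odot>\<^bsub>free3 ?V\<^esub> path_relation (?\<tau> ` J)"
      using linear_mapsD(3)[OF tree_class_linear[OF postlie_s2_module], of "path_relator (?\<tau> ` J)" 3 "- 1"]
      by (simp add: neg path_relator_keys)
    finally show ?thesis using act by simp
  qed
qed

lemma postlie_relators_class: "tree_class postlie_s2 3 ` postlie_relators = path_relation ` {{1, 2, 3}, {1}, {1, 2}}"
proof -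
  obtain p1 p2 p3 :: "(postlie_op \<Rightarrow>\<^sub>0 'a) ptree \<Rightarrow>\<^sub>0 'a" where p: "postlie_relators = {p1, p2, p3}"
    "p1 \<simeq> path_relator {1, 2, 3}" "p2 \<simeq> path_relator {1}" "p3 \<simeq> path_relator {1, 2}"
    using postlie_relators_path by blast
  have "keys p1 \<subseteq> trees postlie_s2 3" by (rule postlie_relators_keys) (simp add: p(1))
  moreover have "keys p2 \<subseteq> trees postlie_s2 3" by (rule postlie_relators_keys) (simp add: p(1))
  moreover have "keys p3 \<subseteq> trees postlie_s2 3" by (rule postlie_relators_keys) (simp add: p(1))
  ultimately show ?thesis
    using postlie_eq_class[OF p(2) _ path_relator_keys] postlie_eq_class[OF p(3) _ path_relator_keys]
      postlie_eq_class[OF p(4) _ path_relator_keys] unfolding p(1) by simp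
qed

lemma path_relation_closed: "path_relation J \<in> carrier (free3 (postlie_s2 :: ('k::field, _) s2_module))"
  using linear_mapsD(1)[OF tree_class_linear[OF postlie_s2_module], of "path_relator J"] path_relator_keys[of J] by simp

lemma postlie_relation_generators_carrier:
  "{sym_act (free_operad postlie_s2) 3 \<sigma> (tree_class postlie_s2 3 p) | \<sigma> p. \<sigma> permutes {1..3} \<and> p \<in> postlie_relators}
     \<subseteq> carrier (free3 postlie_s2)"
proof clarify
  fix \<sigma> :: "nat \<Rightarrow> nat" and p assume *: "\<sigma> permutes {1..3}" "p \<in> (postlie_relators :: (_ \<Rightarrow>\<^sub>0 'a) set)"
  have "tree_class postlie_s2 3 p \<in> carrier (free3 postlie_s2)"
    using linear_mapsD(1)[OF tree_class_linear[OF postlie_s2_module], of p] postlie_relators_keys[OF *(2)] by simp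
  then show "sym_act (free_operad postlie_s2) 3 \<sigma> (tree_class postlie_s2 3 p) \<in> carrier (free3 postlie_s2)"
    by (rule linear_mapsD(1)[OF operad.act_linear[OF free_operad_operad[OF postlie_s2_module] *(1)]])
qed

lemmas postlie_free3 = free_operad_vectorspace[OF postlie_s2_module, of 3]

text \<open>Up to a permutation, a nonempty set of inputs is determined by its size, so
  \<open>{1}\<close>, \<open>{1, 2}\<close> and \<open>{1, 2, 3}\<close> reach all the others. The
  sign that may appear on the way is removed by scaling with \<open>-1\<close>.\<close>

lemma path_relation_mem:
  assumes "J \<noteq> {}" "J \<subseteq> {1..3}"
  shows "(path_relation J :: (_ \<Rightarrow>\<^sub>0 'k::field) set) \<in> postlie_relations"
proof -
  let ?F = "free3 (postlie_s2 :: ('k, _) s2_module)" and ?p = "\<lambda>J. path_relation J :: (_ \<Rightarrow>\<^sub>0 'k) set"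
  have rel: "subspace_of postlie_relations ?F"
    unfolding postlie_relations_def by (rule span_in_subspace[OF postlie_free3 postlie_relation_generators_carrier])
  have "\<exists>\<tau> J0. \<tau> permutes {1..3} \<and> J0 \<in> {{1, 2, 3}, {1}, {1, 2}} \<and> \<tau> ` J0 = J"
  proof -
    have tr: "Transposition.transpose a b permutes {1..3}" if "a \<in> {1..3}" "b \<in> {1..3}" for a b :: nat
      using that by (rule permutes_swap_id)
    have "J \<in> Pow {1, 2, 3}" using assms(2) unfolding atLeastAtMost_3 by simp
    then consider "J = {1}" | "J = {2}" | "J = {3}" | "J = {1, 2}" | "J = {1, 3}" | "J = {2, 3}" | "J = {1, 2, 3}"
      using assms(1) by (auto simp: Pow_insert insert_commute)
    then show ?thesis
    proof cases
      case 1 then show ?thesis by (intro exI[of _ id] exI[of _ "{1}"]) (simp add: permutes_id)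
    next
      case 2 then show ?thesis using tr[of 1 2] by (intro exI[of _ "Transposition.transpose 1 2"] exI[of _ "{1}"]) simp
    next
      case 3 then show ?thesis using tr[of 1 3] by (intro exI[of _ "Transposition.transpose 1 3"] exI[of _ "{1}"]) simp
    next
      case 4 then show ?thesis by (intro exI[of _ id] exI[of _ "{1, 2}"]) (simp add: permutes_id)
    next
      case 5 then show ?thesis using tr[of 2 3]
        by (intro exI[of _ "Transposition.transpose 2 3"] exI[of _ "{1, 2}"]) (simp add: transpose_def)
    next
      case 6 then show ?thesis using tr[of 1 3]
        by (intro exI[of _ "Transposition.transpose 1 3"] exI[of _ "{1, 2}"]) (simp add: transpose_def insert_commute)
    next
      case 7 then show ?thesis by (intro exI[of _ id] exI[of _ "{1, 2, 3}"]) (simp add: permutes_id)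
    qed
  qed
  then obtain \<tau> J0 where J0: "\<tau> permutes {1..3}" "J0 \<in> {{1, 2, 3}, {1}, {1, 2}}" "\<tau> ` J0 = J" by blast
  \<comment> \<open>The inverse is taken because the action moves \<open>J0\<close> by the inverse
    of the acting permutation.\<close>
  let ?\<sigma> = "inv_into UNIV \<tau>"
  have \<sigma>: "?\<sigma> permutes {1..3}" "inv_into UNIV ?\<sigma> = \<tau>" using permutes_inv[OF J0(1)] permutes_inv_inv[OF J0(1)] by auto
  have "?p J0 \<in> tree_class postlie_s2 3 ` postlie_relators"
    unfolding postlie_relators_class using J0(2) by (rule imageI)
  then obtain p where p: "p \<in> postlie_relators" "?p J0 = tree_class postlie_s2 3 p" by blast
  have "sym_act (free_operad postlie_s2) 3 ?\<sigma> (?p J0) \<in> postlie_relations"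
    unfolding postlie_relations_def
    by (rule span_in_superset[OF postlie_free3 postlie_relation_generators_carrier], unfold p(2),
        rule CollectI, rule exI[of _ ?\<sigma>], rule exI[of _ p], intro conjI refl \<sigma>(1) p(1))
  then have "?p J \<in> postlie_relations \<or> (- 1) \<odot>\<^bsub>?F\<^esub> ?p J \<in> postlie_relations"
    using path_relation_act[OF \<sigma>(1), of J0, where ?'k='k] unfolding \<sigma>(2) J0(3) by auto
  then show ?thesis
  proof
    assume "(- 1) \<odot>\<^bsub>?F\<^esub> ?p J \<in> postlie_relations"
    then have "(- 1) \<odot>\<^bsub>?F\<^esub> ((- 1) \<odot>\<^bsub>?F\<^esub> ?p J) \<in> postlie_relations"
      by (rule subspace_ofD(4)[OF rel])
    then show ?thesis
      using path_relation_closed[of J, where ?'k='k]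
      by (simp add: vectorspace_smult(5)[OF postlie_free3] flip: vectorspace_smult(4)[OF postlie_free3])
  qed
qed

text \<open>The generators of the PostLie relations are permuted path relations, hence path
  relations again up to a sign that closure of \<open>W\<close> under scalars absorbs. Conditions
  linear in a PostLie relation can thus be checked on path relations.\<close>

lemma postlie_relations_least:
  assumes W: "subspace_of W (free3 postlie_s2)" and J: "\<And>J. J \<noteq> {} \<Longrightarrow> J \<subseteq> {1..3} \<Longrightarrow> path_relation J \<in> W"
  shows "postlie_relations \<subseteq> W"
  unfolding postlie_relations_def
proof (rule span_in_least[OF postlie_free3 W], clarify)
  fix \<sigma> :: "nat \<Rightarrow> nat" and p assume \<sigma>: "\<sigma> permutes {1..3}" and p: "p \<in> (postlie_relators :: (_ \<Rightarrow>\<^sub>0 'a) set)"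
  obtain J where p': "tree_class postlie_s2 3 p = path_relation J" "J \<in> {{1, 2, 3}, {1}, {1, 2}}"
    using p postlie_relators_class by blast
  then have "J \<noteq> {}" "J \<subseteq> {1..3}" unfolding atLeastAtMost_3 by auto
  then have "inv_into UNIV \<sigma> ` J \<noteq> {}" "inv_into UNIV \<sigma> ` J \<subseteq> {1..3}"
    using permutes_image[OF permutes_inv[OF \<sigma>]] by (auto dest: permutes_mem[OF permutes_inv[OF \<sigma>]])
  then have "path_relation (inv_into UNIV \<sigma> ` J) \<in> W" by (rule J)
  then show "sym_act (free_operad postlie_s2) 3 \<sigma> (tree_class postlie_s2 3 p) \<in> W"
    using path_relation_act[OF \<sigma>, of J] subspace_ofD(4)[OF W] unfolding p'(1) by metis
qed

section \<open>The isomorphism\<close>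

primrec comp3_inputs :: "tree_type \<Rightarrow> nat \<times> nat \<times> nat" where
  "comp3_inputs Type_I = (1, 2, 3)"
| "comp3_inputs Type_II = (2, 3, 1)"
| "comp3_inputs Type_III = (3, 1, 2)"

text \<open>The label function \<open>F\<close> is left open so that \<open>path_label\<close> and
  \<open>hat_label\<close> are evaluated on the very same pair of leaf sets.\<close>

definition outer_dir :: "(nat set \<Rightarrow> nat set \<Rightarrow> 'a) \<Rightarrow> tree_type \<Rightarrow> 'a" where
  "outer_dir F u = (case comp3_inputs u of (a, b, c) \<Rightarrow> F {a, b} {c})"

definition inner_dir :: "(nat set \<Rightarrow> nat set \<Rightarrow> 'a) \<Rightarrow> tree_type \<Rightarrow> 'a" where
  "inner_dir F u = (case comp3_inputs u of (a, b, c) \<Rightarrow> F {a} {b})"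

lemma comp3_tree_path:
  "path_tree J (comp3_tree u () ()) = comp3_tree u (outer_dir (path_label J) u) (inner_dir (path_label J) u)"
  "tsu_tree V J (comp3_tree u v w) = comp3_tree u (outer_dir (hat_label V J) u v) (inner_dir (hat_label V J) u w)"
  by (cases u; simp add: outer_dir_def inner_dir_def hat_label_def)+

lemma map_comp3_tree: "map_ptree f (comp3_tree u v w) = comp3_tree u (f v) (f w)"
  by (cases u) auto

text \<open>Both sides are linear in \<open>r\<close>, so \<open>r\<close> may be a
  \<open>comp3\<close> of some type \<open>u\<close>. Then \<Psi> annihilates the two summands of
  the path relation whose type is not \<open>u\<close> and tensors the labels of the remaining one;
  these tensors are the images of the \<open>TSu\<close> labels under \<open>f\<close>.\<close>

lemma free_hom_tsu_map:
  fixes V :: "('k::field, 'v) s2_module"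
  assumes V: "s2_module V" and f: "f \<in> s2_hom (hat V) (black_s2 postlie_s2 V)"
    and label: "\<And>J L R v. v \<in> carrier V \<Longrightarrow> f (hat_label V J L R v) = black_tensor postlie_s2 V (path_label J L R) v"
    and r: "r \<in> carrier (free3 V)"
  shows "free_hom (black_s2 postlie_s2 V) f 3 (tsu_map V 3 J r) =
    black_map postlie_s2 V (pure_tensor (free3 postlie_s2) (free3 V) (path_relation J) r)"
proof -
  let ?P = "postlie_s2 :: ('k, _) s2_module"
  let ?B = "black_s2 ?P V" and ?\<Psi> = "black_map ?P V" and ?T = "pure_tensor (free3 ?P) (free3 V)"
  note P = postlie_s2_module[where ?'a='k]
  note B = black_s2_module[OF P V]
  note K = free_operad_vectorspace[OF B, of 3] and FV = free_operad_vectorspace[OF V, of 3]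
  interpret K: vectorspace class_ring "free3 ?B" by (rule K)
  interpret FP: vectorspace class_ring "free3 ?P" by (rule postlie_free3)
  have \<Psi>: "?\<Psi> \<in> linear_maps (tensor_vs (free3 ?P) (free3 V)) (free3 ?B)"
    "\<And>u u' v w v' w'. v' \<in> carrier V \<Longrightarrow> w' \<in> carrier V \<Longrightarrow>
      ?\<Psi> (?T (comp3 ?P u v w) (comp3 V u' v' w')) =
        (if u = u' then comp3 ?B u (black_tensor ?P V v v') (black_tensor ?P V w w') else \<zero>\<^bsub>free3 ?B\<^esub>)"
    using black_map_is_black_map[OF P V] by (auto simp: is_black_map_def)
  note T = pure_tensor_bilinear[OF postlie_free3 FV]
  note \<Psi>T = linear_maps_compose[OF bilinear_onD(1)[OF T] \<Psi>(1)]
  show ?thesis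
  proof (rule free3_linear_eq[OF V K _ _ _ r])
    show "(\<lambda>r. free_hom ?B f 3 (tsu_map V 3 J r)) \<in> linear_maps (free3 V) (free3 ?B)"
      by (rule linear_maps_compose[OF tsu_map_linear[OF V] operad_homD(1)[OF free_hom_operad_hom[OF hat_s2_module[OF V] B f]]])
    show "(\<lambda>r. ?\<Psi> (?T (path_relation J) r)) \<in> linear_maps (free3 V) (free3 ?B)"
      by (rule linear_maps_compose[OF bilinear_onD(2)[OF T path_relation_closed] \<Psi>(1)])
    fix u v w assume vw: "v \<in> carrier V" "w \<in> carrier V"
    define po where "po = (outer_dir (path_label J) :: _ \<Rightarrow> postlie_op \<Rightarrow>\<^sub>0 'k)"
    define pi where "pi = (inner_dir (path_label J) :: _ \<Rightarrow> postlie_op \<Rightarrow>\<^sub>0 'k)"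
    have labels: "f (outer_dir (hat_label V J) u v) = black_tensor ?P V (po u) v"
      "f (inner_dir (hat_label V J) u w) = black_tensor ?P V (pi u) w"
      unfolding po_def pi_def outer_dir_def inner_dir_def by (simp_all add: label vw split: prod.split)
    have c: "comp3 ?P u (po u) (pi u) \<in> carrier (free3 ?P)" for u by (rule comp3_closed[OF P]) simp_all
    have keys: "keys (single (comp3_tree u (po u) (pi u)) (1::'k)) \<subseteq> trees ?P 3" for u
      by (intro keys_single_subset comp3_tree_trees) simp_all
    have "path_relation J = comp3 ?P Type_I (po Type_I) (pi Type_I) \<oplus>\<^bsub>free3 ?P\<^esub> comp3 ?P Type_II (po Type_II) (pi Type_II)
        \<oplus>\<^bsub>free3 ?P\<^esub> comp3 ?P Type_III (po Type_III) (pi Type_III)"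
      unfolding path_relator_def comp3_tree_path(1) comp3_def po_def[symmetric] pi_def[symmetric]
      using linear_mapsD(2)[OF tree_class_linear[OF P], of _ 3] keys by (simp add: keys_add_subset del: keys_single comp3_tree.simps)
    then have "?\<Psi> (?T (path_relation J) (comp3 V u v w)) =
        ?\<Psi> (?T (comp3 ?P Type_I (po Type_I) (pi Type_I)) (comp3 V u v w)) \<oplus>\<^bsub>free3 ?B\<^esub>
        ?\<Psi> (?T (comp3 ?P Type_II (po Type_II) (pi Type_II)) (comp3 V u v w)) \<oplus>\<^bsub>free3 ?B\<^esub>
        ?\<Psi> (?T (comp3 ?P Type_III (po Type_III) (pi Type_III)) (comp3 V u v w))"
      using linear_mapsD(2)[OF \<Psi>T[OF comp3_closed[OF V vw]]] c by simp
    also have "\<dots> = comp3 ?B u (black_tensor ?P V (po u) v) (black_tensor ?P V (pi u) w)"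
    proof -
      have "comp3 ?B u (black_tensor ?P V (po u) v) (black_tensor ?P V (pi u) w) \<in> carrier (free3 ?B)"
        using vw bilinear_onD(3)[OF black_tensor_bilinear[OF P V]] by (intro comp3_closed[OF B]) auto
      then show ?thesis by (cases u) (simp_all add: \<Psi>(2) vw)
    qed
    also have "\<dots> = free_hom ?B f 3 (tsu_map V 3 J (comp3 V u v w))"
    proof -
      have t: "comp3_tree u v w \<in> trees V 3" by (rule comp3_tree_trees[OF vw])
      have "tsu_map V 3 J (comp3 V u v w) = tree_class (hat V) 3 (single (tsu_tree V J (comp3_tree u v w)) 1)"
        using tsu_map_class[OF V, of "single (comp3_tree u v w) 1" 3 J] t by (simp add: comp3_def)
      also have "free_hom ?B f 3 \<dots> = tree_class ?B 3 (single (map_ptree f (tsu_tree V J (comp3_tree u v w))) 1)"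
        using free_hom_class[OF hat_s2_module[OF V] B f, of "single (tsu_tree V J (comp3_tree u v w)) 1" 3]
          tsu_tree_trees[OF V t, of J] by simp
      finally show ?thesis
        by (simp add: comp3_tree_path(2) map_comp3_tree labels comp3_def)
    qed
    finally show "free_hom ?B f 3 (tsu_map V 3 J (comp3 V u v w)) = ?\<Psi> (?T (path_relation J) (comp3 V u v w))" ..
  qed
qed

theorem theorem3p7:
  fixes V :: "('k::field, 'v) s2_module"
    and R :: "('v ptree \<Rightarrow>\<^sub>0 'k) set set"
  assumes "s2_module V"
    and "vectorspace.fin_dim class_ring V"
    and "sym_submodule (free_operad V) 3 R"
  shows "operad_isomorphic
           (trisuccessor V (in_arity_3 R))
           (black_product postlie_s2 postlie_relations V R)"
proof -
  let ?P = "postlie_s2 :: ('k, _) s2_module"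
  let ?B = "black_s2 ?P V" and ?\<Psi> = "black_map ?P V" and ?T = "pure_tensor (free3 ?P) (free3 V)"
  let ?R = "\<lambda>n. {tsu_map V n J r | J r. r \<in> in_arity_3 R n \<and> J \<noteq> {} \<and> J \<subseteq> {1..n}}"
  let ?X = "{?T s r | s r. s \<in> postlie_relations \<and> r \<in> R}"
  let ?S = "in_arity_3 (?\<Psi> ` span_in (tensor_vs (free3 ?P) (free3 V)) ?X)"
  note V = assms(1) and P = postlie_s2_module[where ?'a='k]
  note H = hat_s2_module[OF V] and B = black_s2_module[OF P V]
  note FV = free_operad_vectorspace[OF V, of 3] and FH = free_operad_vectorspace[OF H, of 3]
    and FB = free_operad_vectorspace[OF B, of 3]
  have R: "R \<subseteq> carrier (free3 V)"
    using assms(3) subspace_ofD(1) by (auto simp: sym_submodule_def)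
  have rel: "subspace_of postlie_relations (free3 ?P)"
    unfolding postlie_relations_def by (rule span_in_subspace[OF postlie_free3 postlie_relation_generators_carrier])
  note T = pure_tensor_bilinear[OF postlie_free3 FV] and vsT = tensor_vs_vectorspace[OF postlie_free3 FV]
  have X: "?X \<subseteq> carrier (tensor_vs (free3 ?P) (free3 V))"
  proof clarify
    fix s r assume "s \<in> (postlie_relations :: (_ \<Rightarrow>\<^sub>0 'k) set set)" "r \<in> R"
    then show "?T s r \<in> carrier (tensor_vs (free3 ?P) (free3 V))"
      using R subspace_ofD(1)[OF rel] by (intro bilinear_onD(3)[OF T]) auto
  qed
  have \<Psi>: "?\<Psi> \<in> linear_maps (tensor_vs (free3 ?P) (free3 V)) (free3 ?B)"
    using black_map_is_black_map[OF P V] by (simp add: is_black_map_def)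
  obtain f g where f: "f \<in> s2_hom (hat V) ?B" and g: "g \<in> s2_hom ?B (hat V)"
    and gf: "\<And>x. x \<in> carrier (hat V) \<Longrightarrow> g (f x) = x" and fg: "\<And>y. y \<in> carrier ?B \<Longrightarrow> f (g y) = y"
    and label: "\<And>J L R v. v \<in> carrier V \<Longrightarrow> f (hat_label V J L R v) = black_tensor ?P V (path_label J L R) v"
    using hat_black_iso_ex[OF V] by (elim exE conjE)
      (rule that, assumption, assumption, erule (1) bspec, erule (1) bspec, (drule spec)+, erule (1) bspec)
  note F = free_hom_operad_hom[OF H B f] and G = free_hom_operad_hom[OF B H g]
  note FG = free_hom_inverse[OF H B f g gf] free_hom_inverse[OF B H g f fg]
  have tsu: "free_hom ?B f 3 (tsu_map V 3 J r) = ?\<Psi> (?T (path_relation J) r)" if "r \<in> carrier (free3 V)" for J r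
    by (rule free_hom_tsu_map[OF V f label that])
  have R_closed: "?R n \<subseteq> ops (free_operad (hat V)) n" for n
    using R linear_mapsD(1)[OF tsu_map_linear[OF V]] by (auto simp: in_arity_3_def split: if_splits)
  have S_closed: "?S n \<subseteq> ops (free_operad ?B) n" for n
    using linear_mapsD(1)[OF \<Psi>] span_in_carrier[OF vsT X] by (auto simp: in_arity_3_def)
  note ideal = generated_ideal_ideal[of "free_operad (hat V)" ?R, OF free_operad_operad[OF H] R_closed]
  show ?thesis
    unfolding trisuccessor_def black_product_def binary_operad_def
  proof (rule generated_quot_isomorphic[OF free_operad_operad[OF H] R_closed free_operad_operad[OF B] S_closed F G FG])
    \<comment> \<open>A generating relation of the trisuccessor goes to the image under \<Psi> of a
      single pure tensor, formed with a path relation.\<close>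
    fix n x assume "x \<in> ?R n"
    then obtain J r where x: "n = 3" "x = tsu_map V 3 J r" "r \<in> R" "J \<noteq> {}" "J \<subseteq> {1..3}"
      by (auto simp: in_arity_3_def split: if_splits)
    have "?T (path_relation J) r \<in> span_in (tensor_vs (free3 ?P) (free3 V)) ?X"
      by (rule span_in_superset[OF vsT X]) (use x path_relation_mem in blast)
    moreover have "free_hom ?B f n x = ?\<Psi> (?T (path_relation J) r)"
      using x(1-3) tsu[of r J] R by auto
    ultimately show "free_hom ?B f n x \<in> generated_ideal (free_operad ?B) ?S n"
      using x(1) by (intro generated_ideal_superset) (auto simp: in_arity_3_def)
  next
    fix n y assume "y \<in> ?S n"
    then obtain z where y: "n = 3" "y = ?\<Psi> z" "z \<in> span_in (tensor_vs (free3 ?P) (free3 V)) ?X"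
      by (auto simp: in_arity_3_def split: if_splits)
    let ?I = "generated_ideal (free_operad (hat V)) ?R 3"
    note I = operad_idealD(1)[OF ideal, of 3]
    note lin = linear_maps_compose[OF \<Psi> operad_homD(1)[OF G, of 3]]
    \<comment> \<open>For fixed \<open>r\<close> the condition is linear in \<open>s\<close> and so
      defines a subspace; it remains to treat path relations. For these the element in question is
      \<open>tsu_map V 3 J r\<close> itself, since the homomorphism induced by \<open>g\<close>
      undoes the one induced by \<open>f\<close>.\<close>
    have gen: "free_hom (hat V) g 3 (?\<Psi> (?T s r)) \<in> ?I" if s: "s \<in> postlie_relations" and r: "r \<in> R" for s r
    proof -
      have r': "r \<in> carrier (free3 V)" using r R by blast
      have "postlie_relations \<subseteq> {s \<in> carrier (free3 ?P). free_hom (hat V) g 3 (?\<Psi> (?T s r)) \<in> ?I}"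
      proof (rule postlie_relations_least[OF subspace_of_vimage[OF postlie_free3 FH linear_maps_compose[OF bilinear_onD(1)[OF T r'] lin] I]])
        fix J :: "nat set" assume J: "J \<noteq> {}" "J \<subseteq> {1..3}"
        have t: "tsu_map V 3 J r \<in> ?R 3" using r J by (auto simp: in_arity_3_def)
        have "free_hom (hat V) g 3 (?\<Psi> (?T (path_relation J) r)) = tsu_map V 3 J r"
          using FG(1)[of "tsu_map V 3 J r" 3] R_closed[of 3] t unfolding tsu[OF r', symmetric] by blast
        then show "path_relation J \<in> {s \<in> carrier (free3 ?P). free_hom (hat V) g 3 (?\<Psi> (?T s r)) \<in> ?I}"
          using generated_ideal_superset[where R="?R" and P="free_operad (hat V)", OF t] path_relation_closed[of J, where ?'k='k]
          by (simp only: mem_Collect_eq)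
      qed
      then show ?thesis using s by blast
    qed
    have "free_hom (hat V) g 3 (?\<Psi> z) \<in> ?I"
      by (rule linear_span_in[OF vsT FH lin X I _ y(3)]) (use gen in blast)
    then show "free_hom (hat V) g n y \<in> generated_ideal (free_operad (hat V)) ?R n" using y by simp
  qed
qed

end
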